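(* Let $H$, $\Gamma$, $d(\cdot\,;\cdot)$ and $B(x;r)$ be as in the context. For $x\in\mathbb R^{n+m}$, $r>0$, $\kappa\in(0,1]$ and a measurable set $B$ of finite positive measure write $\langle\varphi\rangle_B=|B|^{-1}\int_B\varphi$. I. If $n\ge2$, or if $n=1$ and $\delta_1\vee\delta_1'\in[0,1/2)$, then there exist $\lambda>0$ and $\kappa\in(0,1]$ such that \[ \int_{B(x;r)}\Gamma(\varphi)(y)\,dy\ \ge\ \lambda\,r^{-2}\int_{B(x;\kappa r)}\big(\varphi(y)-\langle\varphi\rangle_{B(x;\kappa r)}\big)^2dy \] for all $x\in\mathbb R^{n+m}$, all $r>0$ and all $\varphi\in C^1(\mathbb R^{n+m})$. II. If $n=1$ and $\delta_1\vee\delta_1'\in[1/2,1)$, then there are no $\lambda>0$ and $\kappa\in(0,1]$ for which the inequality in I holds for all $x\in\mathbb R^{1+m}$, $r>0$ and $\varphi\in C^1(\mathbb R^{1+m})$. III. If $n=1$ and $\delta_1\in[1/2,1)$, then there exist $\lambda>0$ and $\kappa\in(0,1]$ such that, for each choice of sign $\pm$, \[ \int_{B_\pm(x;r)}\Gamma(\varphi)(y)\,dy\ \ge\ \lambda\,r^{-2}\int_{B_\pm(x;\kappa r)}\big(\varphi(y)-\langle\varphi\rangle_{B_\pm(x;\kappa r)}\big)^2dy \] for all $x\in\Omega_\pm$, $r>0$ and $\varphi\in C^1(\mathbb R^{1+m})$.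
   Context: Let $n,m\ge1$ be integers, write $x=(x_1,x_2)\in\mathbb R^n\times\mathbb R^m=\mathbb R^{n+m}$ and let $|\cdot|$ denote Euclidean norms. For $a\ge0$ and real $\alpha,\alpha'$ set $a^{(\alpha,\alpha')}=a^\alpha$ if $a\le1$ and $a^{(\alpha,\alpha')}=a^{\alpha'}$ if $a\ge1$. Fix $\delta_1,\delta_1'\in[0,1)$ and $\delta_2,\delta_2'\ge0$; $a\vee b=\max(a,b)$. Let $C_\delta(x)$ be the block-diagonal matrix $|x_1|^{(2\delta_1,2\delta_1')}I_n\oplus|x_1|^{(2\delta_2,2\delta_2')}I_m$. Let $C=(c_{ij})$ be a real symmetric matrix of measurable functions on $\mathbb R^{n+m}$ such that $a\,C_\delta(x)\le C(x)\le a'\,C_\delta(x)$ (as quadratic forms) for almost every $x$, for some constants $a,a'>0$. Set $\Gamma(\varphi)=\sum_{i,j}c_{ij}(\partial_i\varphi)(\partial_j\varphi)$. $H$ is the positive self-adjoint operator associated with the closure of the form $h(\varphi)=\int\Gamma(\varphi)$, $\varphi\in C_c^\infty(\mathbb R^{n+m})$ (formally $H=-\sum\partial_ic_{ij}\partial_j$). The distance is $d(x;y)=\sup\{\psi(x)-\psi(y):\psi\in C^1(\mathbb R^{n+m}),\ \Gamma(\psi)\le1\}$, $B(x;r)=\{y:d(x;y)<r\}$, and $|B|$ is Lebesgue measure. When $n=1$: $\Omega_+=\{(x_1,x_2):x_1\ge0\}$, $\Omega_-=\{(x_1,x_2):x_1\le0\}$ and $B_\pm(x;r)=B(x;r)\cap\Omega_\pm$.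 *)

theory Defs
  imports "HOL-Analysis.Analysis"
begin

text \<open>Ambient space: R^(n+m) is rendered as the product type 'n \<times> 'm of two
  euclidean spaces with DIM('n) = n and DIM('m) = m; x1 = fst x, x2 = snd x.\<close>

text \<open>The piecewise power a^(alpha,alpha'), with the convention 0^0 = 1.\<close>
definition ppow :: "real \<Rightarrow> real \<Rightarrow> real \<Rightarrow> real" where
  "ppow t \<alpha> \<alpha>' = (if t \<le> 1 then (if t = 0 then (if \<alpha> = 0 then 1 else 0) else t powr \<alpha>)
                     else t powr \<alpha>')"

definition Qdelta :: "real \<Rightarrow> real \<Rightarrow> real \<Rightarrow> real \<Rightarrow>
    ('n::euclidean_space \<times> 'm::euclidean_space) \<Rightarrow> ('n \<times> 'm) \<Rightarrow> real" where
  "Qdelta \<delta>1 \<delta>1' \<delta>2 \<delta>2' x \<xi> =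
     ppow (norm (fst x)) (2*\<delta>1) (2*\<delta>1') * (norm (fst \<xi>))\<^sup>2
   + ppow (norm (fst x)) (2*\<delta>2) (2*\<delta>2') * (norm (snd \<xi>))\<^sup>2"

definition Qc :: "('a::euclidean_space \<Rightarrow> 'a \<Rightarrow> 'a \<Rightarrow> real) \<Rightarrow> 'a \<Rightarrow> 'a \<Rightarrow> real" where
  "Qc c x \<xi> = (\<Sum>i\<in>Basis. \<Sum>j\<in>Basis. c i j x * (\<xi> \<bullet> i) * (\<xi> \<bullet> j))"

definition coeff_ok :: "real \<Rightarrow> real \<Rightarrow> real \<Rightarrow> real \<Rightarrow> real \<Rightarrow> real \<Rightarrow>
    (('n::euclidean_space \<times> 'm::euclidean_space) \<Rightarrow> ('n \<times> 'm) \<Rightarrow> ('n \<times> 'm) \<Rightarrow> real) \<Rightarrow> bool" where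
  "coeff_ok a a' \<delta>1 \<delta>1' \<delta>2 \<delta>2' c \<longleftrightarrow>
     (\<forall>i\<in>Basis. \<forall>j\<in>Basis. c i j \<in> borel_measurable lebesgue \<and> (\<forall>x. c i j x = c j i x)) \<and>
     (AE x in lebesgue. \<forall>\<xi>. a * Qdelta \<delta>1 \<delta>1' \<delta>2 \<delta>2' x \<xi> \<le> Qc c x \<xi>
                          \<and> Qc c x \<xi> \<le> a' * Qdelta \<delta>1 \<delta>1' \<delta>2 \<delta>2' x \<xi>)"

definition C1_fun :: "('a::euclidean_space \<Rightarrow> real) \<Rightarrow> bool" where
  "C1_fun \<phi> \<longleftrightarrow> (\<forall>x. \<phi> differentiable (at x)) \<and>
                 (\<forall>v. continuous_on UNIV (\<lambda>x. frechet_derivative \<phi> (at x) v))"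

definition Gam :: "('a::euclidean_space \<Rightarrow> 'a \<Rightarrow> 'a \<Rightarrow> real) \<Rightarrow> ('a \<Rightarrow> real) \<Rightarrow> 'a \<Rightarrow> real" where
  "Gam c \<phi> x = (\<Sum>i\<in>Basis. \<Sum>j\<in>Basis.
      c i j x * frechet_derivative \<phi> (at x) i * frechet_derivative \<phi> (at x) j)"

definition dist_c :: "('a::euclidean_space \<Rightarrow> 'a \<Rightarrow> 'a \<Rightarrow> real) \<Rightarrow> 'a \<Rightarrow> 'a \<Rightarrow> ereal" where
  "dist_c c x y = (SUP \<psi> \<in> {\<psi>. C1_fun \<psi> \<and> (AE z in lebesgue. Gam c \<psi> z \<le> 1)}. ereal (\<psi> x - \<psi> y))"

definition ball_c :: "('a::euclidean_space \<Rightarrow> 'a \<Rightarrow> 'a \<Rightarrow> real) \<Rightarrow> 'a \<Rightarrow> real \<Rightarrow> 'a set" where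
  "ball_c c x r = {y. dist_c c x y < ereal r}"

definition avg :: "'a::euclidean_space set \<Rightarrow> ('a \<Rightarrow> real) \<Rightarrow> real" where
  "avg B \<phi> = (LINT y:B|lebesgue. \<phi> y) / measure lebesgue B"

definition poincare_at :: "('a::euclidean_space \<Rightarrow> 'a \<Rightarrow> 'a \<Rightarrow> real) \<Rightarrow> real \<Rightarrow> real \<Rightarrow>
    'a set \<Rightarrow> 'a set \<Rightarrow> ('a \<Rightarrow> real) \<Rightarrow> bool" where
  "poincare_at c lam r U V \<phi> \<longleftrightarrow>
     (\<integral>\<^sup>+ y\<in>U. ennreal (Gam c \<phi> y) \<partial>lebesgue)
       \<ge> ennreal (lam / r\<^sup>2) * (\<integral>\<^sup>+ y\<in>V. ennreal ((\<phi> y - avg V \<phi>)\<^sup>2) \<partial>lebesgue)"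

text \<open>Half spaces Omega_+ (s = True) and Omega_- (s = False), meant for DIM('n) = 1.\<close>
definition half :: "bool \<Rightarrow> ('n::euclidean_space \<times> 'm::euclidean_space) set" where
  "half s = {x. \<forall>i\<in>Basis. if s then 0 \<le> fst x \<bullet> i else fst x \<bullet> i \<le> 0}"

end

theory Submission
  imports Defs
begin

text \<open>The ball of radius \<open>r\<close> about \<open>x\<close> is sandwiched between multiples of a box: bump functions bound
  the distance from below, and paths that are radial in the first variable and change the second one
  only where \<open>norm (fst x)\<close> is comparable with the size of the box bound it from above. Hence it
  suffices to control the oscillation on boxes. Away from the degenerate set the weights are
  essentially constant and the Poincare inequality on convex sets applies. On a box centred on the
  degenerate set the outer part \<open>norm (fst x) \<ge> R/2\<close> is covered by convex slabs; the inner part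
  is absorbed by comparing \<open>\<phi> (x\<^sub>1, x\<^sub>2)\<close> with \<open>\<phi> (x\<^sub>1/2, x\<^sub>2)\<close>, which costs no more than the energy
  because \<open>t\<close> divided by its weight is increasing. What remains is to connect the slabs: for
  dimension at least two they overlap, on a half line there is only one, and on the line the
  reflection \<open>x\<^sub>1 \<mapsto> -x\<^sub>1\<close> is controlled by the same dilation argument with a singular weight, which
  is a contraction exactly if both exponents are below \<open>1/2\<close>. Otherwise the functions
  \<open>arsinh (x\<^sub>1/e) / arsinh (R/e)\<close> approximate the sign function with too little energy.\<close>

subsection \<open>Piecewise powers\<close>

text \<open>The distance is a supremum over test functions, so an upper bound on it has to be proved
  for every admissible function, and such a function is controlled only almost everywhere, by a
  gradient bound that may blow up at the degenerate set. What helps is that both exponents of the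
  first weight are below 1. Hence \<open>s powr (- D1)\<close> is integrable at 0, radial paths have
  finite length, and \<open>\<theta> R = R / w1 R\<close> increases from 0 to infinity, so that
  every radius is \<open>\<theta> R\<close> for some \<open>R\<close>. All estimates on boxes are
  expressed by \<open>\<theta> R\<close>, \<open>w1 R\<close> and \<open>w2 R\<close> and use one
  common exponent for small and large arguments; this makes the constants uniform in centre and
  radius. Absorbing a term into the left side presupposes that it is finite. That is a qualitative
  input: it comes from \<open>\<phi>\<close> being C1 on a bounded box, and the bound used for it
  never enters the constants. In the positive results the loss \<open>\<kappa>\<close> only reflects
  the mismatch \<open>k1 / k2\<close> between the inner and the outer box inclusion.\<close>

lemma ppow_nonneg: "0 \<le> ppow t \<alpha> \<alpha>'"
  by (simp add: ppow_def)

lemma ppow_pos: "0 < t \<Longrightarrow> 0 < ppow t \<alpha> \<alpha>'"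
  by (simp add: ppow_def)

lemma ppow_square: "ppow t (2 * \<alpha>) (2 * \<alpha>') = (ppow t \<alpha> \<alpha>')\<^sup>2"
  by (simp add: ppow_def power2_eq_square powr_add [symmetric])

lemma ppow_mono:
  assumes "0 \<le> s" "s \<le> t" "0 \<le> \<alpha>" "0 \<le> \<alpha>'"
  shows "ppow s \<alpha> \<alpha>' \<le> ppow t \<alpha> \<alpha>'"
proof -
  consider "s = 0" | "0 < s" "t \<le> 1" | "0 < s" "s \<le> 1" "1 < t" | "1 < s"
    using assms by linarith
  then show ?thesis
  proof cases
    case 1
    show ?thesis
    proof (cases "t \<le> 1")
      case True then show ?thesis using 1 by (simp add: ppow_def)
    next
      case False then show ?thesis using 1 assms by (simp add: ppow_def ge_one_powr_ge_zero)
    qed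
  next
    case 2
    then show ?thesis using assms by (simp add: ppow_def powr_mono2)
  next
    case 3
    have "s powr \<alpha> \<le> 1" using 3 assms by (simp add: powr_le1)
    moreover have "1 \<le> t powr \<alpha>'" using 3 assms by (simp add: ge_one_powr_ge_zero)
    ultimately show ?thesis using 3 by (simp add: ppow_def)
  next
    case 4
    then show ?thesis using assms by (simp add: ppow_def powr_mono2)
  qed
qed

text \<open>One exponent \<open>D\<close> above both \<open>\<alpha>\<close> and
  \<open>\<alpha>'\<close> gives one scaling law across the break at 1. When
  \<open>l * t \<le> 1 < t\<close>, the power \<open>D\<close> is inserted between the two: raising
  the exponent increases powers of \<open>t\<close> and decreases powers of
  \<open>l * t\<close>.\<close>

lemma ppow_scale:
  assumes "0 < l" "l \<le> 1" "0 < t" "\<alpha> \<le> D" "\<alpha>' \<le> D"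
  shows "l powr D * ppow t \<alpha> \<alpha>' \<le> ppow (l * t) \<alpha> \<alpha>'"
proof -
  have lt: "0 < l * t" "l * t \<le> t" using assms by (auto simp: mult_left_le_one_le)
  consider "t \<le> 1" | "1 < t" "l * t \<le> 1" | "1 < l * t" "1 < t"
    using lt by linarith
  then show ?thesis
  proof cases
    case 1
    have "l powr D * t powr \<alpha> \<le> l powr \<alpha> * t powr \<alpha>"
      using assms by (intro mult_right_mono powr_mono') auto
    moreover have "l * t \<le> 1" using 1 lt by linarith
    ultimately show ?thesis using 1 assms by (simp add: ppow_def powr_mult)
  next
    case 2
    have "l powr D * t powr \<alpha>' \<le> l powr D * t powr D"
      using assms 2 by (intro mult_left_mono powr_mono) auto
    also have "\<dots> = (l * t) powr D" using assms by (simp add: powr_mult)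
    also have "\<dots> \<le> (l * t) powr \<alpha>" using assms lt 2 by (intro powr_mono') auto
    finally show ?thesis using 2 lt assms by (simp add: ppow_def)
  next
    case 3
    have "l powr D * t powr \<alpha>' \<le> l powr \<alpha>' * t powr \<alpha>'"
      using assms by (intro mult_right_mono powr_mono') auto
    moreover have "\<not> t \<le> 1" "\<not> l * t \<le> 1" using 3 by auto
    ultimately show ?thesis using assms by (simp add: ppow_def powr_mult)
  qed
qed

text \<open>The reason why \<open>\<theta>\<close> is again a piecewise power. Its exponents
  \<open>1 - \<delta>1\<close> and \<open>1 - \<delta>1'\<close> are positive, hence it is
  increasing and onto the positive reals.\<close>

lemma ppow_divide_self: "0 < t \<Longrightarrow> t / ppow t \<alpha> \<alpha>' = ppow t (1 - \<alpha>) (1 - \<alpha>')"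
  by (simp add: ppow_def powr_diff)

lemma ppow_inverse:
  assumes "0 < r" "0 < \<alpha>" "0 < \<alpha>'"
  shows "\<exists>R>0. ppow R \<alpha> \<alpha>' = r"
proof (cases "r \<le> 1")
  case True
  have "r powr (1/\<alpha>) \<le> 1" using True assms by (intro powr_le1) auto
  then show ?thesis using assms
    by (intro exI [of _ "r powr (1/\<alpha>)"]) (simp add: ppow_def powr_powr)
next
  case False
  have "1 < r powr (1/\<alpha>')" using False assms by (intro gr_one_powr) auto
  then have "\<not> r powr (1/\<alpha>') \<le> 1" by linarith
  then show ?thesis using assms False
    by (intro exI [of _ "r powr (1/\<alpha>')"]) (simp add: ppow_def powr_powr)
qed

text \<open>Serves \<open>adm_energy\<close>, where an almost everywhere bound becomes pointwise.
  The branches agree at 1 and are glued along two relatively closed pieces of the open half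
  line.\<close>

lemma isCont_ppow:
  assumes "0 < t"
  shows "isCont (\<lambda>t. ppow t \<alpha> \<alpha>') t"
proof -
  have eq: "(if t \<le> 1 then t powr \<alpha> else t powr \<alpha>') = ppow t \<alpha> \<alpha>'" if "t \<in> {0<..}" for t
    using that by (auto simp: ppow_def)
  have "continuous_on ({0<..1} \<union> {1..}) (\<lambda>t::real. if t \<le> 1 then t powr \<alpha> else t powr \<alpha>')"
  proof (rule continuous_on_cases_local)
    show "closedin (top_of_set ({0<..1} \<union> {1..})) {0<..1::real}"
    proof -
      have "{0<..1::real} = ({0<..1} \<union> {1..}) \<inter> {..1}" by auto
      then show ?thesis by (metis closedin_closed_Int closed_atMost)
    qed
    show "closedin (top_of_set ({0<..1} \<union> {1..})) {1::real..}"
    proof -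
      have "{1::real..} = ({0<..1} \<union> {1..}) \<inter> {1..}" by auto
      then show ?thesis by (metis closedin_closed_Int closed_atLeast)
    qed
  qed (auto intro!: continuous_intros)
  moreover have "{0<..1} \<union> {1..} = {0::real<..}" by auto
  ultimately have "continuous_on {0<..} (\<lambda>t::real. if t \<le> 1 then t powr \<alpha> else t powr \<alpha>')"
    by simp
  then have "continuous_on {0<..} (\<lambda>t. ppow t \<alpha> \<alpha>')"
    by (rule continuous_on_cong [THEN iffD1, rotated 2]) (auto simp: eq)
  then show ?thesis using assms
    by (simp add: continuous_on_eq_continuous_at)
qed

lemma ppow_measurable [measurable]: "(\<lambda>t. ppow t \<alpha> \<alpha>') \<in> borel_measurable borel"
  unfolding ppow_def by measurable

subsection \<open>Gradients and path integrals\<close>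

text \<open>The partial derivatives form a vector here, so that \<open>Gam c \<phi> x\<close>
  becomes the form \<open>Qc c x\<close> at this vector and the ellipticity hypothesis applies to
  it.\<close>

definition grad :: "('a::euclidean_space \<Rightarrow> real) \<Rightarrow> 'a \<Rightarrow> 'a" where
  "grad \<phi> x = (\<Sum>i\<in>Basis. frechet_derivative \<phi> (at x) i *\<^sub>R i)"

lemma grad_eqI:
  assumes "(\<phi> has_derivative (\<lambda>v. g \<bullet> v)) (at x)"
  shows "grad \<phi> x = g"
proof -
  have "frechet_derivative \<phi> (at x) = (\<lambda>v. g \<bullet> v)"
    using frechet_derivative_at [OF assms] by simp
  then show ?thesis by (simp add: grad_def euclidean_representation)
qed

lemma grad_inner:
  assumes "\<phi> differentiable at x"
  shows "grad \<phi> x \<bullet> v = frechet_derivative \<phi> (at x) v"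
proof -
  have lin: "linear (frechet_derivative \<phi> (at x))"
    using assms by (rule linear_frechet_derivative)
  have "frechet_derivative \<phi> (at x) v = frechet_derivative \<phi> (at x) (\<Sum>i\<in>Basis. (v \<bullet> i) *\<^sub>R i)"
    by (simp add: euclidean_representation)
  also have "\<dots> = (\<Sum>i\<in>Basis. (v \<bullet> i) * frechet_derivative \<phi> (at x) i)"
    using lin by (simp add: linear_sum linear_cmul)
  also have "\<dots> = grad \<phi> x \<bullet> v"
    by (simp add: grad_def inner_sum_left inner_commute [of v] mult.commute)
  finally show ?thesis by simp
qed

lemma C1_fun_has_derivative:
  assumes "C1_fun \<phi>"
  shows "(\<phi> has_derivative (\<lambda>v. grad \<phi> x \<bullet> v)) (at x within S)"
proof -
  have d: "\<phi> differentiable at x" using assms by (simp add: C1_fun_def)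
  then have "(\<phi> has_derivative (\<lambda>v. grad \<phi> x \<bullet> v)) (at x)"
    unfolding grad_inner [OF d] by (simp add: frechet_derivative_works [symmetric])
  then show ?thesis by (rule has_derivative_at_withinI)
qed

lemma C1_fun_continuous_grad:
  assumes "C1_fun \<phi>"
  shows "continuous_on UNIV (grad \<phi>)"
  using assms unfolding C1_fun_def grad_def by (intro continuous_intros) auto

lemma C1_funI:
  assumes der: "\<And>x. (\<phi> has_derivative (\<lambda>v. g x \<bullet> v)) (at x)" and "continuous_on UNIV g"
  shows "C1_fun \<phi>"
proof -
  have "frechet_derivative \<phi> (at x) = (\<lambda>v. g x \<bullet> v)" for x
    using frechet_derivative_at [OF der] by simp
  then show ?thesis using assms
    by (auto simp: C1_fun_def differentiable_def intro!: continuous_intros)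
qed

lemma C1_fun_continuous: "C1_fun \<phi> \<Longrightarrow> continuous_on S \<phi>"
  by (meson C1_fun_has_derivative has_derivative_continuous continuous_at_imp_continuous_on)

lemma C1_fun_measurable: "C1_fun \<phi> \<Longrightarrow> \<phi> \<in> borel_measurable borel"
  by (simp add: C1_fun_continuous borel_measurable_continuous_onI)

lemma grad_measurable: "C1_fun \<phi> \<Longrightarrow> grad \<phi> \<in> borel_measurable borel"
  by (simp add: C1_fun_continuous_grad borel_measurable_continuous_onI)

lemma Gam_eq_Qc: "Gam c \<phi> x = Qc c x (grad \<phi> x)"
  by (simp add: Gam_def Qc_def grad_def inner_sum_left inner_Basis if_distrib cong: if_cong)

lemma C1_fun_vector_derivative_along:
  assumes "C1_fun \<phi>"
  shows "((\<lambda>s. \<phi> (x + s *\<^sub>R v)) has_real_derivative (grad \<phi> (x + s *\<^sub>R v) \<bullet> v)) (at s within S)"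
proof -
  have "((\<lambda>s. x + s *\<^sub>R v) has_derivative (\<lambda>h. h *\<^sub>R v)) (at s within S)"
    by (auto intro!: derivative_eq_intros)
  from diff_chain_within [OF this C1_fun_has_derivative [OF assms]]
  show ?thesis by (simp add: has_field_derivative_def o_def mult.commute [of _ "grad _ _ \<bullet> v"])
qed

text \<open>Cauchy-Schwarz on the unit interval, from integrating the nonnegative square of
  \<open>f s - I\<close>. The right side is an extended nonnegative integral, ready for
  Fubini.\<close>

lemma square_integral_le:
  fixes f :: "real \<Rightarrow> real"
  assumes "continuous_on {0..1} f" "(f has_integral I) {0..1}"
  shows "ennreal (I\<^sup>2) \<le> (\<integral>\<^sup>+s\<in>{0..1}. ennreal ((f s)\<^sup>2) \<partial>lborel)"
proof -
  have int2: "(\<lambda>s. (f s)\<^sup>2) integrable_on {0..1}"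
    using assms(1) by (intro integrable_continuous_real continuous_intros)
  define J where "J = integral {0..1} (\<lambda>s. (f s)\<^sup>2)"
  have J: "((\<lambda>s. (f s)\<^sup>2) has_integral J) {0..1}"
    using int2 by (simp add: J_def has_integral_integral)
  have "((\<lambda>s. (f s)\<^sup>2 - 2 * I * f s + I\<^sup>2) has_integral (J - 2 * I * I + I\<^sup>2)) {0..1}"
    using has_integral_add [OF has_integral_diff [OF J has_integral_mult_right [OF assms(2), of "2 * I"]]
        has_integral_const_real [of "I\<^sup>2" 0 1]]
    by simp
  moreover have "(f s)\<^sup>2 - 2 * I * f s + I\<^sup>2 \<ge> 0" for s
    using zero_le_power2 [of "f s - I"] by (simp add: power2_eq_square algebra_simps)
  ultimately have "0 \<le> J - 2 * I * I + I\<^sup>2" by (rule has_integral_nonneg)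
  then have "I\<^sup>2 \<le> J" by (simp add: power2_eq_square)
  have "((\<lambda>s. (f s)\<^sup>2 * indicator {0..1} s) has_integral J) UNIV"
    using J has_integral_restrict_UNIV [of "{0..1}" "\<lambda>s. (f s)\<^sup>2" J]
    by (simp add: indicator_def of_bool_def if_distrib cong: if_cong)
  moreover have "(\<lambda>s. (f s)\<^sup>2 * indicator {0..1} s) \<in> borel_measurable borel"
    using borel_measurable_continuous_on_indicator [of "{0..1}" "\<lambda>s. (f s)\<^sup>2"] assms(1)
    by (simp add: continuous_on_power mult.commute)
  ultimately have "(\<integral>\<^sup>+s. ennreal ((f s)\<^sup>2 * indicator {0..1} s) \<partial>lborel) = ennreal J"
    by (intro nn_integral_has_integral_lborel) auto
  moreover have "ennreal ((f s)\<^sup>2 * indicator {0..1} s) = ennreal ((f s)\<^sup>2) * indicator {0..1} s" for s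
    by (simp add: indicator_def)
  ultimately show ?thesis using \<open>I\<^sup>2 \<le> J\<close> by (simp add: ennreal_leI)
qed

lemma C1_fun_square_increment_le:
  assumes "C1_fun \<phi>"
  shows "ennreal ((\<phi> (x + v) - \<phi> x)\<^sup>2)
    \<le> (\<integral>\<^sup>+s\<in>{0..1}. ennreal ((grad \<phi> (x + s *\<^sub>R v) \<bullet> v)\<^sup>2) \<partial>lborel)"
proof (rule square_integral_le)
  show "continuous_on {0..1} (\<lambda>s. grad \<phi> (x + s *\<^sub>R v) \<bullet> v)"
    by (intro continuous_intros continuous_on_compose2 [OF C1_fun_continuous_grad [OF assms]]) auto
  show "((\<lambda>s. grad \<phi> (x + s *\<^sub>R v) \<bullet> v) has_integral \<phi> (x + v) - \<phi> x) {0..1}"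
    using fundamental_theorem_of_calculus [of 0 1 "\<lambda>s. \<phi> (x + s *\<^sub>R v)" "\<lambda>s. grad \<phi> (x + s *\<^sub>R v) \<bullet> v"]
      C1_fun_vector_derivative_along [OF assms]
    by (simp add: has_real_derivative_iff_has_vector_derivative [symmetric])
qed

section \<open>Diagonal changes of variables and averaging over segments\<close>

lemma nn_integral_lborel_diagonal:
  fixes F :: "'a::euclidean_space \<Rightarrow> ennreal" and c :: "'a \<Rightarrow> real"
  assumes [measurable]: "F \<in> borel_measurable borel" and c: "\<And>j. j \<in> Basis \<Longrightarrow> c j \<noteq> 0"
  shows "(\<integral>\<^sup>+x. F x \<partial>lborel)
    = ennreal (\<Prod>j\<in>Basis. \<bar>c j\<bar>) * (\<integral>\<^sup>+x. F (t + (\<Sum>j\<in>Basis. (c j * (x \<bullet> j)) *\<^sub>R j)) \<partial>lborel)"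
proof -
  have "(\<integral>\<^sup>+x. F x \<partial>lborel) = (\<integral>\<^sup>+x. F x \<partial>(density (distr lborel borel
      (\<lambda>x. t + (\<Sum>j\<in>Basis. (c j * (x \<bullet> j)) *\<^sub>R j))) (\<lambda>_. ennreal (\<Prod>j\<in>Basis. \<bar>c j\<bar>))))"
    using lborel_affine_euclidean [where c=c and t=t] c by simp
  also have "\<dots> = (\<integral>\<^sup>+x. ennreal (\<Prod>j\<in>Basis. \<bar>c j\<bar>) * F (t + (\<Sum>j\<in>Basis. (c j * (x \<bullet> j)) *\<^sub>R j)) \<partial>lborel)"
    by (simp add: nn_integral_density nn_integral_distr)
  also have "\<dots> = ennreal (\<Prod>j\<in>Basis. \<bar>c j\<bar>) * (\<integral>\<^sup>+x. F (t + (\<Sum>j\<in>Basis. (c j * (x \<bullet> j)) *\<^sub>R j)) \<partial>lborel)"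
    by (simp add: nn_integral_cmult)
  finally show ?thesis .
qed

text \<open>The Jacobian is a product of factors at least 1/2, so the inverse Jacobian costs at most
  \<open>2 ^ DIM('a)\<close>. For this reason paths are always cut so that no map contracts by more
  than one half.\<close>

lemma nn_integral_lborel_diagonal_le:
  fixes F :: "'a::euclidean_space \<Rightarrow> ennreal" and c :: "'a \<Rightarrow> real"
  assumes "F \<in> borel_measurable borel" and c: "\<And>j. j \<in> Basis \<Longrightarrow> 1/2 \<le> c j"
  shows "(\<integral>\<^sup>+x. F (t + (\<Sum>j\<in>Basis. (c j * (x \<bullet> j)) *\<^sub>R j)) \<partial>lborel)
    \<le> 2 ^ DIM('a) * (\<integral>\<^sup>+x. F x \<partial>lborel)"
proof -
  let ?I = "\<integral>\<^sup>+x. F (t + (\<Sum>j\<in>Basis. (c j * (x \<bullet> j)) *\<^sub>R j)) \<partial>lborel"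
  have "(\<Prod>j\<in>(Basis::'a set). (1/2::real)) \<le> (\<Prod>j\<in>Basis. \<bar>c j\<bar>)"
    by (rule prod_mono) (use c in fastforce)
  then have "1 \<le> 2 ^ DIM('a) * (\<Prod>j\<in>Basis. \<bar>c j\<bar>)"
    by (simp add: power_one_over divide_le_eq mult.commute)
  then have "1 * ?I \<le> ennreal (2 ^ DIM('a) * (\<Prod>j\<in>Basis. \<bar>c j\<bar>)) * ?I"
    by (intro mult_right_mono) (auto simp: ennreal_leI simp flip: ennreal_1)
  also have "\<dots> = 2 ^ DIM('a) * (ennreal (\<Prod>j\<in>Basis. \<bar>c j\<bar>) * ?I)"
    by (simp add: ennreal_mult' mult.assoc flip: ennreal_power)
  also have "ennreal (\<Prod>j\<in>Basis. \<bar>c j\<bar>) * ?I = (\<integral>\<^sup>+x. F x \<partial>lborel)"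
    using assms by (intro nn_integral_lborel_diagonal [symmetric]) fastforce+
  finally show ?thesis by simp
qed

text \<open>The squared increment is bounded by an integral over the segment from \<open>x\<close>
  to \<open>p x\<close>, and Fubini exchanges the two integrations. For fixed \<open>s\<close> the
  map from \<open>x\<close> to the point at time \<open>s\<close> is diagonal with entries
  \<open>1 - s + s * c j \<ge> 1/2\<close> and keeps \<open>S\<close> invariant, so each time slice
  costs at most \<open>2 ^ DIM('a)\<close>. The weight sits at the starting point;
  \<open>bound\<close> moves it to the point on the path.\<close>

lemma path_integral_bound:
  fixes \<phi> W G :: "'a::euclidean_space \<Rightarrow> real" and c :: "'a \<Rightarrow> real"
  assumes C1: "C1_fun \<phi>" and S [measurable]: "S \<in> sets borel"
    and c: "\<And>j. j \<in> Basis \<Longrightarrow> 1/2 \<le> c j \<and> c j \<le> 1"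
    and p: "\<And>x. p x = t + (\<Sum>j\<in>Basis. (c j * (x \<bullet> j)) *\<^sub>R j)"
    and W [measurable]: "W \<in> borel_measurable borel" and W0: "\<And>x. 0 \<le> W x"
    and G [measurable]: "G \<in> borel_measurable borel"
    and seg: "\<And>x s. x \<in> S \<Longrightarrow> 0 \<le> s \<Longrightarrow> s \<le> 1 \<Longrightarrow> x + s *\<^sub>R (p x - x) \<in> S"
    and bound: "\<And>x s. x \<in> S \<Longrightarrow> 0 \<le> s \<Longrightarrow> s \<le> 1 \<Longrightarrow>
       W x * (grad \<phi> (x + s *\<^sub>R (p x - x)) \<bullet> (p x - x))\<^sup>2 \<le> G (x + s *\<^sub>R (p x - x))"
  shows "(\<integral>\<^sup>+x\<in>S. ennreal (W x * (\<phi> (p x) - \<phi> x)\<^sup>2) \<partial>lborel)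
    \<le> 2 ^ DIM('a) * (\<integral>\<^sup>+x\<in>S. ennreal (G x) \<partial>lborel)"
proof -
  define H where "H z = ennreal (G z) * indicator S z" for z
  have H [measurable]: "H \<in> borel_measurable borel"
    unfolding H_def by measurable
  have [measurable]: "grad \<phi> \<in> borel_measurable borel"
    using C1 by (rule grad_measurable)
  have pm [measurable]: "p \<in> borel_measurable borel"
    unfolding p by measurable
  have "(\<integral>\<^sup>+x\<in>S. ennreal (W x * (\<phi> (p x) - \<phi> x)\<^sup>2) \<partial>lborel)
    \<le> (\<integral>\<^sup>+x. (\<integral>\<^sup>+s. H (x + s *\<^sub>R (p x - x)) * indicator {0..1::real} s \<partial>lborel) \<partial>lborel)"
  proof (rule nn_integral_mono)
    fix x :: 'a
    show "ennreal (W x * (\<phi> (p x) - \<phi> x)\<^sup>2) * indicator S x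
      \<le> (\<integral>\<^sup>+s. H (x + s *\<^sub>R (p x - x)) * indicator {0..1::real} s \<partial>lborel)"
    proof (cases "x \<in> S")
      case True
      have "ennreal (W x * (\<phi> (p x) - \<phi> x)\<^sup>2) = ennreal (W x) * ennreal ((\<phi> (x + (p x - x)) - \<phi> x)\<^sup>2)"
        using W0 by (simp add: ennreal_mult')
      also have "\<dots> \<le> ennreal (W x) *
          (\<integral>\<^sup>+s\<in>{0..1}. ennreal ((grad \<phi> (x + s *\<^sub>R (p x - x)) \<bullet> (p x - x))\<^sup>2) \<partial>lborel)"
        by (intro mult_left_mono C1_fun_square_increment_le C1) auto
      also have "\<dots> = (\<integral>\<^sup>+s. ennreal (W x) *
          (ennreal ((grad \<phi> (x + s *\<^sub>R (p x - x)) \<bullet> (p x - x))\<^sup>2) * indicator {0..1} s) \<partial>lborel)"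
        by (rule nn_integral_cmult [symmetric]) measurable
      also have "\<dots> \<le> (\<integral>\<^sup>+s. H (x + s *\<^sub>R (p x - x)) * indicator {0..1::real} s \<partial>lborel)"
      proof (rule nn_integral_mono)
        fix s :: real
        show "ennreal (W x) * (ennreal ((grad \<phi> (x + s *\<^sub>R (p x - x)) \<bullet> (p x - x))\<^sup>2) * indicator {0..1} s)
           \<le> H (x + s *\<^sub>R (p x - x)) * indicator {0..1} s"
          using bound [OF True, of s] seg [OF True, of s] W0 [of x]
          by (auto simp: indicator_def H_def ennreal_leI simp flip: ennreal_mult')
      qed
      finally show ?thesis using True by simp
    qed simp
  qed
  also have "\<dots> = (\<integral>\<^sup>+s. (\<integral>\<^sup>+x. H (x + s *\<^sub>R (p x - x)) * indicator {0..1::real} s \<partial>lborel) \<partial>lborel)"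
    by (rule lborel_pair.Fubini') measurable
  also have "\<dots> \<le> (\<integral>\<^sup>+s. 2 ^ DIM('a) * (\<integral>\<^sup>+x. H x \<partial>lborel) * indicator {0..1::real} s \<partial>lborel)"
  proof (rule nn_integral_mono)
    fix s :: real
    show "(\<integral>\<^sup>+x. H (x + s *\<^sub>R (p x - x)) * indicator {0..1} s \<partial>lborel)
      \<le> 2 ^ DIM('a) * (\<integral>\<^sup>+x. H x \<partial>lborel) * indicator {0..1} s"
    proof (cases "s \<in> {0..1}")
      case True
      have eq: "x + s *\<^sub>R (p x - x) = s *\<^sub>R t + (\<Sum>j\<in>Basis. ((1 - s + s * c j) * (x \<bullet> j)) *\<^sub>R j)" for x
        by (rule euclidean_eqI)
          (simp add: p inner_add_left inner_diff_left inner_sum_left_Basis; simp add: algebra_simps)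
      have "1/2 \<le> 1 - s + s * c j" if "j \<in> Basis" for j
      proof -
        have "s * (1 - c j) \<le> 1 * (1/2)" using True c [OF that] by (intro mult_mono) auto
        then show ?thesis by (simp add: algebra_simps)
      qed
      then have "(\<integral>\<^sup>+x. H (x + s *\<^sub>R (p x - x)) \<partial>lborel) \<le> 2 ^ DIM('a) * (\<integral>\<^sup>+x. H x \<partial>lborel)"
        unfolding eq by (intro nn_integral_lborel_diagonal_le H) auto
      then show ?thesis using True by simp
    qed simp
  qed
  also have "\<dots> = 2 ^ DIM('a) * (\<integral>\<^sup>+x. H x \<partial>lborel)"
    by (subst nn_integral_cmult) auto
  finally show ?thesis by (simp add: H_def)
qed

subsection \<open>Oscillation in mean square\<close>

lemma ennreal_le_combination:
  assumes "u \<le> \<alpha> * v + \<beta> * w" "0 \<le> \<alpha>" "0 \<le> \<beta>" "0 \<le> v" "0 \<le> w"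
  shows "ennreal u \<le> ennreal \<alpha> * ennreal v + ennreal \<beta> * ennreal w"
proof -
  have "ennreal u \<le> ennreal (\<alpha> * v + \<beta> * w)"
    using assms by (intro ennreal_leI)
  then show ?thesis using assms by (simp add: ennreal_mult' ennreal_plus)
qed

lemma set_nn_integral_le_combination:
  fixes u v w :: "'a \<Rightarrow> real"
  assumes [measurable]: "v \<in> borel_measurable M" "w \<in> borel_measurable M" "S \<in> sets M"
    and "0 \<le> \<alpha>" "0 \<le> \<beta>" and "\<And>x. 0 \<le> v x" "\<And>x. 0 \<le> w x"
    and le: "\<And>x. x \<in> S \<Longrightarrow> u x \<le> \<alpha> * v x + \<beta> * w x"
  shows "(\<integral>\<^sup>+x\<in>S. ennreal (u x) \<partial>M)
    \<le> ennreal \<alpha> * (\<integral>\<^sup>+x\<in>S. ennreal (v x) \<partial>M) + ennreal \<beta> * (\<integral>\<^sup>+x\<in>S. ennreal (w x) \<partial>M)"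
proof -
  have "(\<integral>\<^sup>+x\<in>S. ennreal (u x) \<partial>M) \<le>
     (\<integral>\<^sup>+x. ennreal \<alpha> * (ennreal (v x) * indicator S x) + ennreal \<beta> * (ennreal (w x) * indicator S x) \<partial>M)"
  proof (rule nn_integral_mono)
    fix x
    show "ennreal (u x) * indicator S x
      \<le> ennreal \<alpha> * (ennreal (v x) * indicator S x) + ennreal \<beta> * (ennreal (w x) * indicator S x)"
    proof (cases "x \<in> S")
      case True
      have "ennreal (u x) \<le> ennreal \<alpha> * ennreal (v x) + ennreal \<beta> * ennreal (w x)"
        using assms True by (intro ennreal_le_combination) auto
      then show ?thesis using True by simp
    qed simp
  qed
  also have "\<dots> = ennreal \<alpha> * (\<integral>\<^sup>+x\<in>S. ennreal (v x) \<partial>M) + ennreal \<beta> * (\<integral>\<^sup>+x\<in>S. ennreal (w x) \<partial>M)"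
    by (simp add: nn_integral_add nn_integral_cmult)
  finally show ?thesis .
qed

lemma set_nn_integral_cmult_ennreal:
  fixes f :: "'a \<Rightarrow> real"
  assumes [measurable]: "f \<in> borel_measurable M" "S \<in> sets M" and "0 \<le> k"
  shows "(\<integral>\<^sup>+x\<in>S. ennreal (k * f x) \<partial>M) = ennreal k * (\<integral>\<^sup>+x\<in>S. ennreal (f x) \<partial>M)"
proof -
  have "(\<integral>\<^sup>+x\<in>S. ennreal (k * f x) \<partial>M) = (\<integral>\<^sup>+x. ennreal k * (ennreal (f x) * indicator S x) \<partial>M)"
    using assms by (intro nn_integral_cong) (simp add: ennreal_mult' mult.assoc)
  then show ?thesis by (simp add: nn_integral_cmult)
qed

section \<open>Weighted squares, absorption, and the Poincare inequality on convex sets\<close>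

lemma square_add_le_weighted:
  fixes a b :: real
  assumes "0 < e"
  shows "(a + b)\<^sup>2 \<le> (1 + e) * a\<^sup>2 + (1 + 1/e) * b\<^sup>2"
proof -
  have "0 \<le> (e * a - b)\<^sup>2 / e" using assms by simp
  also have "(e * a - b)\<^sup>2 / e = e * a\<^sup>2 - 2 * a * b + b\<^sup>2 / e"
    using assms by (simp add: power2_eq_square field_simps)
  finally show ?thesis by (simp add: power2_eq_square algebra_simps)
qed

lemma square_diff_le_double: "((a::real) - c)\<^sup>2 \<le> 2 * (a - b)\<^sup>2 + 2 * (b - c)\<^sup>2"
  using square_add_le_weighted [of 1 "a - b" "b - c"] by simp

text \<open>Finiteness of \<open>X\<close> permits the subtraction; for infinite \<open>X\<close>
  the hypothesis on \<open>B\<close> would say nothing if \<open>\<mu> > 0\<close>.\<close>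

lemma ennreal_absorb:
  fixes X B :: ennreal
  assumes "X < \<infinity>" "X \<le> B + ennreal \<mu> * X" "0 \<le> \<mu>" "\<mu> < 1"
  shows "X \<le> ennreal (1 / (1 - \<mu>)) * B"
proof (cases B)
  case (real b)
  obtain x where x: "X = ennreal x" "0 \<le> x" using assms(1) by (cases X) auto
  have "ennreal x \<le> ennreal (b + \<mu> * x)"
    using assms x real by (simp add: ennreal_mult' ennreal_plus)
  then have "x \<le> b + \<mu> * x" using real x assms by (subst (asm) ennreal_le_iff) auto
  then have "x \<le> 1 / (1 - \<mu>) * b" using assms by (simp add: field_simps)
  then show ?thesis using real x assms
    by (simp add: ennreal_leI flip: ennreal_mult')
next
  case top
  then show ?thesis using assms by (simp add: ennreal_mult_top)
qed

abbreviation sq_dev :: "'a::euclidean_space set \<Rightarrow> ('a \<Rightarrow> real) \<Rightarrow> real \<Rightarrow> ennreal" where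
  "sq_dev S \<phi> m \<equiv> \<integral>\<^sup>+x\<in>S. ennreal ((\<phi> x - m)\<^sup>2) \<partial>lborel"

text \<open>The constant is left free instead of being the mean. It can thus be kept when passing to
  subsets or from one slab to another, and \<open>avg_minimizes\<close> brings in the mean at the
  very end.\<close>

definition osc_le :: "'a::euclidean_space set \<Rightarrow> ('a \<Rightarrow> real) \<Rightarrow> ennreal \<Rightarrow> bool" where
  "osc_le S \<phi> E \<longleftrightarrow> (\<exists>m. (sq_dev S \<phi> m) \<le> E)"

lemma osc_le_mono: "osc_le S \<phi> E \<Longrightarrow> E \<le> E' \<Longrightarrow> osc_le S \<phi> E'"
  unfolding osc_le_def by (meson order_trans)

text \<open>The increment from \<open>x\<close> to \<open>y\<close> is split at the midpoint, so that only contractions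
  towards one end point with ratio at least one half occur.\<close>

lemma convex_poincare:
  fixes \<phi> G :: "'a::euclidean_space \<Rightarrow> real"
  assumes C1: "C1_fun \<phi>" and S [measurable]: "S \<in> sets borel" and cv: "convex S"
    and fin: "emeasure lborel S < \<infinity>" and pos: "emeasure lborel S \<noteq> 0"
    and G [measurable]: "G \<in> borel_measurable borel"
    and bound: "\<And>x y z. x \<in> S \<Longrightarrow> y \<in> S \<Longrightarrow> z \<in> S \<Longrightarrow> (grad \<phi> z \<bullet> (x - y))\<^sup>2 \<le> G z"
  shows "osc_le S \<phi> (4 * 2 ^ DIM('a) * (\<integral>\<^sup>+x\<in>S. ennreal (G x) \<partial>lborel))"
proof -
  define I where "I = 2 ^ DIM('a) * (\<integral>\<^sup>+x\<in>S. ennreal (G x) \<partial>lborel)"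
  have [measurable]: "\<phi> \<in> borel_measurable borel" using C1 by (rule C1_fun_measurable)
  define mid where "mid x y = (1/2) *\<^sub>R x + (1/2) *\<^sub>R y" for x y :: 'a
  have mid_sym: "mid x y = mid y x" for x y by (simp add: mid_def add.commute)
  have half: "(\<integral>\<^sup>+x\<in>S. ennreal ((\<phi> (mid x y) - \<phi> x)\<^sup>2) \<partial>lborel) \<le> I" if y: "y \<in> S" for y
  proof -
    have "(\<integral>\<^sup>+x\<in>S. ennreal (1 * (\<phi> (mid x y) - \<phi> x)\<^sup>2) \<partial>lborel) \<le> I"
      unfolding I_def
    proof (rule path_integral_bound [OF C1 S, where c = "\<lambda>_. 1/2" and t = "(1/2) *\<^sub>R y"])
      fix x show "mid x y = (1/2) *\<^sub>R y + (\<Sum>j\<in>Basis. (1/2 * (x \<bullet> j)) *\<^sub>R j)"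
        by (rule euclidean_eqI) (simp add: mid_def inner_add_left)
    next
      fix x and s :: real assume x: "x \<in> S" and s: "0 \<le> s" "s \<le> 1"
      have "x + s *\<^sub>R (mid x y - x) = (1 - s/2) *\<^sub>R x + (s/2) *\<^sub>R y"
        by (rule euclidean_eqI) (simp add: mid_def inner_add_left inner_diff_left algebra_simps)
      then show "x + s *\<^sub>R (mid x y - x) \<in> S"
        using convexD [OF cv x y, of "1 - s/2" "s/2"] s by simp
      then have "(grad \<phi> (x + s *\<^sub>R (mid x y - x)) \<bullet> (y - x))\<^sup>2 \<le> G (x + s *\<^sub>R (mid x y - x))"
        using bound x y by blast
      moreover have "mid x y - x = (1/2) *\<^sub>R (y - x)"
        by (rule euclidean_eqI) (simp add: mid_def inner_add_left inner_diff_left algebra_simps)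
      then have "(grad \<phi> (x + s *\<^sub>R (mid x y - x)) \<bullet> (mid x y - x))\<^sup>2
         = 1/4 * (grad \<phi> (x + s *\<^sub>R (mid x y - x)) \<bullet> (y - x))\<^sup>2"
        by (simp add: power_divide)
      ultimately show "1 * (grad \<phi> (x + s *\<^sub>R (mid x y - x)) \<bullet> (mid x y - x))\<^sup>2
          \<le> G (x + s *\<^sub>R (mid x y - x))"
        using zero_le_power2 [of "grad \<phi> (x + s *\<^sub>R (mid x y - x)) \<bullet> (y - x)"] by linarith
    qed auto
    then show ?thesis by simp
  qed
  define D where "D x y = ennreal ((\<phi> (mid x y) - \<phi> x)\<^sup>2) * indicator S x" for x y
  have [measurable]: "case_prod mid \<in> borel_measurable (borel \<Otimes>\<^sub>M borel)" "mid x \<in> borel_measurable borel"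
    "(\<lambda>z. mid z x) \<in> borel_measurable borel" for x
    unfolding mid_def by measurable
  have [measurable]: "case_prod D \<in> borel_measurable (lborel \<Otimes>\<^sub>M lborel)"
    unfolding D_def by measurable
  define F where "F y = (\<integral>\<^sup>+x\<in>S. ennreal ((\<phi> x - \<phi> y)\<^sup>2) \<partial>lborel)" for y
  have [measurable]: "F \<in> borel_measurable lborel"
    unfolding F_def by measurable
  let ?J = "\<integral>\<^sup>+y. (\<integral>\<^sup>+x. D x y * indicator S y \<partial>lborel) \<partial>lborel"
  have J: "?J \<le> I * emeasure lborel S"
  proof -
    have "?J \<le> (\<integral>\<^sup>+y. I * indicator S y \<partial>lborel)"
      using half by (intro nn_integral_mono) (auto simp: D_def indicator_def)
    then show ?thesis by (simp add: nn_integral_cmult)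
  qed
  have "(\<integral>\<^sup>+y\<in>S. F y \<partial>lborel)
     \<le> (\<integral>\<^sup>+y. (\<integral>\<^sup>+x. 2 * (D x y * indicator S y) + 2 * (D y x * indicator S x) \<partial>lborel) \<partial>lborel)"
  proof (rule nn_integral_mono)
    fix y
    show "F y * indicator S y \<le> (\<integral>\<^sup>+x. 2 * (D x y * indicator S y) + 2 * (D y x * indicator S x) \<partial>lborel)"
    proof (cases "y \<in> S")
      case True
      have "(\<phi> x - \<phi> y)\<^sup>2 \<le> 2 * (\<phi> (mid x y) - \<phi> x)\<^sup>2 + 2 * (\<phi> (mid x y) - \<phi> y)\<^sup>2" for x
        using square_diff_le_double [of "\<phi> x" "\<phi> y" "\<phi> (mid x y)"]
        by (simp add: power2_commute [of "\<phi> x" "\<phi> (mid x y)"])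
      then have "ennreal ((\<phi> x - \<phi> y)\<^sup>2) \<le> 2 * ennreal ((\<phi> (mid x y) - \<phi> x)\<^sup>2) + 2 * ennreal ((\<phi> (mid x y) - \<phi> y)\<^sup>2)" for x
        using ennreal_le_combination [of _ 2 _ 2] by simp
      then show ?thesis using True
        by (auto simp: F_def D_def mid_sym [of y] indicator_def intro!: nn_integral_mono)
    qed simp
  qed
  also have "\<dots> = 2 * ?J + 2 * (\<integral>\<^sup>+y. (\<integral>\<^sup>+x. D y x * indicator S x \<partial>lborel) \<partial>lborel)"
    by (simp add: nn_integral_add nn_integral_cmult)
  also have "(\<integral>\<^sup>+y. (\<integral>\<^sup>+x. D y x * indicator S x \<partial>lborel) \<partial>lborel) = ?J"
    by (rule lborel_pair.Fubini') measurable
  also have "2 * ?J + 2 * ?J = 4 * ?J"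
    by (simp flip: distrib_right)
  also have "\<dots> \<le> 4 * (I * emeasure lborel S)"
    by (intro mult_left_mono J) auto
  finally have main: "(\<integral>\<^sup>+y\<in>S. F y \<partial>lborel) \<le> 4 * I * emeasure lborel S"
    by (simp add: mult.assoc)
  \<comment> \<open>The mean of \<open>F\<close> over \<open>S\<close> is at most
    \<open>4 * I\<close>. If all values of \<open>F\<close> exceeded \<open>4 * I\<close>, the
    integrals would compare strictly because \<open>S\<close> has positive measure. The point found
    supplies the constant \<open>\<phi> y\<close>.\<close>
  have "\<exists>y. F y \<le> 4 * I"
  proof (rule ccontr)
    assume "\<not> ?thesis"
    then have lt: "4 * I < F y" for y by (simp add: not_le)
    then have I4: "4 * I < \<infinity>"
      by (metis infinity_ennreal_def order_less_le_trans top_greatest)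
    have c: "(\<integral>\<^sup>+y. 4 * I * indicator S y \<partial>lborel) = 4 * I * emeasure lborel S"
      by (simp add: nn_integral_cmult)
    have "(\<integral>\<^sup>+y. 4 * I * indicator S y \<partial>lborel) < (\<integral>\<^sup>+y. F y * indicator S y \<partial>lborel)"
    proof (rule nn_integral_less)
      show "(\<integral>\<^sup>+y. 4 * I * indicator S y \<partial>lborel) \<noteq> \<infinity>"
        unfolding c using I4 fin by (simp add: ennreal_mult_less_top less_top [symmetric] ennreal_mult_eq_top_iff)
      show "AE y in lborel. 4 * I * indicator S y \<le> F y * indicator S y"
        using lt by (auto simp: indicator_def less_imp_le)
      show "\<not> (AE y in lborel. F y * indicator S y \<le> 4 * I * indicator S y)"
      proof
        assume "AE y in lborel. F y * indicator S y \<le> 4 * I * indicator S y"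
        then have "AE y in lborel. y \<notin> S"
          by (rule AE_mp) (auto intro!: AE_I2 simp: indicator_def not_le lt)
        then have "emeasure lborel S = 0"
          by (subst (asm) AE_iff_measurable [of S]) auto
        then show False using pos by simp
      qed
    qed measurable
    then show False using main c by simp
  qed
  then obtain y where "F y \<le> 4 * I" ..
  then show ?thesis unfolding osc_le_def F_def I_def by (auto simp: mult.assoc)
qed

subsection \<open>Dilations in the first variable\<close>

lemma ennreal_mult_mult: "0 \<le> a \<Longrightarrow> ennreal a * (ennreal b * X) = ennreal (a * b) * X"
  by (simp add: ennreal_mult' mult.assoc)

lemma fst_snd_borel [measurable]:
  shows "(fst :: 'n::euclidean_space \<times> 'm::euclidean_space \<Rightarrow> 'n) \<in> borel_measurable borel"
    and "(snd :: 'n::euclidean_space \<times> 'm::euclidean_space \<Rightarrow> 'm) \<in> borel_measurable borel"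
  by (intro borel_measurable_continuous_onI continuous_intros)+

text \<open>The test \<open>fst j = 0\<close> recognizes the basis vectors of the second factor.
  This puts the dilation into the diagonal form on which the change of variables is stated.\<close>

lemma fst_dilation_eq_sum:
  fixes x :: "'n::euclidean_space \<times> 'm::euclidean_space"
  shows "(a *\<^sub>R fst x, snd x) = (\<Sum>j\<in>Basis. ((if fst j = 0 then 1 else a) * (x \<bullet> j)) *\<^sub>R j)"
proof (rule euclidean_eqI)
  fix j :: "'n \<times> 'm" assume "j \<in> Basis"
  moreover from this have "(a *\<^sub>R fst x, snd x) \<bullet> j = (if fst j = 0 then 1 else a) * (x \<bullet> j)"
    by (auto simp: Basis_prod_def inner_prod_def)
  ultimately show "(a *\<^sub>R fst x, snd x) \<bullet> j
      = (\<Sum>j\<in>Basis. ((if fst j = 0 then 1 else a) * (x \<bullet> j)) *\<^sub>R j) \<bullet> j"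
    by (simp only: inner_sum_left_Basis)
qed

lemma prod_fst_dilation:
  "(\<Prod>j\<in>(Basis :: ('n::euclidean_space \<times> 'm::euclidean_space) set). \<bar>if fst j = 0 then 1 else a\<bar>)
    = \<bar>a :: real\<bar> ^ DIM('n)"
proof -
  have "(\<Prod>j\<in>(\<lambda>u. (u, 0::'m)) ` (Basis :: 'n set). \<bar>if fst j = 0 then 1 else a\<bar>) = \<bar>a\<bar> ^ DIM('n)"
  proof -
    have "(\<Prod>u\<in>(Basis :: 'n set). \<bar>if u = 0 then 1 else a\<bar>) = (\<Prod>u\<in>(Basis :: 'n set). \<bar>a\<bar>)"
      by (rule prod.cong) auto
    then show ?thesis by (subst prod.reindex) (auto simp: inj_on_def)
  qed
  moreover have "(\<Prod>j\<in>(\<lambda>v. (0::'n, v)) ` (Basis :: 'm set). \<bar>if fst j = 0 then 1 else a\<bar>) = 1"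
    by (intro prod.neutral) auto
  ultimately show ?thesis
    unfolding Basis_prod_def by (subst prod.union_disjoint) auto
qed

text \<open>Negative factors are included: \<open>a = 1/2\<close> is the dilation to be iterated by
  absorption, \<open>a = -1\<close> the reflection in the degenerate set.\<close>

lemma nn_integral_fst_dilation:
  fixes F :: "'n::euclidean_space \<times> 'm::euclidean_space \<Rightarrow> ennreal"
  assumes "F \<in> borel_measurable borel" "a \<noteq> 0"
  shows "(\<integral>\<^sup>+x. F x \<partial>lborel) = ennreal (\<bar>a\<bar> ^ DIM('n)) * (\<integral>\<^sup>+x. F (a *\<^sub>R fst x, snd x) \<partial>lborel)"
  using nn_integral_lborel_diagonal [OF assms(1), of "\<lambda>j. if fst j = 0 then 1 else a" 0] assms(2)
  by (simp add: prod_fst_dilation flip: fst_dilation_eq_sum)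

text \<open>At \<open>fst x = 0\<close> the weight is \<open>0\<close>, which is harmless since the increment vanishes there.\<close>

lemma dilation_increment:
  fixes \<phi> G :: "'n::euclidean_space \<times> 'm::euclidean_space \<Rightarrow> real"
  assumes C1: "C1_fun \<phi>" and S: "S \<in> sets borel" and G: "G \<in> borel_measurable borel"
    and star: "\<And>x s. x \<in> S \<Longrightarrow> 1/2 \<le> s \<Longrightarrow> s \<le> 1 \<Longrightarrow> (s *\<^sub>R fst x, snd x) \<in> S"
    and bound: "\<And>z. z \<in> S \<Longrightarrow> norm (fst z) powr \<beta> * (norm (fst (grad \<phi> z)))\<^sup>2 \<le> G z"
    and \<beta>: "0 \<le> \<beta>" "\<beta> \<le> 2"
  shows "(\<integral>\<^sup>+x\<in>S. ennreal (norm (fst x) powr (\<beta> - 2) * (\<phi> ((1/2) *\<^sub>R fst x, snd x) - \<phi> x)\<^sup>2) \<partial>lborel)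
    \<le> 2 ^ DIM('n \<times> 'm) * (\<integral>\<^sup>+x\<in>S. ennreal (G x) \<partial>lborel)"
proof (rule path_integral_bound [OF C1 S, where c = "\<lambda>j. if fst j = 0 then 1 else 1/2" and t = 0])
  fix x :: "'n \<times> 'm" and s :: real
  assume x: "x \<in> S" and s: "0 \<le> s" "s \<le> 1"
  define z where "z = x + s *\<^sub>R (((1/2) *\<^sub>R fst x, snd x) - x)"
  have z: "z = ((1 - s/2) *\<^sub>R fst x, snd x)"
    by (cases x) (simp add: z_def algebra_simps flip: scaleR_add_left)
  then show zS: "x + s *\<^sub>R (((1/2) *\<^sub>R fst x, snd x) - x) \<in> S"
    using star [OF x, of "1 - s/2"] s z_def by simp
  have "((1/2) *\<^sub>R fst x, snd x) - x = (- (1/2) *\<^sub>R fst x, 0)"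
    by (cases x) (simp add: algebra_simps flip: scaleR_add_left)
  then have "grad \<phi> z \<bullet> (((1/2) *\<^sub>R fst x, snd x) - x) = - (1/2) * (fst (grad \<phi> z) \<bullet> fst x)"
    by (simp add: inner_prod_def)
  then have sq: "(grad \<phi> z \<bullet> (((1/2) *\<^sub>R fst x, snd x) - x))\<^sup>2 = 1/4 * (fst (grad \<phi> z) \<bullet> fst x)\<^sup>2"
    by (simp add: power_mult_distrib power_divide)
  have "norm (fst x) powr (\<beta> - 2) * (1/4 * (fst (grad \<phi> z) \<bullet> fst x)\<^sup>2) \<le> G z"
  proof (cases "fst x = 0")
    case True
    have "0 \<le> norm (fst z) powr \<beta> * (norm (fst (grad \<phi> z)))\<^sup>2" by simp
    then show ?thesis using bound [of z] zS z_def True by simp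
  next
    case False
    have half: "norm (fst x) \<le> 2 * norm (fst z)"
    proof -
      have "1 * norm (fst x) \<le> (2 - s) * norm (fst x)"
        using s by (intro mult_right_mono) auto
      also have "\<dots> = 2 * norm (fst z)" using s by (simp add: z)
      finally show ?thesis by simp
    qed
    have "norm (fst x) powr (\<beta> - 2) * (1/4 * (fst (grad \<phi> z) \<bullet> fst x)\<^sup>2)
        \<le> norm (fst x) powr (\<beta> - 2) * (1/4 * (norm (fst (grad \<phi> z)) * norm (fst x))\<^sup>2)"
      by (intro mult_left_mono abs_le_square_iff [THEN iffD1]) (auto simp: Cauchy_Schwarz_ineq2)
    also have "\<dots> = 1/4 * (norm (fst x) powr (\<beta> - 2) * norm (fst x) powr 2) * (norm (fst (grad \<phi> z)))\<^sup>2"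
      using False by (simp add: power_mult_distrib)
    also have "norm (fst x) powr (\<beta> - 2) * norm (fst x) powr 2 = norm (fst x) powr \<beta>"
      by (subst powr_add [symmetric]) simp
    \<comment> \<open>The 1/4 from squaring a displacement of half the length pays for moving the
      weight from \<open>x\<close> to \<open>z\<close>: \<open>norm (fst x)\<close> is at most twice
      \<open>norm (fst z)\<close> and \<open>\<beta> \<le> 2\<close>.\<close>
    also have "1/4 * norm (fst x) powr \<beta> * (norm (fst (grad \<phi> z)))\<^sup>2
      \<le> norm (fst z) powr \<beta> * (norm (fst (grad \<phi> z)))\<^sup>2"
    proof (rule mult_right_mono)
      have "norm (fst x) powr \<beta> \<le> (2 * norm (fst z)) powr \<beta>"
        using half \<beta> by (intro powr_mono2) auto
      also have "\<dots> = 2 powr \<beta> * norm (fst z) powr \<beta>" by (simp add: powr_mult)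
      also have "\<dots> \<le> 2 powr 2 * norm (fst z) powr \<beta>"
        using \<beta> by (intro mult_right_mono powr_mono) auto
      finally show "1/4 * norm (fst x) powr \<beta> \<le> norm (fst z) powr \<beta>" by simp
    qed simp
    also have "\<dots> \<le> G z" using zS unfolding z_def by (rule bound)
    finally show ?thesis .
  qed
  then show "norm (fst x) powr (\<beta> - 2) *
      (grad \<phi> (x + s *\<^sub>R (((1/2) *\<^sub>R fst x, snd x) - x)) \<bullet> (((1/2) *\<^sub>R fst x, snd x) - x))\<^sup>2
      \<le> G (x + s *\<^sub>R (((1/2) *\<^sub>R fst x, snd x) - x))"
    by (simp only: sq flip: z_def)
next
  fix x :: "'n \<times> 'm"
  show "((1/2) *\<^sub>R fst x, snd x) = 0 + (\<Sum>j\<in>Basis. ((if fst j = 0 then 1 else 1/2) * (x \<bullet> j)) *\<^sub>R j)"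
    by (simp only: fst_dilation_eq_sum add_0)
qed (use G in auto)

text \<open>Dilation by \<open>1/2\<close> at least halves squared \<open>L\<^sup>2\<close>-norms, so the norm over the inner part
  \<open>{x \<in> S. (2 x\<^sub>1, x\<^sub>2) \<in> S}\<close> can be absorbed: no integrability of the inverse weight is needed.\<close>

lemma osc_le_fill:
  fixes \<phi> G :: "'n::euclidean_space \<times> 'm::euclidean_space \<Rightarrow> real"
  assumes C1: "C1_fun \<phi>" and S [measurable]: "S \<in> sets borel" and G: "G \<in> borel_measurable borel"
    and star: "\<And>x s. x \<in> S \<Longrightarrow> 1/2 \<le> s \<Longrightarrow> s \<le> 1 \<Longrightarrow> (s *\<^sub>R fst x, snd x) \<in> S"
    and bound: "\<And>z. z \<in> S \<Longrightarrow> (norm (fst z))\<^sup>2 * (norm (fst (grad \<phi> z)))\<^sup>2 \<le> G z"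
    and fin: "\<And>m. (sq_dev S \<phi> m) < \<infinity>"
    and osc: "osc_le {x \<in> S. (2 *\<^sub>R fst x, snd x) \<notin> S} \<phi> E"
  shows "osc_le S \<phi> (4 * E + 6 * 2 ^ DIM('n \<times> 'm) * (\<integral>\<^sup>+x\<in>S. ennreal (G x) \<partial>lborel))"
proof -
  define A where "A = {x \<in> S. (2 *\<^sub>R fst x, snd x) \<notin> S}"
  define H where "H = {x \<in> S. (2 *\<^sub>R fst x, snd x) \<in> S}"
  have [measurable]: "\<phi> \<in> borel_measurable borel" using C1 by (rule C1_fun_measurable)
  have [measurable]: "A \<in> sets borel" "H \<in> sets borel"
    unfolding A_def H_def by measurable
  obtain m where m: "(sq_dev A \<phi> m) \<le> E"
    using osc by (auto simp: osc_le_def A_def)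
  define X where "X = sq_dev S \<phi> m"
  define T where "T = (\<integral>\<^sup>+x\<in>S. ennreal ((\<phi> ((1/2) *\<^sub>R fst x, snd x) - \<phi> x)\<^sup>2) \<partial>lborel)"
  define J where "J = (\<integral>\<^sup>+x\<in>S. ennreal (G x) \<partial>lborel)"
  have T: "T \<le> 2 ^ DIM('n \<times> 'm) * J"
  proof -
    have "T = (\<integral>\<^sup>+x\<in>S. ennreal (norm (fst x) powr (2 - 2) * (\<phi> ((1/2) *\<^sub>R fst x, snd x) - \<phi> x)\<^sup>2) \<partial>lborel)"
      unfolding T_def
    proof (intro nn_integral_cong)
      fix x :: "'n \<times> 'm"
      have "(0, snd x) = x" if "fst x = 0" using that by (metis prod.collapse)
      then show "ennreal ((\<phi> ((1/2) *\<^sub>R fst x, snd x) - \<phi> x)\<^sup>2) * indicator S x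
        = ennreal (norm (fst x) powr (2 - 2) * (\<phi> ((1/2) *\<^sub>R fst x, snd x) - \<phi> x)\<^sup>2) * indicator S x"
        by (cases "fst x = 0") auto
    qed
    also have "\<dots> \<le> 2 ^ DIM('n \<times> 'm) * J" unfolding J_def
      by (rule dilation_increment [OF C1 S G star]) (use bound in \<open>auto simp: powr_numeral\<close>)
    finally show ?thesis .
  qed
  have "(sq_dev H \<phi> m)
    = ennreal (\<bar>1/2\<bar> ^ DIM('n)) * (\<integral>\<^sup>+x. ennreal ((\<phi> ((1/2) *\<^sub>R fst x, snd x) - m)\<^sup>2)
        * indicator H ((1/2) *\<^sub>R fst x, snd x) \<partial>lborel)"
    by (subst nn_integral_fst_dilation [where a = "1/2"]) auto
  also have "\<dots> = ennreal (\<bar>1/2\<bar> ^ DIM('n)) * (\<integral>\<^sup>+x\<in>S. ennreal ((\<phi> ((1/2) *\<^sub>R fst x, snd x) - m)\<^sup>2) \<partial>lborel)"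
    using star [of _ "1/2"]
    by (auto simp: H_def indicator_def intro!: arg_cong2 [where f = "(*)"] nn_integral_cong)
  \<comment> \<open>The Jacobian gives at most 1/2, so the weight \<open>1 + e\<close> in front of
    \<open>X\<close> has to stay below 2. The choice \<open>e = 1/2\<close> gives
    \<open>3/4\<close>, whence the factor 4 after absorption.\<close>
  also have "\<dots> \<le> ennreal (1/2) * (ennreal (1 + 1/2) * X + ennreal (1 + 1/(1/2)) * T)"
  proof (rule mult_mono)
    have "(1/2::real) ^ DIM('n) \<le> (1/2) ^ 1"
      by (intro power_decreasing) (auto simp: Suc_le_eq)
    then show "ennreal (\<bar>1/2\<bar> ^ DIM('n)) \<le> ennreal (1/2)" by (intro ennreal_leI) simp
    show "(\<integral>\<^sup>+x\<in>S. ennreal ((\<phi> ((1/2) *\<^sub>R fst x, snd x) - m)\<^sup>2) \<partial>lborel)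
        \<le> ennreal (1 + 1/2) * X + ennreal (1 + 1/(1/2)) * T"
      unfolding X_def T_def
    proof (rule set_nn_integral_le_combination)
      show "(\<phi> ((1/2) *\<^sub>R fst x, snd x) - m)\<^sup>2
          \<le> (1 + 1/2) * (\<phi> x - m)\<^sup>2 + (1 + 1/(1/2)) * (\<phi> ((1/2) *\<^sub>R fst x, snd x) - \<phi> x)\<^sup>2" for x
        using square_add_le_weighted [of "1/2" "\<phi> x - m" "\<phi> ((1/2) *\<^sub>R fst x, snd x) - \<phi> x"] by simp
    qed auto
  qed auto
  also have "\<dots> = ennreal (3/4) * X + ennreal (3/2) * T"
    by (subst distrib_left, subst (1 2) ennreal_mult_mult) simp_all
  finally have Hle: "(sq_dev H \<phi> m) \<le> ennreal (3/4) * X + ennreal (3/2) * T" .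
  have "X = (\<integral>\<^sup>+x. ennreal ((\<phi> x - m)\<^sup>2) * indicator A x + ennreal ((\<phi> x - m)\<^sup>2) * indicator H x \<partial>lborel)"
    unfolding X_def by (intro nn_integral_cong) (auto simp: A_def H_def indicator_def)
  also have "\<dots> = (sq_dev A \<phi> m) + (sq_dev H \<phi> m)"
    by (intro nn_integral_add) auto
  also have "\<dots> \<le> E + (ennreal (3/4) * X + ennreal (3/2) * T)"
    by (intro add_mono m Hle)
  finally have "X \<le> (E + ennreal (3/2) * T) + ennreal (3/4) * X" by (simp add: ac_simps)
  then have "X \<le> ennreal (1 / (1 - 3/4)) * (E + ennreal (3/2) * T)"
    by (rule ennreal_absorb [rotated]) (use fin in \<open>auto simp: X_def\<close>)
  also have "\<dots> = 4 * E + 6 * T"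
    by (subst distrib_left, subst ennreal_mult_mult) simp_all
  also have "\<dots> \<le> 4 * E + 6 * (2 ^ DIM('n \<times> 'm) * J)"
    by (intro add_left_mono mult_left_mono T) auto
  finally show ?thesis unfolding osc_le_def X_def J_def by (auto simp: mult.assoc)
qed

text \<open>The same absorption argument with the weight \<open>norm (fst x) powr (\<beta> - 2)\<close>, whose exponent is below
  \<open>-1\<close> exactly when \<open>\<beta> < 1\<close>; this is where the condition on the degeneracy exponents enters.\<close>

lemma reflection_increment:
  fixes \<phi> G :: "'n::euclidean_space \<times> 'm::euclidean_space \<Rightarrow> real"
  assumes n: "DIM('n) = 1"
    and C1: "C1_fun \<phi>" and S [measurable]: "S \<in> sets borel" and G [measurable]: "G \<in> borel_measurable borel"
    and star: "\<And>x s. x \<in> S \<Longrightarrow> 1/2 \<le> s \<Longrightarrow> s \<le> 1 \<Longrightarrow> (s *\<^sub>R fst x, snd x) \<in> S"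
    and refl: "\<And>x. x \<in> S \<Longrightarrow> (- fst x, snd x) \<in> S"
    and bound: "\<And>z. z \<in> S \<Longrightarrow> norm (fst z) powr \<beta> * (norm (fst (grad \<phi> z)))\<^sup>2 \<le> G z"
    and \<beta>: "0 \<le> \<beta>" "\<beta> < 1"
    and fin: "(\<integral>\<^sup>+x\<in>S. ennreal (norm (fst x) powr (\<beta> - 2) * (\<phi> x - \<phi> (- fst x, snd x))\<^sup>2) \<partial>lborel) < \<infinity>"
  shows "(\<integral>\<^sup>+x\<in>S. ennreal (norm (fst x) powr (\<beta> - 2) * (\<phi> x - \<phi> (- fst x, snd x))\<^sup>2) \<partial>lborel)
    \<le> ennreal (16 / (1 - 2 powr (\<beta> - 1))\<^sup>2) * 2 ^ DIM('n \<times> 'm) * (\<integral>\<^sup>+x\<in>S. ennreal (G x) \<partial>lborel)"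
proof -
  define w where "w x = norm (fst x) powr (\<beta> - 2)" for x :: "'n \<times> 'm"
  define g where "g x = \<phi> x - \<phi> (- fst x, snd x)" for x
  define h where "h x = ((1/2) *\<^sub>R fst x, snd x)" for x :: "'n \<times> 'm"
  define T where "T = (\<integral>\<^sup>+x\<in>S. ennreal (w x * (\<phi> (h x) - \<phi> x)\<^sup>2) \<partial>lborel)"
  define J where "J = (\<integral>\<^sup>+x\<in>S. ennreal (G x) \<partial>lborel)"
  define X where "X = (\<integral>\<^sup>+x\<in>S. ennreal (w x * (g x)\<^sup>2) \<partial>lborel)"
  \<comment> \<open>Doubling the first variable multiplies the weight by
    \<open>2 powr (\<beta> - 2)\<close>, and the substitution contributes a factor 2 in dimension
    one; \<open>\<mu>\<close> is the product.\<close>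
  define \<mu> where "\<mu> = 2 powr (\<beta> - 1)"
  have \<mu>: "0 < \<mu>" "\<mu> < 1" using \<beta> by (auto simp: \<mu>_def powr_less_one)
  \<comment> \<open>Chosen so that \<open>(1 + e) * \<mu>\<close> is the midpoint of
    \<open>\<mu>\<close> and 1, hence still below 1.\<close>
  define e where "e = (1 - \<mu>) / (2 * \<mu>)"
  have e: "0 < e" using \<mu> by (simp add: e_def)
  have [measurable]: "\<phi> \<in> borel_measurable borel" using C1 by (rule C1_fun_measurable)
  have [measurable]: "h \<in> borel_measurable borel" "w \<in> borel_measurable borel" "g \<in> borel_measurable borel"
    unfolding h_def w_def g_def by measurable
  have T: "T \<le> 2 ^ DIM('n \<times> 'm) * J"
    unfolding T_def J_def w_def h_def
    by (rule dilation_increment [OF C1 S G star bound]) (use \<beta> in auto)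
  \<comment> \<open>Both \<open>w\<close> and \<open>S\<close> are invariant under the reflection,
    so the increments of the reflected function have the same weighted norm.\<close>
  have T': "(\<integral>\<^sup>+x\<in>S. ennreal (w x * (\<phi> (- fst (h x), snd x) - \<phi> (- fst x, snd x))\<^sup>2) \<partial>lborel) = T"
  proof -
    have inv: "(- fst x, snd x) \<in> S \<longleftrightarrow> x \<in> S" for x
      using refl [of x] refl [of "(- fst x, snd x)"] by auto
    have "T = (\<integral>\<^sup>+x. ennreal (w (- fst x, snd x) * (\<phi> (h (- fst x, snd x)) - \<phi> (- fst x, snd x))\<^sup>2)
        * indicator S (- fst x, snd x) \<partial>lborel)"
      unfolding T_def by (subst nn_integral_fst_dilation [where a = "-1"]) auto
    then show ?thesis
      by (simp add: inv w_def h_def indicator_def)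
  qed
  define U where "U = (\<integral>\<^sup>+x\<in>S. ennreal (w x * (g (h x))\<^sup>2) \<partial>lborel)"
  have U: "U \<le> ennreal \<mu> * X"
  proof -
    define F where "F y = ennreal (w (2 *\<^sub>R fst y, snd y) * (g y)\<^sup>2) * indicator S (2 *\<^sub>R fst y, snd y)" for y
    have [measurable]: "F \<in> borel_measurable borel" unfolding F_def by measurable
    have "U = (\<integral>\<^sup>+x. F ((1/2) *\<^sub>R fst x, snd x) \<partial>lborel)"
      by (simp add: U_def F_def h_def)
    also have "\<dots> = ennreal 2 * (ennreal (1/2) * (\<integral>\<^sup>+x. F ((1/2) *\<^sub>R fst x, snd x) \<partial>lborel))"
      by (subst ennreal_mult_mult) simp_all
    also have "ennreal (1/2) * (\<integral>\<^sup>+x. F ((1/2) *\<^sub>R fst x, snd x) \<partial>lborel) = (\<integral>\<^sup>+y. F y \<partial>lborel)"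
      by (subst nn_integral_fst_dilation [where F = F and a = "1/2"]) (auto simp: n)
    also have "(\<integral>\<^sup>+y. F y \<partial>lborel) \<le> (\<integral>\<^sup>+y. ennreal (2 powr (\<beta> - 2)) * (ennreal (w y * (g y)\<^sup>2) * indicator S y) \<partial>lborel)"
    proof (rule nn_integral_mono)
      fix y :: "'n \<times> 'm"
      have "y \<in> S" if "(2 *\<^sub>R fst y, snd y) \<in> S" using star [OF that, of "1/2"] by simp
      moreover have "w (2 *\<^sub>R fst y, snd y) = 2 powr (\<beta> - 2) * w y"
        by (simp add: w_def powr_mult)
      ultimately show "F y \<le> ennreal (2 powr (\<beta> - 2)) * (ennreal (w y * (g y)\<^sup>2) * indicator S y)"
        by (auto simp: F_def indicator_def mult.assoc simp flip: ennreal_mult')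
    qed
    also have "\<dots> = ennreal (2 powr (\<beta> - 2)) * X"
      unfolding X_def by (rule nn_integral_cmult) measurable
    finally have "U \<le> ennreal 2 * (ennreal (2 powr (\<beta> - 2)) * X)" by (simp add: mult_left_mono)
    also have "\<dots> = ennreal \<mu> * X"
      unfolding \<mu>_def by (subst ennreal_mult_mult) (simp_all add: powr_diff)
    finally show ?thesis .
  qed
  define V where "V = (\<integral>\<^sup>+x\<in>S. ennreal (w x * (g x - g (h x))\<^sup>2) \<partial>lborel)"
  have V: "V \<le> 4 * T"
  proof -
    have "V \<le> ennreal 2 * T + ennreal 2 *
        (\<integral>\<^sup>+x\<in>S. ennreal (w x * (\<phi> (- fst (h x), snd x) - \<phi> (- fst x, snd x))\<^sup>2) \<partial>lborel)"
      unfolding V_def T_def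
    proof (rule set_nn_integral_le_combination)
      fix x
      have "(g x - g (h x))\<^sup>2 \<le> 2 * (\<phi> (h x) - \<phi> x)\<^sup>2 + 2 * (\<phi> (- fst (h x), snd x) - \<phi> (- fst x, snd x))\<^sup>2"
        using square_add_le_weighted [of 1 "\<phi> x - \<phi> (h x)" "\<phi> (- fst (h x), snd x) - \<phi> (- fst x, snd x)"]
        by (simp add: g_def h_def algebra_simps power2_commute [of "\<phi> x"])
      then have "w x * (g x - g (h x))\<^sup>2
          \<le> w x * (2 * (\<phi> (h x) - \<phi> x)\<^sup>2 + 2 * (\<phi> (- fst (h x), snd x) - \<phi> (- fst x, snd x))\<^sup>2)"
        by (intro mult_left_mono) (auto simp: w_def)
      then show "w x * (g x - g (h x))\<^sup>2 \<le> 2 * (w x * (\<phi> (h x) - \<phi> x)\<^sup>2)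
          + 2 * (w x * (\<phi> (- fst (h x), snd x) - \<phi> (- fst x, snd x))\<^sup>2)"
        by (simp add: algebra_simps)
    qed (auto simp: w_def)
    also have "\<dots> = 4 * T" unfolding T' by (simp flip: distrib_right)
    finally show ?thesis .
  qed
  have "X \<le> ennreal (1 + e) * U + ennreal (1 + 1/e) * V"
    unfolding X_def U_def V_def
  proof (rule set_nn_integral_le_combination)
    fix x
    have "w x * (g x)\<^sup>2 \<le> w x * ((1 + e) * (g (h x))\<^sup>2 + (1 + 1/e) * (g x - g (h x))\<^sup>2)"
      using square_add_le_weighted [OF e, of "g (h x)" "g x - g (h x)"]
      by (intro mult_left_mono) (auto simp: w_def)
    then show "w x * (g x)\<^sup>2 \<le> (1 + e) * (w x * (g (h x))\<^sup>2) + (1 + 1/e) * (w x * (g x - g (h x))\<^sup>2)"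
      by (simp add: algebra_simps)
  qed (use e in \<open>auto simp: w_def\<close>)
  also have "\<dots> \<le> ennreal (1 + e) * (ennreal \<mu> * X) + ennreal (1 + 1/e) * (4 * T)"
    by (intro add_mono mult_left_mono U V) auto
  also have "\<dots> = ennreal ((1 + \<mu>) / 2) * X + ennreal (4 * (1 + \<mu>) / (1 - \<mu>)) * T"
  proof -
    have "(1 + e) * \<mu> = (1 + \<mu>) / 2" using \<mu> by (simp add: e_def field_simps)
    moreover have "(1 + 1/e) * 4 = 4 * (1 + \<mu>) / (1 - \<mu>)"
    proof -
      have "1 + 1/e = (1 + \<mu>) / (1 - \<mu>)" using \<mu> by (simp add: e_def field_simps)
      then show ?thesis by simp
    qed
    moreover have "ennreal (1 + 1/e) * (4 * T) = ennreal ((1 + 1/e) * 4) * T"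
      using e ennreal_mult_mult [of "1 + 1/e" 4 T] by (simp only: ennreal_numeral) simp
    moreover have "ennreal (1 + e) * (ennreal \<mu> * X) = ennreal ((1 + e) * \<mu>) * X"
      using e by (intro ennreal_mult_mult) auto
    ultimately show ?thesis by (simp only:)
  qed
  finally have "X \<le> ennreal (4 * (1 + \<mu>) / (1 - \<mu>)) * T + ennreal ((1 + \<mu>) / 2) * X"
    by (simp add: add.commute)
  then have "X \<le> ennreal (1 / (1 - (1 + \<mu>) / 2)) * (ennreal (4 * (1 + \<mu>) / (1 - \<mu>)) * T)"
    by (rule ennreal_absorb [rotated]) (use fin \<mu> in \<open>auto simp: X_def g_def w_def\<close>)
  also have "\<dots> = ennreal (1 / (1 - (1 + \<mu>) / 2) * (4 * (1 + \<mu>) / (1 - \<mu>))) * T"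
    using \<mu> by (intro ennreal_mult_mult) auto
  also have "\<dots> \<le> ennreal (16 / (1 - \<mu>)\<^sup>2) * (2 ^ DIM('n \<times> 'm) * J)"
  proof (intro mult_mono T ennreal_leI)
    have "1 / (1 - (1 + \<mu>) / 2) * (4 * (1 + \<mu>) / (1 - \<mu>)) = 8 * (1 + \<mu>) / (1 - \<mu>)\<^sup>2"
      using \<mu> by (simp add: power2_eq_square field_simps)
    also have "\<dots> \<le> 16 / (1 - \<mu>)\<^sup>2"
      using \<mu> by (intro divide_right_mono) auto
    finally show "1 / (1 - (1 + \<mu>) / 2) * (4 * (1 + \<mu>) / (1 - \<mu>)) \<le> 16 / (1 - \<mu>)\<^sup>2" .
  qed auto
  finally show ?thesis
    unfolding X_def J_def w_def g_def \<mu>_def by (simp add: mult.assoc)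
qed

section \<open>Passing an approximating constant between overlapping sets\<close>

lemma combination_arith:
  fixes X Y k :: "'a::comm_semiring_1"
  shows "2 * Y + 2 * (k * (2 * Y + 2 * X)) = 4 * k * X + (2 + 4 * k) * Y"
  by (simp add: algebra_simps)

text \<open>Both \<open>m\<close> and \<open>m2\<close> approximate \<open>\<phi>\<close> on the
  common part \<open>S3\<close>, which bounds the difference \<open>m2 - m\<close> there. Being
  constant, the difference extends to \<open>S2\<close> at the price \<open>K\<close> of the ratio
  of measures. The same \<open>m\<close> serves in the conclusion, so transfers can be
  chained.\<close>

lemma osc_transfer:
  fixes \<phi> :: "'a::euclidean_space \<Rightarrow> real"
  assumes [measurable]: "\<phi> \<in> borel_measurable borel" "S2 \<in> sets borel" "S3 \<in> sets borel"
    and sub: "S3 \<subseteq> S1" "S3 \<subseteq> S2" and S1 [measurable]: "S1 \<in> sets borel"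
    and E1: "(sq_dev S1 \<phi> m) \<le> E1" and "osc_le S2 \<phi> E2"
    and K: "emeasure lborel S2 \<le> ennreal K * emeasure lborel S3" "0 \<le> K"
  shows "(sq_dev S2 \<phi> m) \<le> ennreal (4 * K) * E1 + ennreal (2 + 4 * K) * E2"
proof -
  obtain m2 where E2: "(sq_dev S2 \<phi> m2) \<le> E2"
    using assms by (auto simp: osc_le_def)
  have int_sub: "(\<integral>\<^sup>+x\<in>S3. f x \<partial>lborel) \<le> (\<integral>\<^sup>+x\<in>T. f x \<partial>lborel)" if "S3 \<subseteq> T" for T and f :: "'a \<Rightarrow> ennreal"
    using that by (intro nn_integral_mono) (auto simp: indicator_def)
  have "ennreal ((m2 - m)\<^sup>2) * emeasure lborel S3 = (\<integral>\<^sup>+x\<in>S3. ennreal ((m2 - m)\<^sup>2) \<partial>lborel)"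
    by (simp add: nn_integral_cmult)
  also have "\<dots> \<le> ennreal 2 * (sq_dev S3 \<phi> m2)
      + ennreal 2 * (sq_dev S3 \<phi> m)"
  proof (rule set_nn_integral_le_combination)
    show "(m2 - m)\<^sup>2 \<le> 2 * (\<phi> x - m2)\<^sup>2 + 2 * (\<phi> x - m)\<^sup>2" for x
      using square_diff_le_double [of m2 m "\<phi> x"] by (simp add: power2_commute [of m2 "\<phi> x"])
  qed auto
  also have "\<dots> \<le> ennreal 2 * E2 + ennreal 2 * E1"
    by (intro add_mono mult_left_mono order_trans [OF int_sub [OF sub(2)] E2]
        order_trans [OF int_sub [OF sub(1)] E1]) auto
  finally have S3: "ennreal ((m2 - m)\<^sup>2) * emeasure lborel S3 \<le> 2 * E2 + 2 * E1" by simp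
  have "(sq_dev S2 \<phi> m) \<le> ennreal 2 * (sq_dev S2 \<phi> m2)
      + ennreal 2 * (\<integral>\<^sup>+x\<in>S2. ennreal ((m2 - m)\<^sup>2) \<partial>lborel)"
    by (rule set_nn_integral_le_combination) (auto intro: square_diff_le_double)
  also have "(\<integral>\<^sup>+x\<in>S2. ennreal ((m2 - m)\<^sup>2) \<partial>lborel) = ennreal ((m2 - m)\<^sup>2) * emeasure lborel S2"
    by (simp add: nn_integral_cmult)
  also have "ennreal 2 * (sq_dev S2 \<phi> m2) + ennreal 2 * (ennreal ((m2 - m)\<^sup>2) * emeasure lborel S2)
      \<le> 2 * E2 + 2 * (ennreal K * (2 * E2 + 2 * E1))"
  proof -
    have "ennreal ((m2 - m)\<^sup>2) * emeasure lborel S2 \<le> ennreal ((m2 - m)\<^sup>2) * (ennreal K * emeasure lborel S3)"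
      by (intro mult_left_mono K) auto
    also have "\<dots> = ennreal K * (ennreal ((m2 - m)\<^sup>2) * emeasure lborel S3)" by (simp add: ac_simps)
    also have "\<dots> \<le> ennreal K * (2 * E2 + 2 * E1)" by (intro mult_left_mono S3) auto
    finally have "ennreal ((m2 - m)\<^sup>2) * emeasure lborel S2 \<le> ennreal K * (2 * E2 + 2 * E1)" .
    then have "ennreal 2 * (ennreal ((m2 - m)\<^sup>2) * emeasure lborel S2) \<le> ennreal 2 * (ennreal K * (2 * E2 + 2 * E1))"
      by (rule mult_left_mono) simp
    moreover have "ennreal 2 * (sq_dev S2 \<phi> m2) \<le> ennreal 2 * E2"
      by (rule mult_left_mono [OF E2]) simp
    ultimately show ?thesis using add_mono [of "ennreal 2 * _" "ennreal 2 * E2"] by (simp only: ennreal_numeral)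
  qed
  also have "\<dots> = (4 * ennreal K) * E1 + (2 + 4 * ennreal K) * E2"
    by (rule combination_arith)
  also have "4 * ennreal K = ennreal (4 * K)"
    using K(2) by (subst ennreal_mult') auto
  also have "2 + ennreal (4 * K) = ennreal (2 + 4 * K)"
    using K(2) by (subst ennreal_plus) auto
  finally show ?thesis .
qed

lemma numeral_mult_power_ennreal: "(numeral k * 2 ^ n :: ennreal) = ennreal (numeral k * 2 ^ n)"
proof -
  have "ennreal (numeral k * 2 ^ n) = ennreal (numeral k) * ennreal (2 ^ n)"
    by (rule ennreal_mult') simp
  also have "ennreal (2 ^ n) = ennreal 2 ^ n" by (rule ennreal_power [symmetric]) simp
  finally show ?thesis by (simp only: ennreal_numeral)
qed

section \<open>Finiteness on bounded sets and elementary properties of the oscillation\<close>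

lemma set_nn_integral_bounded_finite:
  fixes f :: "'a::euclidean_space \<Rightarrow> real"
  assumes S: "bounded S" "S \<in> sets borel" and le: "\<And>x. x \<in> S \<Longrightarrow> f x \<le> B"
  shows "(\<integral>\<^sup>+x\<in>S. ennreal (f x) \<partial>lborel) < \<infinity>"
proof -
  have "(\<integral>\<^sup>+x\<in>S. ennreal (f x) \<partial>lborel) \<le> (\<integral>\<^sup>+x. ennreal B * indicator S x \<partial>lborel)"
    using le by (intro nn_integral_mono) (auto simp: indicator_def ennreal_leI)
  also have "\<dots> = ennreal B * emeasure lborel S"
    using S by (simp add: nn_integral_cmult)
  also have "\<dots> < \<infinity>"
    using emeasure_bounded_finite [OF S(1)] by (simp add: ennreal_mult_less_top)
  finally show ?thesis .
qed

lemma osc_le_null: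
  assumes "emeasure lborel S = 0" "S \<in> sets borel"
  shows "osc_le S \<phi> E"
proof -
  have "S \<in> null_sets lborel" using assms by (simp add: null_sets_def)
  then show ?thesis by (simp add: osc_le_def nn_integral_null_set)
qed

lemma osc_le_subset:
  assumes "osc_le T \<phi> E" "S \<subseteq> T"
  shows "osc_le S \<phi> E"
proof -
  have "(sq_dev S \<phi> m) \<le> (sq_dev T \<phi> m)" for m
    using assms(2) by (intro nn_integral_mono) (auto simp: indicator_def)
  then show ?thesis using assms(1) unfolding osc_le_def by (meson order_trans)
qed

lemma continuous_bounded_on_bounded:
  fixes f :: "'a::euclidean_space \<Rightarrow> 'b::real_normed_vector"
  assumes "continuous_on UNIV f" "bounded S"
  obtains B where "0 \<le> B" "\<And>x. x \<in> S \<Longrightarrow> norm (f x) \<le> B"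
proof -
  have "compact (f ` closure S)"
    using assms by (intro compact_continuous_image continuous_on_subset [OF assms(1)])
      (auto simp: compact_closure)
  then have "bounded (f ` S)"
    by (meson bounded_subset closure_subset compact_imp_bounded image_mono)
  then obtain B where "\<forall>x\<in>S. norm (f x) \<le> B" by (auto simp: bounded_iff)
  then show ?thesis using that [of "max 0 B"] by (fastforce intro: max.coboundedI2)
qed

text \<open>Supplies the finiteness that \<open>osc_le_fill\<close> demands for its absorption
  step.\<close>

lemma square_oscillation_finite:
  fixes \<phi> :: "'a::euclidean_space \<Rightarrow> real"
  assumes "C1_fun \<phi>" "bounded S" "S \<in> sets borel"
  shows "(sq_dev S \<phi> m) < \<infinity>"
proof -
  have "continuous_on UNIV (\<lambda>x. (\<phi> x - m)\<^sup>2)"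
    by (intro continuous_intros C1_fun_continuous assms)
  then obtain B where "\<And>x. x \<in> S \<Longrightarrow> norm ((\<phi> x - m)\<^sup>2) \<le> B"
    using continuous_bounded_on_bounded assms by blast
  then show ?thesis
    using set_nn_integral_bounded_finite [OF assms(2,3), of "\<lambda>x. (\<phi> x - m)\<^sup>2" B] by simp
qed

lemma C1_fun_increment_le:
  fixes \<phi> :: "'a::euclidean_space \<Rightarrow> real"
  assumes "C1_fun \<phi>" "0 \<le> L" and le: "\<And>s. 0 < s \<Longrightarrow> s < 1 \<Longrightarrow> \<bar>grad \<phi> (x + s *\<^sub>R v) \<bullet> v\<bar> \<le> L"
  shows "\<bar>\<phi> (x + v) - \<phi> x\<bar> \<le> L"
proof -
  have "\<exists>z. 0 < z \<and> z < 1 \<and> \<phi> (x + 1 *\<^sub>R v) - \<phi> (x + 0 *\<^sub>R v) = (1 - 0) * (grad \<phi> (x + z *\<^sub>R v) \<bullet> v)"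
    using C1_fun_vector_derivative_along [OF assms(1), of x v] by (intro MVT2) auto
  then show ?thesis using le by auto
qed

subsection \<open>Slabs and corners\<close>

text \<open>A linear condition replaces \<open>R/2 \<le> norm (fst x)\<close>: for a unit coordinate
  vector \<open>i\<close> and positive \<open>R\<close> it implies this lower bound, and it
  preserves convexity, which a shell would not have.\<close>

definition slab :: "('n::euclidean_space \<times> 'm::euclidean_space) set \<Rightarrow> real \<Rightarrow> 'n \<Rightarrow> bool \<Rightarrow> ('n \<times> 'm) set" where
  "slab S R i b = {x \<in> S. if b then R/2 \<le> fst x \<bullet> i else fst x \<bullet> i \<le> - (R/2)}"

lemma slab_facts:
  fixes S :: "('n::euclidean_space \<times> 'm::euclidean_space) set"
  assumes "S \<in> sets borel" "convex S"
  shows "slab S R i b \<in> sets borel" "convex (slab S R i b)"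
proof -
  define T where "T = {x :: 'n \<times> 'm. if b then R/2 \<le> fst x \<bullet> i else fst x \<bullet> i \<le> - (R/2)}"
  have T: "T = (if b then {x. R/2 \<le> (i, 0) \<bullet> x} else {x. (i, 0) \<bullet> x \<le> - (R/2)})"
    by (auto simp: T_def inner_prod_def inner_commute)
  have "closed T" unfolding T
    by (cases b) (simp_all only: if_True if_False closed_halfspace_ge closed_halfspace_le)
  moreover have "convex T" unfolding T
    by (cases b) (simp_all only: if_True if_False convex_halfspace_ge convex_halfspace_le)
  moreover have "slab S R i b = S \<inter> T" by (auto simp: slab_def T_def)
  ultimately show "slab S R i b \<in> sets borel" "convex (slab S R i b)"
    using assms by (auto intro: convex_Int)
qed

lemma half_facts:
  shows "(half s :: ('n::euclidean_space \<times> 'm::euclidean_space) set) \<in> sets borel"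
    and "convex (half s :: ('n \<times> 'm) set)"
proof -
  have h: "half s = (\<Inter>i\<in>Basis. if s then {x. 0 \<le> (i, 0) \<bullet> x} else {x :: 'n \<times> 'm. (i, 0) \<bullet> x \<le> 0})"
    by (auto simp: half_def inner_prod_def inner_commute)
  have "closed (half s :: ('n \<times> 'm) set)" unfolding h
    by (cases s) (auto simp only: if_True if_False intro: closed_halfspace_le closed_halfspace_ge)
  then show "(half s :: ('n \<times> 'm) set) \<in> sets borel" by (rule borel_closed)
  show "convex (half s :: ('n \<times> 'm) set)" unfolding h
    by (cases s) (auto simp only: if_True if_False intro!: convex_INT convex_halfspace_le convex_halfspace_ge)
qed

lemma set_nn_integral_reflect:
  fixes \<phi> :: "'n::euclidean_space \<times> 'm::euclidean_space \<Rightarrow> ennreal"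
  assumes [measurable]: "\<phi> \<in> borel_measurable borel" "T \<in> sets borel"
  shows "(\<integral>\<^sup>+x\<in>{x. (- fst x, snd x) \<in> T}. \<phi> (- fst x, snd x) \<partial>lborel) = (\<integral>\<^sup>+x\<in>T. \<phi> x \<partial>lborel)"
proof -
  have "(\<integral>\<^sup>+x\<in>T. \<phi> x \<partial>lborel)
     = (\<integral>\<^sup>+x. \<phi> (- fst x, snd x) * indicator T (- fst x, snd x) \<partial>lborel)"
    by (subst nn_integral_fst_dilation [where a = "-1"]) auto
  then show ?thesis by (simp add: indicator_def)
qed

lemma emeasure_lborel_Times:
  fixes A :: "'n::euclidean_space set" and B :: "'m::euclidean_space set"
  assumes "A \<in> sets borel" "B \<in> sets borel"
  shows "emeasure lborel (A \<times> B) = emeasure lborel A * emeasure lborel B"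
  using assms by (simp add: lborel_prod [symmetric] lborel.emeasure_pair_measure_Times)

text \<open>An open cube of side \<open>R/2\<close> in the orthant with signs \<open>\<tau>\<close>.
  It meets the slab condition in every direction \<open>k\<close> with sign \<open>\<tau> k\<close>,
  so it provides the overlap of two slabs; it also locates the places where the counterexample is
  away from 0.\<close>

definition corner :: "('n::euclidean_space \<Rightarrow> bool) \<Rightarrow> real \<Rightarrow> 'n set" where
  "corner \<tau> R = box (\<Sum>k\<in>Basis. (if \<tau> k then R/2 else - R) *\<^sub>R k) (\<Sum>k\<in>Basis. (if \<tau> k then R else - (R/2)) *\<^sub>R k)"

lemma corner_facts:
  fixes \<tau> :: "'n::euclidean_space \<Rightarrow> bool"
  assumes R: "0 < R"
  shows "emeasure lborel (corner \<tau> R) = ennreal ((R/2) ^ DIM('n))"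
    and "x \<in> corner \<tau> R \<longleftrightarrow> (\<forall>i\<in>Basis. if \<tau> i then R/2 < x \<bullet> i \<and> x \<bullet> i < R else - R < x \<bullet> i \<and> x \<bullet> i < - (R/2))"
proof -
  have "(\<Prod>i\<in>(Basis :: 'n set). (if \<tau> i then R else - (R/2)) - (if \<tau> i then R/2 else - R)) = (\<Prod>i\<in>(Basis :: 'n set). R/2)"
    by (rule prod.cong) auto
  then show "emeasure lborel (corner \<tau> R) = ennreal ((R/2) ^ DIM('n))"
    unfolding corner_def using R
    by (subst emeasure_lborel_box) (auto simp: inner_diff_left cong: prod.cong)
  show "x \<in> corner \<tau> R \<longleftrightarrow> (\<forall>i\<in>Basis. if \<tau> i then R/2 < x \<bullet> i \<and> x \<bullet> i < R else - R < x \<bullet> i \<and> x \<bullet> i < - (R/2))"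
    unfolding corner_def mem_box by (rule ball_cong) auto
qed

subsection \<open>Weighted oscillation estimates near the degenerate set\<close>

locale grushin =
  fixes \<delta>1 \<delta>1' \<delta>2 \<delta>2' :: real
  assumes d1: "0 \<le> \<delta>1" "\<delta>1 < 1" "0 \<le> \<delta>1'" "\<delta>1' < 1" and d2: "0 \<le> \<delta>2" "0 \<le> \<delta>2'"
begin

definition "w1 t = ppow t \<delta>1 \<delta>1'"
definition "w2 t = ppow t \<delta>2 \<delta>2'"

text \<open>\<open>\<theta> R\<close> is comparable with the intrinsic distance of the sphere \<open>norm (fst x) = R\<close>
  from the degenerate set \<open>fst x = 0\<close>.\<close>

definition "\<theta> R = R / w1 R"
definition "D1 = max \<delta>1 \<delta>1'"
definition "D2 = max \<delta>2 \<delta>2'"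

text \<open>The density \<open>Gam\<close> for the model coefficients. By \<open>Gam_bounds\<close>
  it is comparable with \<open>Gam c \<phi>\<close> almost everywhere, so the analysis on boxes is
  independent of \<open>c\<close>.\<close>

definition energy :: "('n::euclidean_space \<times> 'm::euclidean_space \<Rightarrow> real) \<Rightarrow> 'n \<times> 'm \<Rightarrow> real" where
  "energy \<phi> z = (w1 (norm (fst z)))\<^sup>2 * (norm (fst (grad \<phi> z)))\<^sup>2
              + (w2 (norm (fst z)))\<^sup>2 * (norm (snd (grad \<phi> z)))\<^sup>2"

abbreviation energy_on :: "('n::euclidean_space \<times> 'm::euclidean_space \<Rightarrow> real) \<Rightarrow> ('n \<times> 'm) set \<Rightarrow> ennreal" where
  "energy_on \<phi> S \<equiv> \<integral>\<^sup>+x\<in>S. ennreal (energy \<phi> x) \<partial>lborel"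

section \<open>Scaling of the weights and of the intrinsic radius\<close>

lemma D: "0 \<le> D1" "D1 < 1" "0 \<le> D2"
  using d1 d2 by (auto simp: D1_def D2_def)

lemma w_pos: "0 < t \<Longrightarrow> 0 < w1 t" "0 < t \<Longrightarrow> 0 < w2 t"
  by (auto simp: w1_def w2_def ppow_pos)

lemma w_nonneg: "0 \<le> w1 t" "0 \<le> w2 t"
  by (auto simp: w1_def w2_def ppow_nonneg)

lemma w_mono: "0 \<le> s \<Longrightarrow> s \<le> t \<Longrightarrow> w1 s \<le> w1 t" "0 \<le> s \<Longrightarrow> s \<le> t \<Longrightarrow> w2 s \<le> w2 t"
  using d1 d2 by (auto simp: w1_def w2_def ppow_mono)

lemma w_scale:
  assumes "0 < l" "l \<le> 1" "0 < t"
  shows "l powr D1 * w1 t \<le> w1 (l * t)" "l powr D2 * w2 t \<le> w2 (l * t)"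
  using assms by (auto simp: w1_def w2_def D1_def D2_def intro!: ppow_scale)

lemma w_half:
  assumes "0 < t"
  shows "w1 t \<le> 2 * w1 (t/2)" "w2 t \<le> 2 powr D2 * w2 (t/2)"
proof -
  have "(1/2) powr 1 * w1 t \<le> (1/2) powr D1 * w1 t"
    using D w_nonneg by (intro mult_right_mono powr_mono') auto
  also have "\<dots> \<le> w1 (t/2)" using w_scale(1) [of "1/2" t] assms by simp
  finally show "w1 t \<le> 2 * w1 (t/2)" by simp
  have "(1/2) powr D2 * w2 t \<le> w2 (t/2)" using w_scale(2) [of "1/2" t] assms by simp
  then show "w2 t \<le> 2 powr D2 * w2 (t/2)" by (simp add: powr_divide field_simps)
qed

lemma \<theta>_pos: "0 < R \<Longrightarrow> 0 < \<theta> R"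
  by (simp add: \<theta>_def w_pos)

lemma \<theta>_w1: "0 < R \<Longrightarrow> \<theta> R * w1 R = R"
  using w_pos(1) [of R] by (simp add: \<theta>_def)

lemma \<theta>_mono: "0 < s \<Longrightarrow> s \<le> t \<Longrightarrow> \<theta> s \<le> \<theta> t"
  using d1 by (simp add: \<theta>_def w1_def ppow_divide_self ppow_mono)

lemma \<theta>_surj: "0 < r \<Longrightarrow> \<exists>R>0. \<theta> R = r"
proof -
  assume "0 < r"
  then obtain R where "0 < R" "ppow R (1 - \<delta>1) (1 - \<delta>1') = r"
    using ppow_inverse [of r "1 - \<delta>1" "1 - \<delta>1'"] d1 by auto
  then show ?thesis by (auto simp: \<theta>_def w1_def ppow_divide_self)
qed

lemma \<theta>_expand: "0 < R \<Longrightarrow> 1 \<le> l \<Longrightarrow> \<theta> (l * R) \<le> l * \<theta> R"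
  using w_mono(1) [of R "l * R"] w_pos(1) [of R]
  by (simp add: \<theta>_def frac_le)

text \<open>Since \<open>D1 < 1\<close>, the factor tends to 0 with \<open>l\<close>. In the
  negative result this places a fixed fraction of a box inside the ball shrunk by
  \<open>\<kappa>\<close>.\<close>

lemma \<theta>_shrink:
  assumes "0 < l" "l \<le> 1" "0 < R"
  shows "\<theta> (l * R) \<le> l powr (1 - D1) * \<theta> R"
proof -
  have "\<theta> (l * R) \<le> l * R / (l powr D1 * w1 R)"
    unfolding \<theta>_def using assms w_scale(1) [OF assms] w_pos
    by (intro frac_le) auto
  also have "\<dots> = l powr (1 - D1) * \<theta> R"
    using assms by (simp add: \<theta>_def powr_diff)
  finally show ?thesis .
qed

section \<open>Oscillation against energy on convex sets and under filling\<close>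

lemma energy_nonneg: "0 \<le> energy \<phi> z"
  by (simp add: energy_def)

lemma energy_measurable:
  assumes "C1_fun \<phi>"
  shows "energy \<phi> \<in> borel_measurable borel"
proof -
  have [measurable]: "grad \<phi> \<in> borel_measurable borel" using assms by (rule grad_measurable)
  show ?thesis unfolding energy_def w1_def w2_def by measurable
qed

text \<open>The assumptions say that \<open>S\<close> has intrinsic diameter of order
  \<open>r\<close> even with the smallest weights on \<open>S\<close>. Cauchy-Schwarz in each
  variable bounds the squared increment of the linearization at \<open>z\<close> by
  \<open>2 * r\<^sup>2 * energy \<phi> z\<close>. Null sets are treated apart because the
  approximating constant is found by averaging.\<close>

lemma osc_le_convex:
  fixes \<phi> :: "'n::euclidean_space \<times> 'm::euclidean_space \<Rightarrow> real"
  assumes C1: "C1_fun \<phi>" and S: "S \<in> sets borel" "convex S" "emeasure lborel S < \<infinity>"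
    and "0 \<le> r"
    and 1: "\<And>x y z. x \<in> S \<Longrightarrow> y \<in> S \<Longrightarrow> z \<in> S \<Longrightarrow> norm (fst x - fst y) \<le> r * w1 (norm (fst z))"
    and 2: "\<And>x y z. x \<in> S \<Longrightarrow> y \<in> S \<Longrightarrow> z \<in> S \<Longrightarrow> norm (snd x - snd y) \<le> r * w2 (norm (fst z))"
  shows "osc_le S \<phi> (ennreal (8 * 2 ^ DIM('n \<times> 'm) * r\<^sup>2) * (energy_on \<phi> S))"
proof (cases "emeasure lborel S = 0")
  case True
  then show ?thesis using S by (simp add: osc_le_null)
next
  case False
  have [measurable]: "energy \<phi> \<in> borel_measurable borel" "S \<in> sets borel"
    using energy_measurable C1 S by auto
  have "osc_le S \<phi> (4 * 2 ^ DIM('n \<times> 'm) * (\<integral>\<^sup>+x\<in>S. ennreal (2 * r\<^sup>2 * energy \<phi> x) \<partial>lborel))"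
  proof (rule convex_poincare [OF C1 S False])
    fix x y z assume S: "x \<in> S" "y \<in> S" "z \<in> S"
    define g where "g = grad \<phi> z"
    have a: "(fst g \<bullet> (fst x - fst y))\<^sup>2 \<le> r\<^sup>2 * ((w1 (norm (fst z)))\<^sup>2 * (norm (fst g))\<^sup>2)"
    proof -
      have "\<bar>fst g \<bullet> (fst x - fst y)\<bar> \<le> norm (fst g) * (r * w1 (norm (fst z)))"
        using 1 [OF S] Cauchy_Schwarz_ineq2 [of "fst g" "fst x - fst y"]
        by (meson mult_left_mono norm_ge_zero order_trans)
      then have "(fst g \<bullet> (fst x - fst y))\<^sup>2 \<le> (norm (fst g) * (r * w1 (norm (fst z))))\<^sup>2"
        by (rule abs_le_square_iff [THEN iffD1, OF order_trans]) simp
      then show ?thesis by (simp add: power_mult_distrib ac_simps)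
    qed
    have b: "(snd g \<bullet> (snd x - snd y))\<^sup>2 \<le> r\<^sup>2 * ((w2 (norm (fst z)))\<^sup>2 * (norm (snd g))\<^sup>2)"
    proof -
      have "\<bar>snd g \<bullet> (snd x - snd y)\<bar> \<le> norm (snd g) * (r * w2 (norm (fst z)))"
        using 2 [OF S] Cauchy_Schwarz_ineq2 [of "snd g" "snd x - snd y"]
        by (meson mult_left_mono norm_ge_zero order_trans)
      then have "(snd g \<bullet> (snd x - snd y))\<^sup>2 \<le> (norm (snd g) * (r * w2 (norm (fst z))))\<^sup>2"
        by (rule abs_le_square_iff [THEN iffD1, OF order_trans]) simp
      then show ?thesis by (simp add: power_mult_distrib ac_simps)
    qed
    have "(g \<bullet> (x - y))\<^sup>2 \<le> 2 * (fst g \<bullet> (fst x - fst y))\<^sup>2 + 2 * (snd g \<bullet> (snd x - snd y))\<^sup>2"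
      using square_add_le_weighted [of 1 "fst g \<bullet> (fst x - fst y)" "snd g \<bullet> (snd x - snd y)"]
      by (simp add: inner_prod_def)
    also have "\<dots> \<le> 2 * r\<^sup>2 * energy \<phi> z"
      using a b unfolding energy_def g_def by (simp add: distrib_left)
    finally show "(grad \<phi> z \<bullet> (x - y))\<^sup>2 \<le> 2 * r\<^sup>2 * energy \<phi> z" by (simp add: g_def)
  qed simp
  also have "(\<integral>\<^sup>+x\<in>S. ennreal (2 * r\<^sup>2 * energy \<phi> x) \<partial>lborel)
     = ennreal (2 * r\<^sup>2) * (energy_on \<phi> S)"
    by (subst nn_integral_cmult [symmetric]) (auto simp: ennreal_mult' mult.assoc)
  also have "4 * 2 ^ DIM('n \<times> 'm) * (ennreal (2 * r\<^sup>2) * (energy_on \<phi> S))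
    = ennreal (8 * 2 ^ DIM('n \<times> 'm) * r\<^sup>2) * (energy_on \<phi> S)"
    unfolding numeral_mult_power_ennreal by (subst ennreal_mult_mult) (simp_all add: ac_simps)
  finally show ?thesis .
qed

text \<open>Writing \<open>norm (fst z)\<close> as \<open>\<theta>\<close> times \<open>w1\<close>
  turns the unweighted dilation estimate into one by energy, with \<open>\<theta>\<close> bounded by
  its value at the edge. The factor \<open>l\<close> absorbs the difference between the norm and the
  half side \<open>R\<close> of a cube.\<close>

lemma osc_le_fill_energy:
  fixes \<phi> :: "'n::euclidean_space \<times> 'm::euclidean_space \<Rightarrow> real"
  assumes C1: "C1_fun \<phi>" and S: "S \<in> sets borel" "bounded S" and R: "0 < R" "1 \<le> l"
    and star: "\<And>x s. x \<in> S \<Longrightarrow> 1/2 \<le> s \<Longrightarrow> s \<le> 1 \<Longrightarrow> (s *\<^sub>R fst x, snd x) \<in> S"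
    and SR: "\<And>x. x \<in> S \<Longrightarrow> norm (fst x) \<le> l * R"
    and osc: "osc_le {x \<in> S. (2 *\<^sub>R fst x, snd x) \<notin> S} \<phi> (ennreal (c * (\<theta> R)\<^sup>2) * (energy_on \<phi> S))"
    and c: "0 \<le> c"
  shows "osc_le S \<phi> (ennreal ((4 * c + 6 * 2 ^ DIM('n \<times> 'm) * l\<^sup>2) * (\<theta> R)\<^sup>2) * (energy_on \<phi> S))"
proof -
  define J where "J = (energy_on \<phi> S)"
  have [measurable]: "energy \<phi> \<in> borel_measurable borel" "S \<in> sets borel"
    using energy_measurable C1 S by auto
  have "osc_le S \<phi> (4 * (ennreal (c * (\<theta> R)\<^sup>2) * J)
      + 6 * 2 ^ DIM('n \<times> 'm) * (\<integral>\<^sup>+x\<in>S. ennreal ((l * \<theta> R)\<^sup>2 * energy \<phi> x) \<partial>lborel))"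
    unfolding J_def
  proof (rule osc_le_fill [OF C1 S(1) _ star _ square_oscillation_finite [OF C1 S(2,1)] osc])
    fix z assume z: "z \<in> S"
    show "(norm (fst z))\<^sup>2 * (norm (fst (grad \<phi> z)))\<^sup>2 \<le> (l * \<theta> R)\<^sup>2 * energy \<phi> z"
    proof (cases "fst z = 0")
      case True
      then show ?thesis by (simp add: energy_nonneg)
    next
      case False
      then have p: "0 < norm (fst z)" by simp
      have "\<theta> (norm (fst z)) \<le> l * \<theta> R"
        using \<theta>_mono [OF p SR [OF z]] \<theta>_expand [OF R] by linarith
      then have "(\<theta> (norm (fst z)))\<^sup>2 \<le> (l * \<theta> R)\<^sup>2"
        using \<theta>_pos [OF p] by (intro power_mono) auto
      moreover have "(norm (fst z))\<^sup>2 = (\<theta> (norm (fst z)))\<^sup>2 * (w1 (norm (fst z)))\<^sup>2"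
        using \<theta>_w1 [OF p] by (simp flip: power_mult_distrib)
      ultimately have "(norm (fst z))\<^sup>2 * (norm (fst (grad \<phi> z)))\<^sup>2
          \<le> (l * \<theta> R)\<^sup>2 * ((w1 (norm (fst z)))\<^sup>2 * (norm (fst (grad \<phi> z)))\<^sup>2)"
        by (simp add: mult_right_mono mult.assoc [symmetric])
      also have "\<dots> \<le> (l * \<theta> R)\<^sup>2 * energy \<phi> z"
        by (intro mult_left_mono) (auto simp: energy_def)
      finally show ?thesis .
    qed
  qed auto
  also have "(\<integral>\<^sup>+x\<in>S. ennreal ((l * \<theta> R)\<^sup>2 * energy \<phi> x) \<partial>lborel) = ennreal ((l * \<theta> R)\<^sup>2) * J"
    unfolding J_def by (subst nn_integral_cmult [symmetric]) (auto simp: ennreal_mult' mult.assoc)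
  also have "4 * (ennreal (c * (\<theta> R)\<^sup>2) * J) + 6 * 2 ^ DIM('n \<times> 'm) * (ennreal ((l * \<theta> R)\<^sup>2) * J)
     = ennreal ((4 * c + 6 * 2 ^ DIM('n \<times> 'm) * l\<^sup>2) * (\<theta> R)\<^sup>2) * J"
  proof -
    have "4 * (ennreal (c * (\<theta> R)\<^sup>2) * J) = ennreal (4 * (c * (\<theta> R)\<^sup>2)) * J"
      using ennreal_mult_mult [of 4 "c * (\<theta> R)\<^sup>2" J] by (simp only: ennreal_numeral)
    moreover have "6 * 2 ^ DIM('n \<times> 'm) * (ennreal ((l * \<theta> R)\<^sup>2) * J) = ennreal (6 * 2 ^ DIM('n \<times> 'm) * (l * \<theta> R)\<^sup>2) * J"
      unfolding numeral_mult_power_ennreal by (rule ennreal_mult_mult) simp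
    moreover have "ennreal (4 * (c * (\<theta> R)\<^sup>2)) * J + ennreal (6 * 2 ^ DIM('n \<times> 'm) * (l * \<theta> R)\<^sup>2) * J
        = ennreal (4 * (c * (\<theta> R)\<^sup>2) + 6 * 2 ^ DIM('n \<times> 'm) * (l * \<theta> R)\<^sup>2) * J"
      using c by (subst ennreal_plus) (auto simp: distrib_right)
    moreover have "4 * (c * (\<theta> R)\<^sup>2) + 6 * 2 ^ DIM('n \<times> 'm) * (l * \<theta> R)\<^sup>2
        = (4 * c + 6 * 2 ^ DIM('n \<times> 'm) * l\<^sup>2) * (\<theta> R)\<^sup>2"
      by (simp add: power_mult_distrib algebra_simps)
    ultimately show ?thesis by (simp only:)
  qed
  finally show ?thesis unfolding J_def .
qed

text \<open>A cube in the first variable, so that its outer part is exactly covered by slabs in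
  coordinate directions. The radius in the second variable is what a path of duration
  \<open>\<theta> R\<close> covers at speed \<open>w2 R\<close>.\<close>

definition nbox :: "'m::euclidean_space \<Rightarrow> real \<Rightarrow> ('n::euclidean_space \<times> 'm) set" where
  "nbox y R = {x. (\<forall>i\<in>Basis. \<bar>fst x \<bullet> i\<bar> < R) \<and> dist y (snd x) < \<theta> R * w2 R}"

lemma nbox_eq:
  fixes y :: "'m::euclidean_space"
  shows "(nbox y R :: ('n::euclidean_space \<times> 'm) set) = box (- (R *\<^sub>R One)) (R *\<^sub>R One) \<times> ball y (\<theta> R * w2 R)"
proof -
  have "(\<forall>i\<in>Basis. \<bar>u \<bullet> i\<bar> < R) \<longleftrightarrow> u \<in> box (- (R *\<^sub>R One)) (R *\<^sub>R One)" for u :: 'n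
    by (auto simp: mem_box abs_less_iff; force)
  then show ?thesis by (auto simp: nbox_def)
qed

lemma nbox_facts:
  fixes y :: "'m::euclidean_space"
  shows "(nbox y R :: ('n::euclidean_space \<times> 'm) set) \<in> sets borel"
    "convex (nbox y R :: ('n \<times> 'm) set)" "bounded (nbox y R :: ('n \<times> 'm) set)"
  by (auto simp: nbox_eq intro!: borel_open open_Times convex_Times convex_box bounded_Times)

lemma nbox_star: "x \<in> nbox y R \<Longrightarrow> \<bar>s\<bar> \<le> 1 \<Longrightarrow> (s *\<^sub>R fst x, snd x) \<in> nbox y R"
  unfolding nbox_def by (auto simp: abs_mult intro: le_less_trans [OF mult_left_le_one_le])

lemma nbox_norm:
  fixes R :: real
  assumes "(x :: 'n::euclidean_space \<times> 'm::euclidean_space) \<in> nbox y R"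
  shows "norm (fst x) \<le> DIM('n) * R"
proof -
  have "norm (fst x) \<le> (\<Sum>i\<in>Basis. \<bar>fst x \<bullet> i\<bar>)" by (rule norm_le_l1)
  also have "\<dots> \<le> (\<Sum>i\<in>(Basis :: 'n set). R :: real)"
    using assms by (intro sum_mono) (auto simp: nbox_def less_imp_le)
  finally show ?thesis by simp
qed

text \<open>The constant of \<open>osc_le_convex\<close> with the diameters of a slab:
  \<open>2 * DIM('n) * R\<close> in the first variable, with another 2 for \<open>w1\<close> at half
  the radius, and twice the radius in the second, with \<open>2 powr D2\<close> for
  \<open>w2\<close>.\<close>

definition near_const :: "'n::euclidean_space itself \<Rightarrow> 'm::euclidean_space itself \<Rightarrow> real" where
  "near_const n m = 8 * 2 ^ DIM('n \<times> 'm) * (4 * DIM('n) + 2 * 2 powr D2)\<^sup>2"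

lemma near_const_nonneg: "0 \<le> near_const n m"
  by (simp add: near_const_def)

text \<open>On a slab \<open>norm (fst z) \<ge> R/2\<close>, so both weights are at least a fixed
  fraction of their values at \<open>R\<close>, and the convex estimate applies with a radius of
  order \<open>\<theta> R\<close>.\<close>

lemma slab_osc:
  fixes \<phi> :: "'n::euclidean_space \<times> 'm::euclidean_space \<Rightarrow> real"
  assumes C1: "C1_fun \<phi>" and S: "S \<in> sets borel" "convex S" "S \<subseteq> nbox y R"
    and i: "i \<in> Basis" and R: "0 < R"
  shows "osc_le (slab S R i b) \<phi> (ennreal (near_const TYPE('n) TYPE('m) * (\<theta> R)\<^sup>2)
    * (energy_on \<phi> S))"
proof -
  define k where "k = 4 * real DIM('n) + 2 * 2 powr D2"
  have k: "0 \<le> k" by (simp add: k_def)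
  have "osc_le (slab S R i b) \<phi> (ennreal (8 * 2 ^ DIM('n \<times> 'm) * (k * \<theta> R)\<^sup>2)
      * (energy_on \<phi> (slab S R i b)))"
  proof (rule osc_le_convex [OF C1 slab_facts [OF S(1,2)]])
    have "bounded (slab S R i b)"
      using S(3) by (intro bounded_subset [OF nbox_facts(3) [of y R]]) (auto simp: slab_def)
    then show "emeasure lborel (slab S R i b) < \<infinity>" by (rule emeasure_bounded_finite)
    show "0 \<le> k * \<theta> R" using k \<theta>_pos [OF R] by simp
    fix x z y' assume x: "x \<in> slab S R i b" and y': "y' \<in> slab S R i b" and z: "z \<in> slab S R i b"
    have xn: "x \<in> nbox y R" "y' \<in> nbox y R" using x y' S(3) by (auto simp: slab_def)
    have "R/2 \<le> \<bar>fst z \<bullet> i\<bar>" using z R by (auto simp: slab_def split: if_splits)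
    also have "\<dots> \<le> norm (fst z)" using i by (rule Basis_le_norm)
    finally have zR: "R/2 \<le> norm (fst z)" .
    have w1z: "w1 R \<le> 2 * w1 (norm (fst z))"
      using w_half(1) [OF R] w_mono(1) [OF _ zR] R by simp
    have "w2 R \<le> 2 powr D2 * w2 (R/2)" using w_half(2) [OF R] .
    also have "\<dots> \<le> 2 powr D2 * w2 (norm (fst z))"
      using w_mono(2) [OF _ zR] R by (intro mult_left_mono) auto
    finally have w2z: "w2 R \<le> 2 powr D2 * w2 (norm (fst z))" .
    have "norm (fst x - fst y') \<le> norm (fst x) + norm (fst y')" by (rule norm_triangle_ineq4)
    also have "\<dots> \<le> 2 * DIM('n) * R" using nbox_norm [OF xn(1)] nbox_norm [OF xn(2)] by simp
    also have "\<dots> = 2 * DIM('n) * \<theta> R * w1 R" using \<theta>_w1 [OF R] by (simp add: mult.assoc)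
    also have "\<dots> \<le> 2 * DIM('n) * \<theta> R * (2 * w1 (norm (fst z)))"
      using \<theta>_pos [OF R] w1z by (intro mult_left_mono) auto
    also have "\<dots> = (4 * DIM('n)) * \<theta> R * w1 (norm (fst z))" by simp
    also have "\<dots> \<le> k * \<theta> R * w1 (norm (fst z))"
      using \<theta>_pos [OF R] w_nonneg by (intro mult_right_mono) (auto simp: k_def)
    finally show "norm (fst x - fst y') \<le> k * \<theta> R * w1 (norm (fst z))" .
    have "norm (snd x - snd y') \<le> dist y (snd x) + dist y (snd y')"
      unfolding dist_norm by (metis dist_norm dist_triangle3)
    also have "\<dots> \<le> 2 * \<theta> R * w2 R" using xn by (auto simp: nbox_def)
    also have "\<dots> \<le> 2 * \<theta> R * (2 powr D2 * w2 (norm (fst z)))"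
      using \<theta>_pos [OF R] w2z by (intro mult_left_mono) auto
    also have "\<dots> = (2 * 2 powr D2) * \<theta> R * w2 (norm (fst z))" by simp
    also have "\<dots> \<le> k * \<theta> R * w2 (norm (fst z))"
      using \<theta>_pos [OF R] w_nonneg by (intro mult_right_mono) (auto simp: k_def)
    finally show "norm (snd x - snd y') \<le> k * \<theta> R * w2 (norm (fst z))" .
  qed
  moreover have "(energy_on \<phi> (slab S R i b)) \<le> (energy_on \<phi> S)"
    by (intro nn_integral_mono) (auto simp: slab_def indicator_def)
  moreover have "8 * 2 ^ DIM('n \<times> 'm) * (k * \<theta> R)\<^sup>2 = near_const TYPE('n) TYPE('m) * (\<theta> R)\<^sup>2"
    by (simp add: near_const_def k_def power_mult_distrib)
  ultimately show ?thesis using osc_le_mono [OF _ mult_left_mono] by auto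
qed

lemma near_osc_half:
  fixes \<phi> :: "'n::euclidean_space \<times> 'm::euclidean_space \<Rightarrow> real"
  assumes n: "DIM('n) = 1" and C1: "C1_fun \<phi>" and R: "0 < R"
  shows "osc_le (nbox y R \<inter> half s) \<phi>
    (ennreal ((4 * near_const TYPE('n) TYPE('m) + 6 * 2 ^ DIM('n \<times> 'm)) * (\<theta> R)\<^sup>2)
      * (energy_on \<phi> (nbox y R \<inter> half s)))"
proof -
  define S where "S = nbox y R \<inter> (half s :: ('n \<times> 'm) set)"
  obtain b :: 'n where b: "Basis = {b}" using n by (metis card_1_singletonE)
  have S: "S \<in> sets borel" "convex S" "bounded S" "S \<subseteq> nbox y R"
    using nbox_facts [of y R, where 'n = 'n] half_facts [of s, where 'n = 'n and 'm = 'm]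
    unfolding S_def by (auto intro: convex_Int bounded_Int)
  have "osc_le S \<phi> (ennreal ((4 * near_const TYPE('n) TYPE('m) + 6 * 2 ^ DIM('n \<times> 'm) * 1\<^sup>2) * (\<theta> R)\<^sup>2)
      * (energy_on \<phi> S))"
  proof (rule osc_le_fill_energy [OF C1 S(1,3) R])
    show "(t *\<^sub>R fst x, snd x) \<in> S" if "x \<in> S" "1/2 \<le> t" "t \<le> 1" for x t
      using that nbox_star [of x y R t]
      by (cases s) (auto simp: S_def half_def b zero_le_mult_iff mult_le_0_iff)
    show "norm (fst x) \<le> 1 * R" if "x \<in> S" for x
      using nbox_norm [of x y R] that by (simp add: S_def n)
    \<comment> \<open>Doubling the first variable respects the half space and the condition on
      \<open>snd x\<close>. A point that leaves \<open>S\<close> therefore violates the bound on its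
      single first coordinate.\<close>
    have "{x \<in> S. (2 *\<^sub>R fst x, snd x) \<notin> S} \<subseteq> slab S R b s"
    proof
      fix x assume x: "x \<in> {x \<in> S. (2 *\<^sub>R fst x, snd x) \<notin> S}"
      then have "(2 *\<^sub>R fst x, snd x) \<notin> nbox y R" "x \<in> nbox y R" "x \<in> half s"
        by (auto simp: S_def half_def b split: if_splits)
      then have "R \<le> 2 * \<bar>fst x \<bullet> b\<bar>" by (auto simp: nbox_def b abs_mult)
      then show "x \<in> slab S R b s"
        using x \<open>x \<in> half s\<close> by (cases s) (auto simp: slab_def half_def b)
    qed
    then show "osc_le {x \<in> S. (2 *\<^sub>R fst x, snd x) \<notin> S} \<phi>
       (ennreal (near_const TYPE('n) TYPE('m) * (\<theta> R)\<^sup>2) * (energy_on \<phi> S))"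
      using slab_osc [OF C1 S(1,2,4) _ R, of b s] b by (auto intro: osc_le_subset)
  qed (auto simp: near_const_nonneg)
  then show ?thesis by (simp add: S_def)
qed

text \<open>The factor from \<open>reflection_increment\<close> at \<open>\<beta> = 2 * D1\<close>;
  it grows without bound as \<open>D1\<close> tends to \<open>1/2\<close> from below.\<close>

definition refl_const :: "'n::euclidean_space itself \<Rightarrow> 'm::euclidean_space itself \<Rightarrow> real" where
  "refl_const n m = 16 / (1 - 2 powr (2 * D1 - 1))\<^sup>2 * 2 ^ DIM('n \<times> 'm)"

lemma refl_const_nonneg: "0 \<le> refl_const n m"
  by (simp add: refl_const_def)

text \<open>Scaling of \<open>w1\<close> bounds \<open>norm (fst z) powr \<beta>\<close>, with
  \<open>\<beta> = 2 * D1\<close>, by \<open>R powr \<beta> / (w1 R)\<^sup>2\<close> times the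
  squared weight, so \<open>reflection_increment\<close> applies. On the box the singular weight is
  at least \<open>R powr (\<beta> - 2)\<close>; dropping it leaves the factor
  \<open>R\<^sup>2 / (w1 R)\<^sup>2\<close>, the square of \<open>\<theta> R\<close>.\<close>

lemma nbox_reflection:
  fixes \<phi> :: "'n::euclidean_space \<times> 'm::euclidean_space \<Rightarrow> real"
  assumes n: "DIM('n) = 1" and D1: "D1 < 1/2" and C1: "C1_fun \<phi>" and R: "0 < R"
  shows "(\<integral>\<^sup>+x\<in>nbox y R. ennreal ((\<phi> x - \<phi> (- fst x, snd x))\<^sup>2) \<partial>lborel)
    \<le> ennreal (refl_const TYPE('n) TYPE('m) * (\<theta> R)\<^sup>2) * (energy_on \<phi> (nbox y R))"
proof -
  define S where "S = (nbox y R :: ('n \<times> 'm) set)"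
  define g where "g x = \<phi> x - \<phi> (- fst x, snd x)" for x
  define \<beta> where "\<beta> = 2 * D1"
  define J where "J = (energy_on \<phi> S)"
  have \<beta>: "0 \<le> \<beta>" "\<beta> < 1" using D D1 by (auto simp: \<beta>_def)
  have S [measurable]: "S \<in> sets borel" and bd: "bounded S" using nbox_facts by (auto simp: S_def)
  have [measurable]: "energy \<phi> \<in> borel_measurable borel" "\<phi> \<in> borel_measurable borel"
    using energy_measurable C1_fun_measurable C1 by auto
  have [measurable]: "g \<in> borel_measurable borel" unfolding g_def by measurable
  have nR: "norm (fst x) < R" if "x \<in> S" for x
  proof -
    obtain b :: 'n where b: "Basis = {b}" using n by (metis card_1_singletonE)
    have "norm (fst x) \<le> (\<Sum>i\<in>Basis. \<bar>fst x \<bullet> i\<bar>)" by (rule norm_le_l1)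
    then have "norm (fst x) \<le> \<bar>fst x \<bullet> b\<bar>" unfolding b by simp
    then show ?thesis using that by (auto simp: S_def nbox_def b)
  qed
  have star: "(s *\<^sub>R fst x, snd x) \<in> S" if "x \<in> S" "\<bar>s\<bar> \<le> 1" for x s
    using nbox_star that unfolding S_def by blast
  have refl: "(- fst x, snd x) \<in> S" if "x \<in> S" for x
    using star [OF that, of "-1"] by simp
  obtain L where L: "0 \<le> L" "\<And>x. x \<in> S \<Longrightarrow> norm (grad \<phi> x) \<le> L"
    using continuous_bounded_on_bounded [OF C1_fun_continuous_grad [OF C1] bd] by metis
  \<comment> \<open>The odd difference \<open>g\<close> vanishes to first order at the degenerate
    set. Its square thus compensates the singular weight and makes the integral to be absorbed
    finite; \<open>L\<close> does not occur in the final constant.\<close>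
  have gL: "(g x)\<^sup>2 \<le> (2 * L * norm (fst x))\<^sup>2" if x: "x \<in> S" for x
  proof -
    have "\<bar>\<phi> ((- fst x, snd x) + (2 *\<^sub>R fst x, 0)) - \<phi> (- fst x, snd x)\<bar> \<le> 2 * L * norm (fst x)"
    proof (rule C1_fun_increment_le [OF C1])
      fix s :: real assume s: "0 < s" "s < 1"
      have "(- fst x, snd x) + s *\<^sub>R (2 *\<^sub>R fst x, 0) = ((2 * s - 1) *\<^sub>R fst x, snd x)"
        by (simp add: algebra_simps)
      then have "(- fst x, snd x) + s *\<^sub>R (2 *\<^sub>R fst x, 0) \<in> S" using star [OF x, of "2 * s - 1"] s by auto
      then have "\<bar>grad \<phi> ((- fst x, snd x) + s *\<^sub>R (2 *\<^sub>R fst x, 0)) \<bullet> (2 *\<^sub>R fst x, 0)\<bar>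
          \<le> L * norm (2 *\<^sub>R fst x, 0 :: 'm)"
        using L by (intro order_trans [OF Cauchy_Schwarz_ineq2] mult_right_mono) auto
      then show "\<bar>grad \<phi> ((- fst x, snd x) + s *\<^sub>R (2 *\<^sub>R fst x, 0)) \<bullet> (2 *\<^sub>R fst x, 0)\<bar> \<le> 2 * L * norm (fst x)"
        by (simp add: norm_Pair real_sqrt_mult mult_ac)
    qed (use L in simp)
    moreover have "(- fst x, snd x) + (2 *\<^sub>R fst x, 0) = x"
      by (cases x) (simp add: scaleR_2)
    ultimately show ?thesis unfolding g_def by (simp add: abs_le_square_iff [symmetric] L(1))
  qed
  have main: "(\<integral>\<^sup>+x\<in>S. ennreal (norm (fst x) powr (\<beta> - 2) * (g x)\<^sup>2) \<partial>lborel)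
    \<le> ennreal (16 / (1 - 2 powr (\<beta> - 1))\<^sup>2) * 2 ^ DIM('n \<times> 'm)
        * (\<integral>\<^sup>+x\<in>S. ennreal (R powr \<beta> / (w1 R)\<^sup>2 * energy \<phi> x) \<partial>lborel)"
    unfolding g_def
  proof (rule reflection_increment [OF n C1 S _ _ refl _ \<beta>])
    show "(s *\<^sub>R fst x, snd x) \<in> S" if "x \<in> S" "1/2 \<le> s" "s \<le> 1" for x s
      using star [OF that(1), of s] that by simp
    fix z assume z: "z \<in> S"
    show "norm (fst z) powr \<beta> * (norm (fst (grad \<phi> z)))\<^sup>2 \<le> R powr \<beta> / (w1 R)\<^sup>2 * energy \<phi> z"
    proof (cases "fst z = 0")
      case True
      then show ?thesis using R by (simp add: energy_nonneg)
    next
      case False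
      define l where "l = norm (fst z) / R"
      have l: "0 < l" "l \<le> 1" "l * R = norm (fst z)" using False nR [OF z] R by (auto simp: l_def)
      have "(l powr D1 * w1 R)\<^sup>2 \<le> (w1 (norm (fst z)))\<^sup>2"
        using w_scale(1) [OF l(1,2) R] l(3) w_nonneg by (intro power_mono) auto
      moreover have "(l powr D1)\<^sup>2 = l powr \<beta>"
        using l by (simp add: \<beta>_def powr_power flip: powr_powr)
      ultimately have "l powr \<beta> * (w1 R)\<^sup>2 \<le> (w1 (norm (fst z)))\<^sup>2" by (simp add: power_mult_distrib)
      moreover have "norm (fst z) powr \<beta> = l powr \<beta> * R powr \<beta>"
        using l R by (simp flip: powr_mult)
      ultimately have "norm (fst z) powr \<beta> \<le> R powr \<beta> / (w1 R)\<^sup>2 * (w1 (norm (fst z)))\<^sup>2"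
        using w_pos(1) [OF R] by (simp add: field_simps mult_left_mono)
      then have "norm (fst z) powr \<beta> * (norm (fst (grad \<phi> z)))\<^sup>2
          \<le> R powr \<beta> / (w1 R)\<^sup>2 * (w1 (norm (fst z)))\<^sup>2 * (norm (fst (grad \<phi> z)))\<^sup>2"
        by (rule mult_right_mono) simp
      also have "\<dots> \<le> R powr \<beta> / (w1 R)\<^sup>2 * energy \<phi> z"
        unfolding mult.assoc by (intro mult_left_mono) (auto simp: energy_def)
      finally show ?thesis .
    qed
  next
    have "norm (fst x) powr (\<beta> - 2) * (g x)\<^sup>2 \<le> 4 * L\<^sup>2 * R powr \<beta>" if x: "x \<in> S" for x
    proof (cases "fst x = 0")
      case False
      have "norm (fst x) powr (\<beta> - 2) * (g x)\<^sup>2 \<le> norm (fst x) powr (\<beta> - 2) * (2 * L * norm (fst x))\<^sup>2"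
        by (intro mult_left_mono gL x) auto
      also have "\<dots> = 4 * L\<^sup>2 * (norm (fst x) powr (\<beta> - 2) * norm (fst x) powr 2)"
        using False by (simp add: power_mult_distrib)
      also have "norm (fst x) powr (\<beta> - 2) * norm (fst x) powr 2 = norm (fst x) powr \<beta>"
        by (subst powr_add [symmetric]) simp
      also have "4 * L\<^sup>2 * norm (fst x) powr \<beta> \<le> 4 * L\<^sup>2 * R powr \<beta>"
        using nR [OF x] \<beta> by (intro mult_left_mono powr_mono2) auto
      finally show ?thesis .
    qed simp
    then show "(\<integral>\<^sup>+x\<in>S. ennreal (norm (fst x) powr (\<beta> - 2) * (\<phi> x - \<phi> (- fst x, snd x))\<^sup>2) \<partial>lborel) < \<infinity>"
      unfolding g_def [symmetric] by (rule set_nn_integral_bounded_finite [OF bd S])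
  qed auto
  have "(\<integral>\<^sup>+x\<in>S. ennreal ((g x)\<^sup>2) \<partial>lborel)
      \<le> (\<integral>\<^sup>+x. ennreal (R powr (2 - \<beta>)) * (ennreal (norm (fst x) powr (\<beta> - 2) * (g x)\<^sup>2) * indicator S x) \<partial>lborel)"
  proof (rule nn_integral_mono)
    fix x :: "'n \<times> 'm"
    have "(g x)\<^sup>2 \<le> R powr (2 - \<beta>) * (norm (fst x) powr (\<beta> - 2) * (g x)\<^sup>2)" if x: "x \<in> S"
    proof (cases "fst x = 0")
      case True
      then have "(- fst x, snd x) = x" by (metis minus_zero prod.collapse)
      then show ?thesis by (simp add: g_def)
    next
      case False
      have "R powr (2 - \<beta>) * norm (fst x) powr (\<beta> - 2) = (R / norm (fst x)) powr (2 - \<beta>)"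
        using False R by (simp add: powr_divide powr_minus_divide [of "norm (fst x)" "2 - \<beta>", simplified])
      also have "\<dots> \<ge> 1" using nR [OF x] False \<beta> by (intro ge_one_powr_ge_zero) auto
      finally show ?thesis
        using mult_right_mono [of 1 "R powr (2 - \<beta>) * norm (fst x) powr (\<beta> - 2)" "(g x)\<^sup>2"]
        by (simp add: mult.assoc)
    qed
    then show "ennreal ((g x)\<^sup>2) * indicator S x
      \<le> ennreal (R powr (2 - \<beta>)) * (ennreal (norm (fst x) powr (\<beta> - 2) * (g x)\<^sup>2) * indicator S x)"
      by (auto simp: indicator_def ennreal_leI simp flip: ennreal_mult')
  qed
  also have "\<dots> = ennreal (R powr (2 - \<beta>)) * (\<integral>\<^sup>+x\<in>S. ennreal (norm (fst x) powr (\<beta> - 2) * (g x)\<^sup>2) \<partial>lborel)"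
    by (rule nn_integral_cmult) measurable
  also have "\<dots> \<le> ennreal (R powr (2 - \<beta>)) * (ennreal (16 / (1 - 2 powr (\<beta> - 1))\<^sup>2) * 2 ^ DIM('n \<times> 'm)
        * (\<integral>\<^sup>+x\<in>S. ennreal (R powr \<beta> / (w1 R)\<^sup>2 * energy \<phi> x) \<partial>lborel))"
    by (rule mult_left_mono [OF main]) simp
  also have "(\<integral>\<^sup>+x\<in>S. ennreal (R powr \<beta> / (w1 R)\<^sup>2 * energy \<phi> x) \<partial>lborel) = ennreal (R powr \<beta> / (w1 R)\<^sup>2) * J"
    unfolding J_def by (rule set_nn_integral_cmult_ennreal) auto
  also have "ennreal (16 / (1 - 2 powr (\<beta> - 1))\<^sup>2) * 2 ^ DIM('n \<times> 'm) * (ennreal (R powr \<beta> / (w1 R)\<^sup>2) * J)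
      = ennreal (refl_const TYPE('n) TYPE('m) * (R powr \<beta> / (w1 R)\<^sup>2)) * J"
  proof -
    have "ennreal (16 / (1 - 2 powr (\<beta> - 1))\<^sup>2) * ennreal (2 ^ DIM('n \<times> 'm)) = ennreal (refl_const TYPE('n) TYPE('m))"
      unfolding refl_const_def \<beta>_def by (rule ennreal_mult' [symmetric]) simp
    moreover have "(2::ennreal) ^ DIM('n \<times> 'm) = ennreal (2 ^ DIM('n \<times> 'm))"
      using ennreal_power [of 2] by simp
    ultimately show ?thesis by (simp only: ennreal_mult_mult [OF refl_const_nonneg])
  qed
  also have "ennreal (R powr (2 - \<beta>)) * (ennreal (refl_const TYPE('n) TYPE('m) * (R powr \<beta> / (w1 R)\<^sup>2)) * J)
     = ennreal (R powr (2 - \<beta>) * (refl_const TYPE('n) TYPE('m) * (R powr \<beta> / (w1 R)\<^sup>2))) * J"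
    by (rule ennreal_mult_mult) simp
  also have "R powr (2 - \<beta>) * (refl_const TYPE('n) TYPE('m) * (R powr \<beta> / (w1 R)\<^sup>2))
     = refl_const TYPE('n) TYPE('m) * ((R powr (2 - \<beta>) * R powr \<beta>) / (w1 R)\<^sup>2)" by simp
  also have "R powr (2 - \<beta>) * R powr \<beta> = R\<^sup>2"
    using R by (subst powr_add [symmetric]) simp
  also have "R\<^sup>2 / (w1 R)\<^sup>2 = (\<theta> R)\<^sup>2" by (simp add: \<theta>_def power_divide)
  finally show ?thesis by (simp add: S_def J_def g_def)
qed

text \<open>\<open>P\<close> and \<open>P'\<close> are mirror images, so the constant
  \<open>m\<close> found on \<open>P\<close> serves the reflected function on \<open>P'\<close>, and
  \<open>nbox_reflection\<close> compares that function with \<open>\<phi>\<close>. The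
  contributions are \<open>near_const\<close> once on \<open>P\<close>, and
  \<open>near_const\<close> and \<open>refl_const\<close> twice each on \<open>P'\<close>.\<close>

lemma near_osc_line:
  fixes \<phi> :: "'n::euclidean_space \<times> 'm::euclidean_space \<Rightarrow> real"
  assumes n: "DIM('n) = 1" and D1: "D1 < 1/2" and C1: "C1_fun \<phi>" and R: "0 < R"
  shows "osc_le (nbox y R) \<phi>
    (ennreal ((4 * (3 * near_const TYPE('n) TYPE('m) + 2 * refl_const TYPE('n) TYPE('m)) + 6 * 2 ^ DIM('n \<times> 'm)) * (\<theta> R)\<^sup>2)
      * (energy_on \<phi> (nbox y R)))"
proof -
  define S where "S = (nbox y R :: ('n \<times> 'm) set)"
  define J where "J = (energy_on \<phi> S)"
  define nc where "nc = near_const TYPE('n) TYPE('m)"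
  define rc where "rc = refl_const TYPE('n) TYPE('m)"
  have nc: "0 \<le> nc" and rc: "0 \<le> rc"
    by (auto simp: nc_def rc_def near_const_nonneg refl_const_nonneg)
  obtain b :: 'n where b: "Basis = {b}" using n by (metis card_1_singletonE)
  have S: "S \<in> sets borel" "convex S" "bounded S"
    using nbox_facts unfolding S_def by auto
  define P where "P = slab S R b True"
  define P' where "P' = slab S R b False"
  have [measurable]: "P \<in> sets borel" "P' \<in> sets borel"
    using slab_facts S by (auto simp: P_def P'_def)
  have [measurable]: "\<phi> \<in> borel_measurable borel"
    using C1 by (rule C1_fun_measurable)
  obtain m where m: "(sq_dev P \<phi> m) \<le> ennreal (nc * (\<theta> R)\<^sup>2) * J"
    using slab_osc [OF C1 S(1,2) _ _ R, of y b True] b by (auto simp: osc_le_def P_def J_def S_def nc_def)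
  have P': "{x. (- fst x, snd x) \<in> P} = P'"
    by (auto simp: P_def P'_def slab_def S_def nbox_def)
  have "(sq_dev P' \<phi> m)
    \<le> ennreal 2 * (\<integral>\<^sup>+x\<in>P'. ennreal ((\<phi> x - \<phi> (- fst x, snd x))\<^sup>2) \<partial>lborel)
      + ennreal 2 * (\<integral>\<^sup>+x\<in>P'. ennreal ((\<phi> (- fst x, snd x) - m)\<^sup>2) \<partial>lborel)"
    by (rule set_nn_integral_le_combination) (auto intro: square_diff_le_double)
  also have "\<dots> \<le> ennreal 2 * (ennreal (rc * (\<theta> R)\<^sup>2) * J) + ennreal 2 * (ennreal (nc * (\<theta> R)\<^sup>2) * J)"
  proof (intro add_mono mult_left_mono)
    have "(\<integral>\<^sup>+x\<in>P'. ennreal ((\<phi> x - \<phi> (- fst x, snd x))\<^sup>2) \<partial>lborel) \<le> (\<integral>\<^sup>+x\<in>S. ennreal ((\<phi> x - \<phi> (- fst x, snd x))\<^sup>2) \<partial>lborel)"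
      by (intro nn_integral_mono) (auto simp: P'_def slab_def indicator_def)
    also have "\<dots> \<le> ennreal (rc * (\<theta> R)\<^sup>2) * J"
      unfolding S_def J_def rc_def by (rule nbox_reflection [OF n D1 C1 R])
    finally show "(\<integral>\<^sup>+x\<in>P'. ennreal ((\<phi> x - \<phi> (- fst x, snd x))\<^sup>2) \<partial>lborel) \<le> ennreal (rc * (\<theta> R)\<^sup>2) * J" .
    show "(\<integral>\<^sup>+x\<in>P'. ennreal ((\<phi> (- fst x, snd x) - m)\<^sup>2) \<partial>lborel) \<le> ennreal (nc * (\<theta> R)\<^sup>2) * J"
      using m set_nn_integral_reflect [of "\<lambda>x. ennreal ((\<phi> x - m)\<^sup>2)" P] unfolding P' by simp
  qed auto
  finally have m': "(sq_dev P' \<phi> m)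
    \<le> ennreal 2 * (ennreal (rc * (\<theta> R)\<^sup>2) * J) + ennreal 2 * (ennreal (nc * (\<theta> R)\<^sup>2) * J)" .
  define A where "A = {x \<in> S. (2 *\<^sub>R fst x, snd x) \<notin> S}"
  have "(sq_dev A \<phi> m)
    \<le> (\<integral>\<^sup>+x. ennreal ((\<phi> x - m)\<^sup>2) * indicator P x + ennreal ((\<phi> x - m)\<^sup>2) * indicator P' x \<partial>lborel)"
  proof (intro nn_integral_mono)
    fix x
    have "x \<in> P \<or> x \<in> P'" if "x \<in> A"
    proof -
      have "R \<le> 2 * \<bar>fst x \<bullet> b\<bar>" "x \<in> S" using that by (auto simp: A_def S_def nbox_def b abs_mult)
      then show ?thesis by (auto simp: P_def P'_def slab_def)
    qed
    then show "ennreal ((\<phi> x - m)\<^sup>2) * indicator A x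
        \<le> ennreal ((\<phi> x - m)\<^sup>2) * indicator P x + ennreal ((\<phi> x - m)\<^sup>2) * indicator P' x"
      by (auto simp: indicator_def)
  qed
  also have "\<dots> = (sq_dev P \<phi> m) + (sq_dev P' \<phi> m)"
    by (rule nn_integral_add) auto
  also have "\<dots> \<le> ennreal (nc * (\<theta> R)\<^sup>2) * J
      + (ennreal 2 * (ennreal (rc * (\<theta> R)\<^sup>2) * J) + ennreal 2 * (ennreal (nc * (\<theta> R)\<^sup>2) * J))"
    by (rule add_mono [OF m m'])
  also have "\<dots> = ennreal (nc * (\<theta> R)\<^sup>2) * J + (ennreal (2 * (rc * (\<theta> R)\<^sup>2)) * J + ennreal (2 * (nc * (\<theta> R)\<^sup>2)) * J)"
    by (simp only: ennreal_mult_mult zero_le_numeral)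
  also have "\<dots> = ennreal (nc * (\<theta> R)\<^sup>2 + (2 * (rc * (\<theta> R)\<^sup>2) + 2 * (nc * (\<theta> R)\<^sup>2))) * J"
    using nc rc by (simp only: distrib_right ennreal_plus zero_le_mult_iff zero_le_numeral zero_le_power2 add_nonneg_nonneg simp_thms)
  also have "nc * (\<theta> R)\<^sup>2 + (2 * (rc * (\<theta> R)\<^sup>2) + 2 * (nc * (\<theta> R)\<^sup>2)) = (3 * nc + 2 * rc) * (\<theta> R)\<^sup>2"
    by (simp add: algebra_simps)
  finally have osc: "osc_le A \<phi> (ennreal ((3 * nc + 2 * rc) * (\<theta> R)\<^sup>2) * J)"
    unfolding osc_le_def by blast
  have "osc_le S \<phi> (ennreal ((4 * (3 * nc + 2 * rc) + 6 * 2 ^ DIM('n \<times> 'm) * 1\<^sup>2) * (\<theta> R)\<^sup>2) * J)"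
    unfolding J_def
  proof (rule osc_le_fill_energy [OF C1 S(1,3) R])
    show "(t *\<^sub>R fst x, snd x) \<in> S" if "x \<in> S" "1/2 \<le> t" "t \<le> 1" for x t
      using that nbox_star [of x y R t] by (simp add: S_def)
    show "norm (fst x) \<le> 1 * R" if "x \<in> S" for x
      using nbox_norm [of x y R] that by (simp add: S_def n)
  qed (use osc nc rc in \<open>auto simp: J_def A_def\<close>)
  then show ?thesis by (simp add: S_def J_def nc_def rc_def)
qed

text \<open>For \<open>i \<noteq> j\<close> the signs \<open>b\<close> and \<open>b'\<close> can be
  prescribed independently, and a corner with these signs lies in both slabs. Its side is
  \<open>R/2\<close> against \<open>2 * R\<close> for the whole cube, hence the ratio of measures
  \<open>4 ^ DIM('n)\<close>.\<close>

lemma slab_transfer: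
  fixes \<phi> :: "'n::euclidean_space \<times> 'm::euclidean_space \<Rightarrow> real"
  assumes C1: "C1_fun \<phi>" and R: "0 < R" and ij: "i \<in> Basis" "j \<in> Basis" "i \<noteq> j"
    and E: "(sq_dev (slab (nbox y R) R i b) \<phi> m) \<le> ennreal e * B"
    and osc: "osc_le (slab (nbox y R) R j b') \<phi> (ennreal nc * B)" and nn: "0 \<le> e" "0 \<le> nc"
  shows "(sq_dev (slab (nbox y R) R j b') \<phi> m)
     \<le> ennreal (4 * 4 ^ DIM('n) * e + (2 + 4 * 4 ^ DIM('n)) * nc) * B"
proof -
  define \<tau> where "\<tau> k = (if k = i then b else b')" for k
  define K where "K = ball y (\<theta> R * w2 R)"
  define S where "S = (nbox y R :: ('n \<times> 'm) set)"
  have sets: "slab S R k c \<in> sets borel" for k c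
    unfolding S_def by (rule slab_facts(1) [OF nbox_facts(1,2)])
  have cb: "corner \<tau> R \<in> sets borel" unfolding corner_def by auto
  have sub: "corner \<tau> R \<times> K \<subseteq> S"
  proof
    fix x assume x: "x \<in> corner \<tau> R \<times> K"
    have "\<bar>fst x \<bullet> k\<bar> < R" if k: "k \<in> Basis" for k
    proof -
      have "if \<tau> k then R/2 < fst x \<bullet> k \<and> fst x \<bullet> k < R else - R < fst x \<bullet> k \<and> fst x \<bullet> k < - (R/2)"
        using x k unfolding mem_Times_iff corner_facts(2) [OF R] by blast
      then show ?thesis using R by (cases "\<tau> k") auto
    qed
    then show "x \<in> S" using x by (auto simp: S_def nbox_def K_def)
  qed
  have sub': "corner \<tau> R \<times> K \<subseteq> slab S R k (\<tau> k)" if k: "k \<in> Basis" for k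
  proof
    fix x assume x: "x \<in> corner \<tau> R \<times> K"
    then have "if \<tau> k then R/2 < fst x \<bullet> k \<and> fst x \<bullet> k < R else - R < fst x \<bullet> k \<and> fst x \<bullet> k < - (R/2)"
      using k unfolding mem_Times_iff corner_facts(2) [OF R] by blast
    then show "x \<in> slab S R k (\<tau> k)" using x sub by (auto simp: slab_def)
  qed
  have "(sq_dev (slab S R j b') \<phi> m)
    \<le> ennreal (4 * 4 ^ DIM('n)) * (ennreal e * B) + ennreal (2 + 4 * 4 ^ DIM('n)) * (ennreal nc * B)"
  proof (rule osc_transfer [where ?S3.0 = "corner \<tau> R \<times> K" and ?S1.0 = "slab S R i b"])
    show "\<phi> \<in> borel_measurable borel" using C1 by (rule C1_fun_measurable)
    show "slab S R i b \<in> sets borel" "slab S R j b' \<in> sets borel" by (rule sets)+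
    show "corner \<tau> R \<times> K \<in> sets borel"
      unfolding corner_def K_def by (intro borel_open open_Times) auto
    show "corner \<tau> R \<times> K \<subseteq> slab S R i b" using sub' [OF ij(1)] by (simp add: \<tau>_def)
    show "corner \<tau> R \<times> K \<subseteq> slab S R j b'" using sub' [OF ij(2)] ij by (simp add: \<tau>_def)
    have "emeasure lborel (slab S R j b') \<le> emeasure lborel S"
      using nbox_facts by (intro emeasure_mono) (auto simp: slab_def S_def)
    also have "\<dots> = emeasure lborel (box (- (R *\<^sub>R One)) (R *\<^sub>R One) :: 'n set) * emeasure lborel K"
      unfolding S_def nbox_eq K_def by (rule emeasure_lborel_Times) auto
    also have "emeasure lborel (box (- (R *\<^sub>R One)) (R *\<^sub>R One) :: 'n set) = ennreal ((2 * R) ^ DIM('n))"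
    proof -
      have "(\<Prod>k\<in>(Basis :: 'n set). (R *\<^sub>R One - - (R *\<^sub>R One)) \<bullet> k) = (\<Prod>k\<in>(Basis :: 'n set). 2 * R)"
        by (rule prod.cong) (auto simp: inner_diff_left inner_add_left)
      then show ?thesis using R by (subst emeasure_lborel_box) (simp_all only: prod_constant, auto)
    qed
    also have "(2 * R) ^ DIM('n) = 4 ^ DIM('n) * (R/2) ^ DIM('n)"
    proof -
      have "2 * R = 4 * (R/2)" by simp
      then show ?thesis by (simp only: power_mult_distrib)
    qed
    also have "ennreal (4 ^ DIM('n) * (R/2) ^ DIM('n)) * emeasure lborel K
      = ennreal (4 ^ DIM('n)) * (emeasure lborel (corner \<tau> R) * emeasure lborel K)"
      by (subst corner_facts(1) [OF R], subst ennreal_mult') (auto simp: mult.assoc)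
    also have "emeasure lborel (corner \<tau> R) * emeasure lborel K = emeasure lborel (corner \<tau> R \<times> K)"
      by (rule emeasure_lborel_Times [symmetric]) (auto simp: K_def cb)
    finally show "emeasure lborel (slab S R j b') \<le> ennreal (4 ^ DIM('n)) * emeasure lborel (corner \<tau> R \<times> K)" .
  qed (use E osc in \<open>auto simp: S_def\<close>)
  also have "\<dots> = ennreal (4 * 4 ^ DIM('n) * e + (2 + 4 * 4 ^ DIM('n)) * nc) * B"
    using nn by (subst (1 2) ennreal_mult_mult) (auto simp: distrib_right ennreal_plus)
  finally show ?thesis by (simp only: S_def)
qed

text \<open>Two successive applications of \<open>slab_transfer\<close> starting from
  \<open>near_const\<close>: from a slab to one in another direction, and from there to either slab
  in the original direction.\<close>

definition chain_const :: "'n::euclidean_space itself \<Rightarrow> 'm::euclidean_space itself \<Rightarrow> real" where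
  "chain_const n m = 4 * 4 ^ DIM('n) * (4 * 4 ^ DIM('n) * near_const n m + (2 + 4 * 4 ^ DIM('n)) * near_const n m)
    + (2 + 4 * 4 ^ DIM('n)) * near_const n m"

text \<open>In dimension at least two the slabs in different coordinate directions overlap, so that
  opposite slabs are connected through a third one.\<close>

lemma near_osc_space:
  fixes \<phi> :: "'n::euclidean_space \<times> 'm::euclidean_space \<Rightarrow> real"
  assumes n: "2 \<le> DIM('n)" and C1: "C1_fun \<phi>" and R: "0 < R"
  shows "osc_le (nbox y R) \<phi>
    (ennreal ((4 * (real (DIM('n) * 2) * chain_const TYPE('n) TYPE('m)) + 6 * 2 ^ DIM('n \<times> 'm) * (real DIM('n))\<^sup>2) * (\<theta> R)\<^sup>2)
      * (energy_on \<phi> (nbox y R)))"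
proof -
  define S where "S = (nbox y R :: ('n \<times> 'm) set)"
  define J where "J = (energy_on \<phi> S)"
  define B where "B = ennreal ((\<theta> R)\<^sup>2) * J"
  define nc where "nc = near_const TYPE('n) TYPE('m)"
  define q :: real where "q = 4 ^ DIM('n)"
  define cc where "cc = chain_const TYPE('n) TYPE('m)"
  have nc: "0 \<le> nc" by (simp add: nc_def near_const_nonneg)
  have q: "1 \<le> q" by (simp add: q_def)
  have S: "S \<in> sets borel" "convex S" "bounded S"
    using nbox_facts unfolding S_def by auto
  have [measurable]: "\<phi> \<in> borel_measurable borel" using C1 by (rule C1_fun_measurable)
  have [measurable]: "slab S R i b \<in> sets borel" for i b using slab_facts S by auto
  define e1 where "e1 = 4 * q * nc + (2 + 4 * q) * nc"
  have cc: "cc = 4 * q * e1 + (2 + 4 * q) * nc"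
    by (simp add: cc_def chain_const_def e1_def q_def nc_def)
  have "1 * nc \<le> 4 * q * nc" using q nc by (intro mult_right_mono) auto
  moreover have "0 \<le> (2 + 4 * q) * nc" using q nc by simp
  ultimately have e1: "nc \<le> e1" unfolding e1_def by linarith
  have "1 * e1 \<le> 4 * q * e1" using q nc e1 by (intro mult_right_mono) auto
  then have e2: "e1 \<le> cc" using \<open>0 \<le> (2 + 4 * q) * nc\<close> unfolding cc by linarith
  have osc: "osc_le (slab S R i b) \<phi> (ennreal nc * B)" if "i \<in> Basis" for i b
    using slab_osc [OF C1 S(1,2) _ that R, of y b]
    by (simp add: S_def J_def B_def nc_def ennreal_mult_mult near_const_nonneg)
  obtain i0 :: 'n where i0: "i0 \<in> Basis" using nonempty_Basis by blast
  have "\<exists>j0\<in>Basis. j0 \<noteq> i0"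
  proof (rule ccontr)
    assume "\<not> ?thesis"
    then have "Basis \<subseteq> {i0}" by auto
    then have "DIM('n) \<le> 1" using card_mono [of "{i0}"] by fastforce
    then show False using n by simp
  qed
  then obtain j0 where j0: "j0 \<in> Basis" "j0 \<noteq> i0" by blast
  obtain m where m: "(sq_dev (slab S R i0 True) \<phi> m) \<le> ennreal nc * B"
    using osc [OF i0, of True] by (auto simp: osc_le_def)
  have one: "(sq_dev (slab S R j b) \<phi> m) \<le> ennreal e1 * B"
    if "j \<in> Basis" "j \<noteq> i0" for j b
    using slab_transfer [OF C1 R i0 that(1) _ _ _ nc nc, where y = y and b = True and m = m and B = B and b' = b] m osc [OF that(1), of b] that(2)
    by (auto simp: S_def e1_def q_def)
  have two: "(sq_dev (slab S R i0 b) \<phi> m) \<le> ennreal cc * B" for b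
    using slab_transfer [OF C1 R j0(1) i0 j0(2) _ _ _ nc, where y = y and b = True and m = m and e = e1 and B = B and b' = b] one [OF j0, of True] osc [OF i0, of b] nc e1
    by (auto simp: S_def cc q_def)
  have all: "(sq_dev (slab S R i b) \<phi> m) \<le> ennreal cc * B" if "i \<in> Basis" for i b
  proof (cases "i = i0")
    case False
    have "ennreal e1 * B \<le> ennreal cc * B" using e2 by (intro mult_right_mono ennreal_leI) auto
    then show ?thesis using one [OF that False, of b] by (rule order_trans [rotated])
  qed (simp add: two)
  define A where "A = {x \<in> S. (2 *\<^sub>R fst x, snd x) \<notin> S}"
  have "(sq_dev A \<phi> m)
    \<le> (\<integral>\<^sup>+x. (\<Sum>p\<in>Basis \<times> UNIV. ennreal ((\<phi> x - m)\<^sup>2) * indicator (slab S R (fst p) (snd p)) x) \<partial>lborel)"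
  proof (intro nn_integral_mono)
    fix x :: "'n \<times> 'm"
    \<comment> \<open>Doubling keeps \<open>snd x\<close>, so some coordinate of
      \<open>fst x\<close> has modulus at least \<open>R/2\<close>; its sign selects the
      slab.\<close>
    have "\<exists>p\<in>Basis \<times> UNIV. x \<in> slab S R (fst p) (snd p)" if "x \<in> A"
    proof -
      have "x \<in> S" "(2 *\<^sub>R fst x, snd x) \<notin> S" using that by (auto simp: A_def)
      then obtain i where i: "i \<in> Basis" "R \<le> 2 * \<bar>fst x \<bullet> i\<bar>" by (auto simp: S_def nbox_def abs_mult not_less)
      then have "x \<in> slab S R i (0 \<le> fst x \<bullet> i)" using \<open>x \<in> S\<close> by (auto simp: slab_def)
      then show ?thesis using i by (intro bexI [of _ "(i, 0 \<le> fst x \<bullet> i)"]) auto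
    qed
    then show "ennreal ((\<phi> x - m)\<^sup>2) * indicator A x
        \<le> (\<Sum>p\<in>Basis \<times> UNIV. ennreal ((\<phi> x - m)\<^sup>2) * indicator (slab S R (fst p) (snd p)) x)"
    proof (cases "x \<in> A")
      case True
      then obtain p where p: "p \<in> Basis \<times> UNIV" "x \<in> slab S R (fst p) (snd p)"
        using \<open>x \<in> A \<Longrightarrow> \<exists>p\<in>Basis \<times> UNIV. x \<in> slab S R (fst p) (snd p)\<close> by blast
      have "ennreal ((\<phi> x - m)\<^sup>2) * indicator (slab S R (fst p) (snd p)) x
          \<le> (\<Sum>p\<in>Basis \<times> UNIV. ennreal ((\<phi> x - m)\<^sup>2) * indicator (slab S R (fst p) (snd p)) x)"
        using p(1) by (intro member_le_sum) auto
      then show ?thesis using p(2) True by simp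
    qed simp
  qed
  also have "\<dots> = (\<Sum>p\<in>Basis \<times> UNIV. \<integral>\<^sup>+x\<in>slab S R (fst p) (snd p). ennreal ((\<phi> x - m)\<^sup>2) \<partial>lborel)"
    by (rule nn_integral_sum) measurable
  also have "\<dots> \<le> of_nat (card ((Basis :: 'n set) \<times> (UNIV :: bool set))) * (ennreal cc * B)"
    by (rule sum_bounded_above) (auto intro: all)
  also have "\<dots> = ennreal (real (DIM('n) * 2)) * (ennreal cc * B)"
    by (simp add: card_cartesian_product ennreal_of_nat_eq_real_of_nat)
  also have "\<dots> = ennreal (real (DIM('n) * 2) * cc * (\<theta> R)\<^sup>2) * J"
    unfolding B_def using e1 e2 nc by (subst ennreal_mult_mult, simp, subst ennreal_mult_mult) (simp_all add: zero_le_mult_iff)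
  finally have osc: "osc_le A \<phi> (ennreal (real (DIM('n) * 2) * cc * (\<theta> R)\<^sup>2) * J)"
    unfolding osc_le_def by blast
  have "osc_le S \<phi> (ennreal ((4 * (real (DIM('n) * 2) * cc) + 6 * 2 ^ DIM('n \<times> 'm) * (real DIM('n))\<^sup>2) * (\<theta> R)\<^sup>2) * J)"
    unfolding J_def
  proof (rule osc_le_fill_energy [OF C1 S(1,3) R])
    show "1 \<le> real DIM('n)" using n by simp
    show "(t *\<^sub>R fst x, snd x) \<in> S" if "x \<in> S" "1/2 \<le> t" "t \<le> 1" for x t
      using that nbox_star [of x y R t] by (simp add: S_def)
    show "norm (fst x) \<le> real DIM('n) * R" if "x \<in> S" for x
      using nbox_norm [of x y R] that by (simp add: S_def)
    show "0 \<le> real (DIM('n) * 2) * cc" using e1 e2 nc by simp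
  qed (use osc in \<open>auto simp: J_def A_def\<close>)
  then show ?thesis by (simp only: S_def J_def cc_def)
qed

text \<open>If \<open>\<delta>1 \<ge> 1/2\<close> the obstruction sits at small scales (\<open>e\<close> tends to \<open>0\<close>), otherwise at large
  scales (\<open>R\<close> tends to infinity).\<close>

lemma degenerate_scales:
  assumes D1: "1/2 \<le> D1" and N: "1 \<le> N"
  obtains R e where "0 < R" "0 < e" "R / e = N"
    "\<And>s. 0 \<le> s \<Longrightarrow> s \<le> R \<Longrightarrow> (w1 s)\<^sup>2 \<le> (w1 R)\<^sup>2 / R * max s e"
proof (cases "1/2 \<le> \<delta>1")
  case True
  show ?thesis
  \<comment> \<open>Up to \<open>R = 1\<close> only the exponent \<open>\<delta>1\<close> is seen,
    and there \<open>s powr (2 * \<delta>1) \<le> s\<close>.\<close>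
  proof (rule that [of 1 "1 / N"])
    fix s :: real assume s: "0 \<le> s" "s \<le> 1"
    have "(w1 s)\<^sup>2 \<le> s"
    proof (cases "s = 0")
      case True
      then show ?thesis using \<open>1/2 \<le> \<delta>1\<close> by (simp add: w1_def ppow_def)
    next
      case False
      then have "(w1 s)\<^sup>2 = s powr (2 * \<delta>1)"
        using s by (simp add: w1_def ppow_def power2_eq_square flip: powr_add)
      also have "\<dots> \<le> s powr 1" using s True by (intro powr_mono') auto
      finally show ?thesis using s by simp
    qed
    then show "(w1 s)\<^sup>2 \<le> (w1 1)\<^sup>2 / 1 * max s (1 / N)" by (simp add: w1_def ppow_def max_def)
  qed (use N in auto)
next
  case False
  then have d: "1/2 \<le> \<delta>1'" using D1 by (simp add: D1_def)
  have w: "(w1 s)\<^sup>2 = s powr (2 * \<delta>1' - 1) * s" if "1 \<le> s" for s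
  proof -
    have "w1 s = s powr \<delta>1'" using that by (cases "s = 1") (auto simp: w1_def ppow_def)
    then have "(w1 s)\<^sup>2 = s powr (2 * \<delta>1')" by (simp add: power2_eq_square flip: powr_add)
    also have "2 * \<delta>1' = 2 * \<delta>1' - 1 + 1" by simp
    also have "s powr (2 * \<delta>1' - 1 + 1) = s powr (2 * \<delta>1' - 1) * s powr 1" by (rule powr_add)
    finally show ?thesis using that by simp
  qed
  have wN: "(w1 N)\<^sup>2 / N = N powr (2 * \<delta>1' - 1)" using w [OF N] N by simp
  have N1: "1 \<le> N powr (2 * \<delta>1' - 1)" using N d by (intro ge_one_powr_ge_zero) auto
  show ?thesis
  \<comment> \<open>Above 1 the quotient \<open>(w1 s)\<^sup>2 / s\<close> is the increasing
    function \<open>s powr (2 * \<delta>1' - 1)\<close>, so its value at \<open>N\<close> dominates.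
    Arguments below 1 are covered by \<open>e = 1\<close> in the maximum.\<close>
  proof (rule that [of N 1])
    fix s :: real assume s: "0 \<le> s" "s \<le> N"
    show "(w1 s)\<^sup>2 \<le> (w1 N)\<^sup>2 / N * max s 1"
    proof (cases "s \<le> 1")
      case True
      have "w1 s \<le> w1 1" using True s by (intro w_mono)
      then have "(w1 s)\<^sup>2 \<le> 1" using w_nonneg by (intro power_le_one) (auto simp: w1_def ppow_def)
      then show ?thesis using N1 True by (simp add: wN max_def)
    next
      case False
      then have "s powr (2 * \<delta>1' - 1) \<le> N powr (2 * \<delta>1' - 1)" using s d by (intro powr_mono2) auto
      then show ?thesis using False w [of s] by (simp add: wN max_def mult_right_mono)
    qed
  qed (use N in auto)
qed

end

subsection \<open>Comparison of intrinsic balls with boxes\<close>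

text \<open>Squaring the positive part makes the cutoff C1 across the sphere of radius
  \<open>\<rho>\<close>, with an explicit gradient of norm at most
  \<open>4 / \<rho>\<close>.\<close>

definition bump :: "'a::euclidean_space \<Rightarrow> real \<Rightarrow> 'a \<Rightarrow> real" where
  "bump p \<rho> y = (max 0 (1 - (norm (y - p))\<^sup>2 / \<rho>\<^sup>2))\<^sup>2"

definition bump_grad :: "'a::euclidean_space \<Rightarrow> real \<Rightarrow> 'a \<Rightarrow> 'a" where
  "bump_grad p \<rho> y = (- (4 * max 0 (1 - (norm (y - p))\<^sup>2 / \<rho>\<^sup>2) / \<rho>\<^sup>2)) *\<^sub>R (y - p)"

lemma square_pos_part_has_derivative:
  "((\<lambda>s::real. (max 0 s)\<^sup>2) has_real_derivative (2 * max 0 s)) (at s)"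
proof -
  consider "s < 0" | "s > 0" | "s = 0" by linarith
  then show ?thesis
  proof cases
    case 1
    have "((\<lambda>s::real. 0) has_real_derivative (2 * max 0 s)) (at s)" using 1 by simp
    then show ?thesis
      by (rule has_field_derivative_transform_within_open [where S = "{..<0}"]) (use 1 in \<open>auto simp: max_def\<close>)
  next
    case 2
    have "((\<lambda>s::real. s\<^sup>2) has_real_derivative (2 * max 0 s)) (at s)"
      using 2 by (auto intro!: derivative_eq_intros)
    then show ?thesis
      by (rule has_field_derivative_transform_within_open [where S = "{0<..}"]) (use 2 in \<open>auto simp: max_def\<close>)
  next
    case 3
    have "((\<lambda>h. ((max 0 (0 + h))\<^sup>2 - (max 0 0)\<^sup>2) / h) \<longlongrightarrow> (0::real)) (at 0)"
    proof (rule Lim_null_comparison)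
      show "\<forall>\<^sub>F h in at 0. norm (((max 0 (0 + h))\<^sup>2 - (max 0 0)\<^sup>2) / h) \<le> \<bar>h :: real\<bar>"
        by (rule always_eventually) (auto simp: max_def power2_eq_square)
      show "((\<lambda>h::real. \<bar>h\<bar>) \<longlongrightarrow> 0) (at 0)"
        by (intro tendsto_rabs_zero tendsto_ident_at)
    qed
    then show ?thesis using 3 by (simp add: DERIV_def)
  qed
qed

lemma bump_has_derivative:
  "(bump p \<rho> has_derivative (\<lambda>v. bump_grad p \<rho> y \<bullet> v)) (at y)"
proof -
  have "((\<lambda>y. 1 - ((y - p) \<bullet> (y - p)) * k) has_derivative (\<lambda>v. - (2 * k) * ((y - p) \<bullet> v))) (at y)" for k
    by (auto intro!: derivative_eq_intros simp: inner_commute [of _ "y - p"])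
  from this [of "1 / \<rho>\<^sup>2"]
  have "((\<lambda>y. 1 - ((y - p) \<bullet> (y - p)) / \<rho>\<^sup>2) has_derivative (\<lambda>v. - (2 / \<rho>\<^sup>2) * ((y - p) \<bullet> v))) (at y)"
    by simp
  from DERIV_compose_FDERIV [OF square_pos_part_has_derivative this]
  have "((\<lambda>y. (max 0 (1 - ((y - p) \<bullet> (y - p)) / \<rho>\<^sup>2))\<^sup>2) has_derivative
     (\<lambda>v. (- (2 / \<rho>\<^sup>2) * ((y - p) \<bullet> v)) * (2 * max 0 (1 - ((y - p) \<bullet> (y - p)) / \<rho>\<^sup>2)))) (at y)" .
  then show ?thesis
    by (simp add: bump_def [abs_def] bump_grad_def power2_norm_eq_inner mult_ac)
qed

lemma bump_bounds: "0 \<le> bump p \<rho> y" "bump p \<rho> y \<le> 1"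
proof -
  show "0 \<le> bump p \<rho> y" by (simp add: bump_def)
  have "max 0 (1 - (norm (y - p))\<^sup>2 / \<rho>\<^sup>2) \<le> 1" by simp
  then show "bump p \<rho> y \<le> 1" unfolding bump_def by (intro power_le_one) auto
qed

lemma bump_outside:
  assumes "0 < \<rho>" "\<rho> \<le> norm (y - p)"
  shows "bump p \<rho> y = 0" "bump_grad p \<rho> y = 0"
proof -
  have "\<rho>\<^sup>2 \<le> (norm (y - p))\<^sup>2" using assms by (intro power_mono) auto
  then have "1 - (norm (y - p))\<^sup>2 / \<rho>\<^sup>2 \<le> 0" using assms by simp
  then show "bump p \<rho> y = 0" "bump_grad p \<rho> y = 0" by (simp_all add: bump_def bump_grad_def max_def)
qed

lemma bump_grad_norm:
  assumes "0 < \<rho>"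
  shows "norm (bump_grad p \<rho> y) \<le> 4 / \<rho>"
proof (cases "\<rho> \<le> norm (y - p)")
  case True
  then show ?thesis using bump_outside [OF assms True] assms by simp
next
  case False
  define m where "m = max 0 (1 - (norm (y - p))\<^sup>2 / \<rho>\<^sup>2)"
  have m: "0 \<le> m" "m \<le> 1" by (auto simp: m_def)
  have "norm (bump_grad p \<rho> y) = 4 * m / \<rho>\<^sup>2 * norm (y - p)"
    using m by (simp add: bump_grad_def m_def [symmetric])
  also have "\<dots> \<le> 4 * 1 / \<rho>\<^sup>2 * \<rho>"
    using m False by (intro mult_mono divide_right_mono) auto
  also have "\<dots> = 4 / \<rho>" using assms by (simp add: power2_eq_square)
  finally show ?thesis .
qed

lemma continuous_bump_grad: "continuous_on UNIV (bump_grad p \<rho>)"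
  unfolding bump_grad_def by (cases "\<rho> = 0") (auto intro!: continuous_intros)

lemma continuous_bump: "continuous_on UNIV (bump p \<rho>)"
  by (intro continuous_at_imp_continuous_on ballI has_derivative_continuous [OF bump_has_derivative])

lemma bump_product_C1:
  fixes p1 :: "'n::euclidean_space" and p2 :: "'m::euclidean_space" and h \<rho>1 \<rho>2 :: real
  defines "\<psi> \<equiv> \<lambda>y. h * (bump p1 \<rho>1 (fst y) * bump p2 \<rho>2 (snd y))"
  shows "C1_fun \<psi>"
    and "grad \<psi> y = (h * bump p2 \<rho>2 (snd y)) *\<^sub>R (bump_grad p1 \<rho>1 (fst y), 0)
        + (h * bump p1 \<rho>1 (fst y)) *\<^sub>R (0, bump_grad p2 \<rho>2 (snd y))"
proof -
  define g where "g y = (h * bump p2 \<rho>2 (snd y)) *\<^sub>R (bump_grad p1 \<rho>1 (fst y), 0)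
        + (h * bump p1 \<rho>1 (fst y)) *\<^sub>R (0, bump_grad p2 \<rho>2 (snd y))" for y :: "'n \<times> 'm"
  have d: "(\<psi> has_derivative (\<lambda>v. g y \<bullet> v)) (at y)" for y
  proof -
    have 1: "((\<lambda>y. bump p1 \<rho>1 (fst y)) has_derivative (\<lambda>v. bump_grad p1 \<rho>1 (fst y) \<bullet> fst v)) (at y)"
      using has_derivative_compose [OF has_derivative_fst [OF has_derivative_ident] bump_has_derivative] .
    have 2: "((\<lambda>y. bump p2 \<rho>2 (snd y)) has_derivative (\<lambda>v. bump_grad p2 \<rho>2 (snd y) \<bullet> snd v)) (at y)"
      using has_derivative_compose [OF has_derivative_snd [OF has_derivative_ident] bump_has_derivative] .
    have eq: "(\<lambda>v. g y \<bullet> v) = (\<lambda>v. h * (bump p1 \<rho>1 (fst y) * (bump_grad p2 \<rho>2 (snd y) \<bullet> snd v)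
        + bump_grad p1 \<rho>1 (fst y) \<bullet> fst v * bump p2 \<rho>2 (snd y)))"
    proof
      fix v
      have "g y \<bullet> v = h * bump p2 \<rho>2 (snd y) * (bump_grad p1 \<rho>1 (fst y) \<bullet> fst v)
          + h * bump p1 \<rho>1 (fst y) * (bump_grad p2 \<rho>2 (snd y) \<bullet> snd v)"
        unfolding g_def inner_add_left by (simp add: inner_prod_def)
      then show "g y \<bullet> v = h * (bump p1 \<rho>1 (fst y) * (bump_grad p2 \<rho>2 (snd y) \<bullet> snd v)
        + bump_grad p1 \<rho>1 (fst y) \<bullet> fst v * bump p2 \<rho>2 (snd y))"
        by (simp only: distrib_left mult_ac add_ac)
    qed
    show ?thesis unfolding \<psi>_def eq
      by (rule has_derivative_mult_right [OF has_derivative_mult [OF 1 2]])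
  qed
  have "continuous_on UNIV g" unfolding g_def
    by (intro continuous_intros continuous_on_compose2 [OF continuous_bump] continuous_on_compose2 [OF continuous_bump_grad]) auto
  then show "C1_fun \<psi>" using d by (rule C1_funI [rotated])
  show "grad \<psi> y = (h * bump p2 \<rho>2 (snd y)) *\<^sub>R (bump_grad p1 \<rho>1 (fst y), 0)
        + (h * bump p1 \<rho>1 (fst y)) *\<^sub>R (0, bump_grad p2 \<rho>2 (snd y))"
    using grad_eqI [OF d] by (simp add: g_def)
qed

lemma grad_uminus:
  assumes "C1_fun \<psi>"
  shows "C1_fun (\<lambda>x. - \<psi> x)" "grad (\<lambda>x. - \<psi> x) = (\<lambda>x. - grad \<psi> x)"
proof -
  have d: "((\<lambda>x. - \<psi> x) has_derivative (\<lambda>v. (- grad \<psi> x) \<bullet> v)) (at x)" for x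
    using has_derivative_minus [OF C1_fun_has_derivative [OF assms]] by simp
  show "grad (\<lambda>x. - \<psi> x) = (\<lambda>x. - grad \<psi> x)" using grad_eqI [OF d] by auto
  show "C1_fun (\<lambda>x. - \<psi> x)" using d
    by (rule C1_funI) (intro continuous_intros C1_fun_continuous_grad assms)
qed

section \<open>Measurability of intrinsic balls and optimality of the mean\<close>

lemma ball_c_mono: "r \<le> s \<Longrightarrow> ball_c c x r \<subseteq> ball_c c x s"
  by (auto simp: ball_c_def intro: less_le_trans)

text \<open>The distance from \<open>x\<close> is a supremum of continuous functions, so its
  sublevel sets with \<open>\<le>\<close> are closed. The ball, given by a strict inequality, is the
  union of those with rational level below \<open>r\<close>.\<close>

lemma ball_c_sets_lebesgue: "ball_c c x r \<in> sets lebesgue"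
proof -
  define P where "P = {\<psi>. C1_fun \<psi> \<and> (AE z in lebesgue. Gam c \<psi> z \<le> 1)}"
  define C where "C q = (\<Inter>\<psi>\<in>P. {y. \<psi> x - \<psi> y \<le> q})" for q
  have C: "y \<in> C q \<longleftrightarrow> dist_c c x y \<le> ereal q" for y q
    by (auto simp: C_def dist_c_def P_def SUP_le_iff)
  have "closed (C q)" for q
    unfolding C_def P_def
    by (intro closed_INT ballI closed_Collect_le continuous_intros C1_fun_continuous) auto
  moreover have "ball_c c x r = (\<Union>q\<in>{q\<in>\<rat>. q < r}. C q)"
  proof (intro equalityI subsetI)
    fix y assume "y \<in> ball_c c x r"
    then have "dist_c c x y < ereal r" by (simp add: ball_c_def)
    then obtain q where q: "dist_c c x y < ereal q" "ereal q < ereal r" using ereal_dense2 by blast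
    then obtain p where "q < p" "p < r" "p \<in> \<rat>" using Rats_dense_in_real by auto
    moreover have "dist_c c x y \<le> ereal p" using q \<open>q < p\<close> by (meson ereal_less_eq(3) less_imp_le order_trans)
    ultimately show "y \<in> (\<Union>q\<in>{q\<in>\<rat>. q < r}. C q)" using C by blast
  next
    fix y assume "y \<in> (\<Union>q\<in>{q\<in>\<rat>. q < r}. C q)"
    then obtain q where q: "q < r" "dist_c c x y \<le> ereal q" using C by auto
    then have "dist_c c x y < ereal r" by (meson le_less_trans less_ereal.simps(1))
    then show "y \<in> ball_c c x r" by (simp add: ball_c_def)
  qed
  moreover have "countable {q\<in>\<rat>. q < r}" by (rule countable_subset [OF _ countable_rat]) auto
  ultimately have "ball_c c x r \<in> sets borel" by (auto intro!: sets.countable_UN')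
  then show ?thesis by simp
qed

text \<open>Expanding the square around the mean leaves no cross term. The computation takes place
  in the restriction of Lebesgue measure to \<open>V\<close>, a finite measure on which the bounded
  \<open>\<phi>\<close> is square integrable.\<close>

lemma avg_minimizes:
  fixes \<phi> :: "'a::euclidean_space \<Rightarrow> real"
  assumes V: "V \<in> sets lebesgue" "emeasure lebesgue V < \<infinity>" and [measurable]: "\<phi> \<in> borel_measurable borel"
    and B: "\<And>x. x \<in> V \<Longrightarrow> \<bar>\<phi> x\<bar> \<le> B"
  shows "(\<integral>\<^sup>+x\<in>V. ennreal ((\<phi> x - avg V \<phi>)\<^sup>2) \<partial>lebesgue) \<le> (\<integral>\<^sup>+x\<in>V. ennreal ((\<phi> x - m)\<^sup>2) \<partial>lebesgue)"
proof (cases "emeasure lebesgue V = 0")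
  case True
  then have "V \<in> null_sets lebesgue" using V by (simp add: null_sets_def)
  then show ?thesis by (simp add: nn_integral_null_set)
next
  case False
  define N where "N = restrict_space lebesgue V"
  define A where "A = avg V \<phi>"
  have sp: "space N = V" by (simp add: N_def space_restrict_space)
  have eN: "emeasure N V = emeasure lebesgue V"
    using V by (simp add: N_def emeasure_restrict_space)
  interpret finite_measure N
    by (rule finite_measureI) (use V eN sp in auto)
  have [measurable]: "\<phi> \<in> borel_measurable N"
    unfolding N_def by (intro measurable_restrict_space1 measurable_completion) simp
  have bnd: "integrable N f" if "f \<in> borel_measurable N" "\<And>x. x \<in> V \<Longrightarrow> \<bar>f x\<bar> \<le> K" for f :: "'a \<Rightarrow> real" and K
    using that by (intro integrable_const_bound [where B = K]) (auto simp: sp)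
  have i\<phi>: "integrable N \<phi>" using B by (intro bnd) auto
  have isq: "integrable N (\<lambda>x. (\<phi> x - q)\<^sup>2)" for q
  proof (rule bnd [where K = "(B + \<bar>q\<bar>)\<^sup>2"])
    fix x assume "x \<in> V"
    then have "\<bar>\<phi> x - q\<bar> \<le> \<bar>B + \<bar>q\<bar>\<bar>" using B [of x] by linarith
    then have "(\<phi> x - q)\<^sup>2 \<le> (B + \<bar>q\<bar>)\<^sup>2" by (simp add: abs_le_square_iff)
    then show "\<bar>(\<phi> x - q)\<^sup>2\<bar> \<le> (B + \<bar>q\<bar>)\<^sup>2" by simp
  qed measurable
  have mN: "measure N V = measure lebesgue V" using eN by (simp add: measure_def)
  have mpos: "measure N V \<noteq> 0" using False eN by (metis emeasure_eq_measure ennreal_0)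
  have "(\<integral>x. \<phi> x \<partial>N) = (LINT y:V|lebesgue. \<phi> y)"
    using V by (simp add: N_def set_lebesgue_integral_def integral_restrict_space)
  then have "A = (\<integral>x. \<phi> x \<partial>N) / measure N V"
    by (simp add: A_def avg_def mN)
  then have zero: "(\<integral>x. \<phi> x - A \<partial>N) = 0"
    using i\<phi> mpos by (simp add: sp)
  have "(\<integral>x. (\<phi> x - m)\<^sup>2 \<partial>N) = (\<integral>x. (\<phi> x - A)\<^sup>2 + (2 * (A - m) * (\<phi> x - A) + (A - m)\<^sup>2) \<partial>N)"
    by (intro Bochner_Integration.integral_cong) (auto simp: power2_eq_square algebra_simps)
  also have "\<dots> = (\<integral>x. (\<phi> x - A)\<^sup>2 \<partial>N) + (A - m)\<^sup>2 * measure N V"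
    using isq [of A] i\<phi> zero by (simp add: sp)
  finally have "(\<integral>x. (\<phi> x - A)\<^sup>2 \<partial>N) \<le> (\<integral>x. (\<phi> x - m)\<^sup>2 \<partial>N)" by simp
  then have "(\<integral>\<^sup>+x. ennreal ((\<phi> x - A)\<^sup>2) \<partial>N) \<le> (\<integral>\<^sup>+x. ennreal ((\<phi> x - m)\<^sup>2) \<partial>N)"
    using isq by (simp add: nn_integral_eq_integral ennreal_leI)
  then show ?thesis
    using V by (simp add: N_def nn_integral_restrict_space A_def)
qed

locale grushin_form = grushin +
  fixes a a' :: real and c :: "('n::euclidean_space \<times> 'm::euclidean_space) \<Rightarrow> ('n \<times> 'm) \<Rightarrow> ('n \<times> 'm) \<Rightarrow> real"
  assumes a: "0 < a" "0 < a'" and coeff: "coeff_ok a a' \<delta>1 \<delta>1' \<delta>2 \<delta>2' c"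
begin

text \<open>Ellipticity holds for all vectors at almost every point, so one null set serves all
  \<open>\<phi>\<close> simultaneously.\<close>

lemma Gam_bounds: "AE z in lebesgue. \<forall>\<phi>. a * energy \<phi> z \<le> Gam c \<phi> z \<and> Gam c \<phi> z \<le> a' * energy \<phi> z"
proof -
  have "AE z in lebesgue. \<forall>\<xi>. a * Qdelta \<delta>1 \<delta>1' \<delta>2 \<delta>2' z \<xi> \<le> Qc c z \<xi> \<and> Qc c z \<xi> \<le> a' * Qdelta \<delta>1 \<delta>1' \<delta>2 \<delta>2' z \<xi>"
    using coeff by (simp add: coeff_ok_def)
  then show ?thesis
  proof (eventually_elim, intro allI)
    fix z :: "'n \<times> 'm" and \<phi>
    assume "\<forall>\<xi>. a * Qdelta \<delta>1 \<delta>1' \<delta>2 \<delta>2' z \<xi> \<le> Qc c z \<xi> \<and> Qc c z \<xi> \<le> a' * Qdelta \<delta>1 \<delta>1' \<delta>2 \<delta>2' z \<xi>"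
    moreover have "energy \<phi> z = Qdelta \<delta>1 \<delta>1' \<delta>2 \<delta>2' z (grad \<phi> z)"
      by (simp add: energy_def Qdelta_def w1_def w2_def ppow_square)
    ultimately show "a * energy \<phi> z \<le> Gam c \<phi> z \<and> Gam c \<phi> z \<le> a' * energy \<phi> z"
      unfolding Gam_eq_Qc by metis
  qed
qed

section \<open>Admissible functions and their increments\<close>

definition adm :: "('n \<times> 'm \<Rightarrow> real) \<Rightarrow> bool" where
  "adm \<psi> \<longleftrightarrow> C1_fun \<psi> \<and> (AE z in lebesgue. Gam c \<psi> z \<le> 1)"

lemma dist_c_adm: "dist_c c x y = (SUP \<psi>\<in>Collect adm. ereal (\<psi> x - \<psi> y))"
proof -
  have "Collect adm = {\<psi>. C1_fun \<psi> \<and> (AE z in lebesgue. Gam c \<psi> z \<le> 1)}"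
    by (auto simp: adm_def)
  then show ?thesis by (simp only: dist_c_def)
qed

text \<open>Turns one-sided estimates valid for all admissible functions into estimates of absolute
  values.\<close>

lemma adm_uminus:
  assumes "adm \<psi>"
  shows "adm (\<lambda>x. - \<psi> x)"
proof -
  have "Gam c (\<lambda>x. - \<psi> x) z = Gam c \<psi> z" for z
    using assms by (simp add: adm_def Gam_eq_Qc grad_uminus Qc_def)
  then show ?thesis using assms by (simp add: adm_def grad_uminus)
qed

lemma admI:
  assumes "C1_fun \<psi>" "\<And>z. a' * energy \<psi> z \<le> 1"
  shows "adm \<psi>"
proof -
  have "AE z in lebesgue. Gam c \<psi> z \<le> 1"
    using Gam_bounds by (rule AE_mp) (auto intro!: AE_I2 intro: order_trans [OF _ assms(2)])
  then show ?thesis using assms by (simp add: adm_def)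
qed

text \<open>Off the degenerate set the energy is continuous, so a violation of the bound would
  persist on a nonempty open set. Such a set is not negligible, whereas the bound holds almost
  everywhere.\<close>

lemma adm_energy:
  assumes "adm \<psi>" "fst z \<noteq> 0"
  shows "energy \<psi> z \<le> 1 / a"
proof (rule ccontr)
  assume neg: "\<not> ?thesis"
  have C1: "C1_fun \<psi>" using assms by (simp add: adm_def)
  define D where "D = {z :: 'n \<times> 'm. fst z \<noteq> 0}"
  have D: "open D" unfolding D_def by (intro open_Collect_neq continuous_intros)
  have cw: "continuous_on D (\<lambda>z. ppow (norm (fst z)) \<alpha> \<alpha>')" for \<alpha> \<alpha>'
  proof -
    have "continuous_on {0<..} (\<lambda>t. ppow t \<alpha> \<alpha>')"
      by (intro continuous_at_imp_continuous_on ballI isCont_ppow) auto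
    then show ?thesis
      by (rule continuous_on_compose2) (auto simp: D_def intro!: continuous_intros)
  qed
  have "continuous_on D (grad \<psi>)"
    using C1_fun_continuous_grad [OF C1] by (rule continuous_on_subset) simp
  then have "continuous_on D (energy \<psi>)"
    unfolding energy_def w1_def w2_def by (intro continuous_intros cw)
  then have U: "open (energy \<psi> -` {1/a<..} \<inter> D)" (is "open ?U")
    using D by (simp add: continuous_on_open_vimage)
  have "AE z in lebesgue. z \<notin> ?U"
  proof -
    have "AE z in lebesgue. Gam c \<psi> z \<le> 1" using assms by (simp add: adm_def)
    with Gam_bounds have "AE z in lebesgue. a * energy \<psi> z \<le> 1"
      by eventually_elim (blast intro: order_trans)
    then show ?thesis
      by (rule AE_mp) (use a in \<open>auto intro!: AE_I2 simp: field_simps\<close>)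
  qed
  then have "?U \<in> null_sets lebesgue"
    using U by (subst AE_iff_null_sets) auto
  then have "?U = {}"
    using open_not_negligible [OF U] by (auto simp: negligible_iff_null_sets)
  moreover have "z \<in> ?U" using neg assms by (simp add: D_def)
  ultimately show False by blast
qed

lemma adm_grad:
  assumes "adm \<psi>" "fst z \<noteq> 0"
  shows "norm (fst (grad \<psi> z)) \<le> 1 / sqrt a / w1 (norm (fst z))"
    and "norm (snd (grad \<psi> z)) \<le> 1 / sqrt a / w2 (norm (fst z))"
proof -
  have w: "0 < w1 (norm (fst z))" "0 < w2 (norm (fst z))" using assms w_pos by auto
  have s: "(1 / sqrt a)\<^sup>2 = 1 / a" using a by (simp add: power_divide)
  have "(w1 (norm (fst z)) * norm (fst (grad \<psi> z)))\<^sup>2 \<le> (1 / sqrt a)\<^sup>2"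
    "(w2 (norm (fst z)) * norm (snd (grad \<psi> z)))\<^sup>2 \<le> (1 / sqrt a)\<^sup>2"
    unfolding s using adm_energy [OF assms]
    by (auto simp: energy_def power_mult_distrib intro: order_trans [rotated])
  then have "w1 (norm (fst z)) * norm (fst (grad \<psi> z)) \<le> 1 / sqrt a"
    "w2 (norm (fst z)) * norm (snd (grad \<psi> z)) \<le> 1 / sqrt a"
    using a by (auto intro: power2_le_imp_le)
  then show "norm (fst (grad \<psi> z)) \<le> 1 / sqrt a / w1 (norm (fst z))"
    "norm (snd (grad \<psi> z)) \<le> 1 / sqrt a / w2 (norm (fst z))"
    unfolding pos_le_divide_eq [OF w(1)] pos_le_divide_eq [OF w(2)] by (simp_all add: mult.commute)
qed

lemma adm_vertical:
  assumes \<psi>: "adm \<psi>" and u: "u \<noteq> 0"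
  shows "\<bar>\<psi> (u, v) - \<psi> (u, v')\<bar> \<le> 1 / sqrt a * (norm (v - v') / w2 (norm u))"
proof -
  have C1: "C1_fun \<psi>" using \<psi> by (simp add: adm_def)
  have "\<bar>\<psi> ((u, v') + (0, v - v')) - \<psi> (u, v')\<bar> \<le> 1 / sqrt a * (norm (v - v') / w2 (norm u))"
  proof (rule C1_fun_increment_le [OF C1])
    show "0 \<le> 1 / sqrt a * (norm (v - v') / w2 (norm u))" using w_nonneg a by simp
    fix s :: real
    define z where "z = (u, v') + s *\<^sub>R (0, v - v')"
    have z: "fst z = u" by (simp add: z_def)
    have "\<bar>grad \<psi> z \<bullet> (0, v - v')\<bar> \<le> norm (snd (grad \<psi> z)) * norm (v - v')"
      by (simp add: inner_prod_def Cauchy_Schwarz_ineq2)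
    also have "\<dots> \<le> (1 / sqrt a / w2 (norm (fst z))) * norm (v - v')"
      using adm_grad(2) [OF \<psi>, of z] z u by (intro mult_right_mono) auto
    finally show "\<bar>grad \<psi> ((u, v') + s *\<^sub>R (0, v - v')) \<bullet> (0, v - v')\<bar> \<le> 1 / sqrt a * (norm (v - v') / w2 (norm u))"
      using z by (simp add: z_def)
  qed
  then show ?thesis by simp
qed

text \<open>By convexity the segment stays in a ball at distance at least \<open>\<rho>\<close> from
  the origin, where \<open>w1\<close> is at least \<open>w1 \<rho>\<close>.\<close>

lemma adm_horizontal:
  assumes \<psi>: "adm \<psi>" and u: "0 < \<rho>" "u \<in> ball p \<epsilon>" "u' \<in> ball p \<epsilon>" "\<epsilon> + \<rho> \<le> norm p"
  shows "\<bar>\<psi> (u, v) - \<psi> (u', v)\<bar> \<le> 1 / sqrt a * (norm (u - u') / w1 \<rho>)"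
proof -
  have C1: "C1_fun \<psi>" using \<psi> by (simp add: adm_def)
  have "\<bar>\<psi> ((u', v) + (u - u', 0)) - \<psi> (u', v)\<bar> \<le> 1 / sqrt a * (norm (u - u') / w1 \<rho>)"
  proof (rule C1_fun_increment_le [OF C1])
    show "0 \<le> 1 / sqrt a * (norm (u - u') / w1 \<rho>)" using w_nonneg a by simp
    fix s :: real assume s: "0 < s" "s < 1"
    define z where "z = (u', v) + s *\<^sub>R (u - u', 0)"
    have "fst z = (1 - s) *\<^sub>R u' + s *\<^sub>R u" by (simp add: z_def algebra_simps)
    then have "fst z \<in> ball p \<epsilon>" using convexD [OF convex_ball u(3,2), of "1 - s" s] s by simp
    then have z: "\<rho> \<le> norm (fst z)"
      using u(4) norm_triangle_ineq2 [of p "p - fst z"] by (simp add: dist_norm)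
    have "1 / sqrt a / w1 (norm (fst z)) \<le> 1 / sqrt a / w1 \<rho>"
      using w_mono(1) [of \<rho> "norm (fst z)"] w_pos(1) [OF u(1)] u(1) z a by (intro divide_left_mono) auto
    moreover have "fst z \<noteq> 0" using z u(1) by auto
    ultimately have "norm (fst (grad \<psi> z)) \<le> 1 / sqrt a / w1 \<rho>"
      using adm_grad(1) [OF \<psi>] by (meson order_trans)
    then have "norm (fst (grad \<psi> z)) * norm (u - u') \<le> 1 / sqrt a / w1 \<rho> * norm (u - u')"
      by (intro mult_right_mono) auto
    moreover have "\<bar>grad \<psi> z \<bullet> (u - u', 0)\<bar> \<le> norm (fst (grad \<psi> z)) * norm (u - u')"
      by (simp add: inner_prod_def Cauchy_Schwarz_ineq2)
    ultimately show "\<bar>grad \<psi> ((u', v) + s *\<^sub>R (u - u', 0)) \<bullet> (u - u', 0)\<bar> \<le> 1 / sqrt a * (norm (u - u') / w1 \<rho>)"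
      by (simp add: z_def)
  qed
  then show ?thesis by simp
qed

text \<open>Along the ray the derivative is at most \<open>K * s powr (- D1)\<close>, which is
  integrable at 0 since \<open>D1 < 1\<close>. Subtracting the antiderivative of this bound yields a
  decreasing function. The monotonicity criterion asks for derivatives only in the open interval,
  which allows the ray to start on the degenerate set, where the gradient is not controlled.\<close>

lemma adm_radial_one_sided:
  assumes \<psi>: "adm \<psi>" and u: "u \<noteq> 0"
  shows "\<psi> (u, v) - \<psi> (0, v) \<le> 1 / sqrt a * \<theta> (norm u) / (1 - D1)"
proof -
  have C1: "C1_fun \<psi>" using \<psi> by (simp add: adm_def)
  define K where "K = 1 / sqrt a * \<theta> (norm u)"
  define f where "f s = \<psi> ((0, v) + s *\<^sub>R (u, 0)) - K * (s powr (1 - D1) / (1 - D1))" for s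
  have "f 0 \<ge> f 1"
  proof (rule DERIV_nonpos_imp_decreasing_open [of 0 1 f])
    fix s :: real assume s: "0 < s" "s < 1"
    define z where "z = (0, v) + s *\<^sub>R (u, 0)"
    have z: "fst z = s *\<^sub>R u" by (simp add: z_def)
    have "((\<lambda>s. s powr (1 - D1) / (1 - D1)) has_real_derivative s powr (- D1)) (at s)"
      using s D by (auto intro!: derivative_eq_intros)
    then have "(f has_real_derivative (grad \<psi> z \<bullet> (u, 0) - K * s powr (- D1))) (at s)"
      unfolding f_def z_def
      by (intro DERIV_diff C1_fun_vector_derivative_along C1 DERIV_cmult)
    moreover have "grad \<psi> z \<bullet> (u, 0) \<le> K * s powr (- D1)"
    proof -
      have w: "s powr D1 * w1 (norm u) \<le> w1 (norm (fst z))"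
        using w_scale(1) [of s "norm u"] s u by (simp add: z)
      have "grad \<psi> z \<bullet> (u, 0) \<le> norm (fst (grad \<psi> z)) * norm u"
        by (simp add: inner_prod_def norm_cauchy_schwarz)
      also have "\<dots> \<le> 1 / sqrt a / w1 (norm (fst z)) * norm u"
        using s u by (intro mult_right_mono adm_grad(1) \<psi>) (auto simp: z)
      also have "\<dots> \<le> 1 / sqrt a / (s powr D1 * w1 (norm u)) * norm u"
        using w s u a w_pos(1) [of "norm u"] w_pos(1) [of "norm (fst z)"]
        by (intro mult_right_mono divide_left_mono) (auto simp: z)
      also have "\<dots> = K * s powr (- D1)"
        using s by (simp add: K_def \<theta>_def powr_minus divide_simps)
      finally show ?thesis .
    qed
    ultimately show "\<exists>y. (f has_real_derivative y) (at s) \<and> y \<le> 0" by (metis diff_le_0_iff_le)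
  next
    show "continuous_on {0..1} f" unfolding f_def
      using D by (intro continuous_intros continuous_on_compose2 [OF C1_fun_continuous [OF C1, of UNIV]]
          continuous_on_powr') auto
  qed simp
  then show ?thesis using D by (simp add: f_def K_def)
qed

lemma adm_radial:
  assumes \<psi>: "adm \<psi>" and u: "norm u \<le> l * R" "0 < R" "1 \<le> l"
  shows "\<bar>\<psi> (u, v) - \<psi> (0, v)\<bar> \<le> 1 / sqrt a * (l * \<theta> R) / (1 - D1)"
proof (cases "u = 0")
  case True
  then show ?thesis using D a \<theta>_pos [OF u(2)] u by simp
next
  case False
  have "\<theta> (norm u) \<le> l * \<theta> R"
    using \<theta>_mono [of "norm u" "l * R"] \<theta>_expand [OF u(2,3)] u False by (simp add: order_trans)
  then have "1 / sqrt a * \<theta> (norm u) / (1 - D1) \<le> 1 / sqrt a * (l * \<theta> R) / (1 - D1)"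
    using D a by (intro divide_right_mono mult_left_mono) auto
  moreover have "\<bar>\<psi> (u, v) - \<psi> (0, v)\<bar> \<le> 1 / sqrt a * \<theta> (norm u) / (1 - D1)"
    using adm_radial_one_sided [OF \<psi> False, of v] adm_radial_one_sided [OF adm_uminus [OF \<psi>] False, of v]
    by (simp add: abs_le_iff)
  ultimately show ?thesis by simp
qed

section \<open>Inclusions between intrinsic balls and boxes\<close>

lemma ball_cI:
  assumes "\<And>\<psi>. adm \<psi> \<Longrightarrow> \<bar>\<psi> x - \<psi> y\<bar> \<le> K" "K < r"
  shows "y \<in> ball_c c x r"
proof -
  have "dist_c c x y \<le> ereal K"
    unfolding dist_c_adm using assms(1) by (intro SUP_least) (auto simp: abs_le_iff)
  then show ?thesis using assms(2) by (auto simp: ball_c_def intro: le_less_trans)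
qed

text \<open>Large enough for both upper bounds: four radial legs and one vertical leg near the
  degenerate set, and \<open>1/2 + 2 powr D2\<close> away from it. The surplus makes the
  inequalities strict.\<close>

definition "k2 = 1 / sqrt a * (4 * real DIM('n) / (1 - D1) + 2 + 2 powr D2)"
text \<open>Here \<open>9/16\<close> is a lower bound for the bump at half its radius, 16 is the
  square of the gradient constant 4, and \<open>64\<close> and \<open>(2 powr D2)\<^sup>2\<close>
  bound the squared ratios of weight to box size in \<open>far_lower\<close>.\<close>

definition "k1 = 9/16 * (1 / sqrt (16 * a' * (64 + (2 powr D2)\<^sup>2)))"

lemma k_pos: "0 < k1" "0 < k2"
proof -
  have "0 < 64 + (2 powr D2)\<^sup>2" by (intro add_pos_nonneg) auto
  then show "0 < k1" using a by (simp add: k1_def)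
  have "0 \<le> 4 * real DIM('n) / (1 - D1)" using D by (intro divide_nonneg_pos) auto
  moreover have "0 < 2 powr D2" by simp
  ultimately have "0 < 4 * real DIM('n) / (1 - D1) + 2 + 2 powr D2" by linarith
  then show "0 < k2" using a by (simp add: k2_def)
qed

text \<open>The path goes from \<open>x\<close> to the degenerate set, out to
  \<open>R *\<^sub>R b\<close> with \<open>snd x\<close> fixed, across to \<open>snd y\<close>, back
  to the degenerate set and out to \<open>y\<close>. The four radial legs cost at most
  \<open>q\<close> each, and the second variable changes only where its weight is
  \<open>w2 R\<close>.\<close>

lemma near_upper:
  assumes x: "norm (fst x) \<le> real DIM('n) * R" and R: "0 < R" and y: "y \<in> nbox (snd x) R"
  shows "y \<in> ball_c c x (k2 * \<theta> R)"
proof (rule ball_cI)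
  define q where "q = 1 / sqrt a * (real DIM('n) * \<theta> R) / (1 - D1)"
  define K where "K = 4 * q + 1 / sqrt a * \<theta> R"
  have n1: "1 \<le> real DIM('n)" by (simp add: Suc_le_eq)
  show "\<bar>\<psi> x - \<psi> y\<bar> \<le> K" if \<psi>: "adm \<psi>" for \<psi>
  proof -
    obtain b :: 'n where b: "b \<in> Basis" using nonempty_Basis by blast
    have nb: "norm (R *\<^sub>R b) = R" using b R by simp
    have b0: "R *\<^sub>R b \<noteq> 0" using nb R by auto
    have nb': "norm (R *\<^sub>R b) \<le> real DIM('n) * R" using nb n1 R by (simp add: mult_le_cancel_right1)
    note rad = adm_radial [OF \<psi> _ R n1]
    have 1: "\<bar>\<psi> (fst x, snd x) - \<psi> (0, snd x)\<bar> \<le> q" using rad [OF x, of "snd x"] by (simp only: q_def)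
    have 2: "\<bar>\<psi> (R *\<^sub>R b, snd x) - \<psi> (0, snd x)\<bar> \<le> q" using rad [OF nb', of "snd x"] by (simp only: q_def)
    have 3: "\<bar>\<psi> (R *\<^sub>R b, snd y) - \<psi> (0, snd y)\<bar> \<le> q" using rad [OF nb', of "snd y"] by (simp only: q_def)
    have 4: "\<bar>\<psi> (fst y, snd y) - \<psi> (0, snd y)\<bar> \<le> q" using rad [OF nbox_norm [OF y], of "snd y"] by (simp only: q_def)
    have "\<bar>\<psi> (R *\<^sub>R b, snd x) - \<psi> (R *\<^sub>R b, snd y)\<bar> \<le> 1 / sqrt a * (norm (snd x - snd y) / w2 (norm (R *\<^sub>R b)))"
      by (rule adm_vertical [OF \<psi> b0])
    also have "\<dots> \<le> 1 / sqrt a * \<theta> R"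
    proof -
      have "norm (snd x - snd y) / w2 R \<le> \<theta> R"
        using y w_pos(2) [OF R] by (simp add: nbox_def dist_norm divide_le_eq)
      then show ?thesis unfolding nb using a by (intro mult_left_mono) auto
    qed
    finally have 5: "\<bar>\<psi> (R *\<^sub>R b, snd x) - \<psi> (R *\<^sub>R b, snd y)\<bar> \<le> 1 / sqrt a * \<theta> R" .
    have "\<bar>\<psi> (fst x, snd x) - \<psi> (fst y, snd y)\<bar> \<le> K"
      unfolding K_def using 1 2 3 4 5 by linarith
    then show ?thesis by simp
  qed
  have "K = 1 / sqrt a * (4 * real DIM('n) / (1 - D1) + 1) * \<theta> R"
    by (simp add: K_def q_def algebra_simps)
  also have "\<dots> < k2 * \<theta> R"
    unfolding k2_def
  proof (intro mult_strict_right_mono mult_strict_left_mono)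
    have "0 < 2 powr D2" by simp
    then show "4 * real DIM('n) / (1 - D1) + 1 < 4 * real DIM('n) / (1 - D1) + 2 + 2 powr D2" by linarith
  qed (use a \<theta>_pos [OF R] in auto)
  finally show "K < k2 * \<theta> R" .
qed

text \<open>A box with the weights frozen at \<open>x\<close>. The divisor 4, together with the
  condition \<open>r * w1 (norm (fst x)) \<le> 2 * norm (fst x)\<close>, keeps it at distance at
  least \<open>norm (fst x) / 2\<close> from the degenerate set.\<close>

definition fbox :: "'n \<times> 'm \<Rightarrow> real \<Rightarrow> ('n \<times> 'm) set" where
  "fbox x r = ball (fst x) (r * w1 (norm (fst x)) / 4) \<times> ball (snd x) (r * w2 (norm (fst x)))"

lemma fbox_facts: "fbox x r \<in> sets borel" "bounded (fbox x r)" "convex (fbox x r)"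
  unfolding fbox_def by (intro borel_open open_Times open_ball bounded_Times bounded_ball convex_Times convex_ball)+

lemma fbox_far:
  assumes y: "y \<in> fbox x r" and r: "r * w1 (norm (fst x)) \<le> 2 * norm (fst x)"
  shows "norm (fst x) / 2 < norm (fst y)"
proof -
  have "norm (fst x - fst y) < norm (fst x) / 2"
    using y r by (auto simp: fbox_def dist_norm mem_Times_iff)
  then show ?thesis using norm_triangle_ineq2 [of "fst x" "fst x - fst y"] by simp
qed

text \<open>Two legs suffice: a horizontal one with \<open>snd x\<close> fixed and a vertical one at
  \<open>fst y\<close>. Along both the weights are at least a fixed fraction of those at
  \<open>x\<close>.\<close>

lemma far_upper:
  assumes x: "fst x \<noteq> 0" and r: "0 < r" "r * w1 (norm (fst x)) \<le> 2 * norm (fst x)" and y: "y \<in> fbox x r"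
  shows "y \<in> ball_c c x (k2 * r)"
proof (rule ball_cI)
  define t where "t = norm (fst x)"
  define K where "K = 1 / sqrt a * (1 / 2 * r) + 1 / sqrt a * (2 powr D2 * r)"
  have t: "0 < t" using x by (simp add: t_def)
  have yx: "norm (fst x - fst y) < r * w1 t / 4" "norm (snd x - snd y) < r * w2 t"
    using y by (auto simp: fbox_def t_def dist_norm mem_Times_iff)
  show "\<bar>\<psi> x - \<psi> y\<bar> \<le> K" if \<psi>: "adm \<psi>" for \<psi>
  proof -
    have "\<bar>\<psi> (fst x, snd x) - \<psi> (fst y, snd x)\<bar> \<le> 1 / sqrt a * (norm (fst x - fst y) / w1 (t/2))"
      using t y r w_pos(1) [OF t]
      by (intro adm_horizontal [OF \<psi>, where p = "fst x" and \<epsilon> = "r * w1 t / 4"]) (auto simp: fbox_def t_def)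
    also have "\<dots> \<le> 1 / sqrt a * (1 / 2 * r)"
    proof (intro mult_left_mono)
      have "norm (fst x - fst y) \<le> r * w1 t / 4" using yx by simp
      also have "\<dots> \<le> r * (2 * w1 (t/2)) / 4" using w_half(1) [OF t] r by (intro divide_right_mono mult_left_mono) auto
      finally show "norm (fst x - fst y) / w1 (t/2) \<le> 1 / 2 * r"
        using w_pos(1) [of "t/2"] t by (simp add: divide_le_eq)
    qed (use a in auto)
    finally have 1: "\<bar>\<psi> (fst x, snd x) - \<psi> (fst y, snd x)\<bar> \<le> 1 / sqrt a * (1 / 2 * r)" .
    have ty: "t/2 < norm (fst y)" using fbox_far [OF y r(2)] by (simp add: t_def)
    have "\<bar>\<psi> (fst y, snd x) - \<psi> (fst y, snd y)\<bar> \<le> 1 / sqrt a * (norm (snd x - snd y) / w2 (norm (fst y)))"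
      using ty t by (intro adm_vertical [OF \<psi>]) auto
    also have "\<dots> \<le> 1 / sqrt a * (2 powr D2 * r)"
    proof (intro mult_left_mono)
      have "norm (snd x - snd y) \<le> r * w2 t" using yx by simp
      also have "\<dots> \<le> r * (2 powr D2 * w2 (t/2))" using w_half(2) [OF t] r by (intro mult_left_mono) auto
      also have "\<dots> \<le> r * (2 powr D2 * w2 (norm (fst y)))"
        using w_mono(2) [of "t/2" "norm (fst y)"] ty t r by (intro mult_left_mono) auto
      finally have "norm (snd x - snd y) \<le> 2 powr D2 * r * w2 (norm (fst y))" by (simp only: mult_ac)
      moreover have "0 < w2 (norm (fst y))" using ty t by (intro w_pos(2)) linarith
      ultimately show "norm (snd x - snd y) / w2 (norm (fst y)) \<le> 2 powr D2 * r"
        by (simp only: pos_divide_le_eq)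
    qed (use a in auto)
    finally have "\<bar>\<psi> (fst x, snd x) - \<psi> (fst y, snd y)\<bar> \<le> K" using 1 unfolding K_def by linarith
    then show ?thesis by simp
  qed
  have "K = 1 / sqrt a * (1/2 + 2 powr D2) * r" by (simp add: K_def algebra_simps)
  also have "\<dots> < k2 * r"
    unfolding k2_def
  proof (intro mult_strict_right_mono mult_strict_left_mono)
    have "0 \<le> 4 * real DIM('n) / (1 - D1)" using D by (intro divide_nonneg_pos) auto
    then show "1/2 + 2 powr D2 < 4 * real DIM('n) / (1 - D1) + 2 + 2 powr D2" by linarith
  qed (use a r in auto)
  finally show "K < k2 * r" .
qed

text \<open>A product of two bumps of height \<open>h\<close> has gradient components at most
  \<open>4 * h / \<rho>1\<close> and \<open>4 * h / \<rho>2\<close>, so \<open>le\<close> makes it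
  admissible. It vanishes off the product of the two balls, while at \<open>x\<close>, within half
  the first radius, it is at least \<open>(3/4)\<^sup>2 * h\<close>. The centre \<open>p\<close> is
  free: it is the origin near the degenerate set and \<open>fst x\<close> away from it.\<close>

lemma bump_lower:
  assumes h: "0 < h" and \<rho>: "0 < \<rho>1" "0 < \<rho>2" and x: "norm (fst x - p) \<le> \<rho>1 / 2"
    and W: "\<And>u. norm (u - p) < \<rho>1 \<Longrightarrow> w1 (norm u) \<le> W1" "\<And>u. norm (u - p) < \<rho>1 \<Longrightarrow> w2 (norm u) \<le> W2"
    and le: "16 * a' * h\<^sup>2 * ((W1 / \<rho>1)\<^sup>2 + (W2 / \<rho>2)\<^sup>2) \<le> 1"
    and y: "y \<in> ball_c c x (9/16 * h)"
  shows "norm (fst y - p) < \<rho>1 \<and> dist (snd x) (snd y) < \<rho>2"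
proof (rule ccontr)
  assume neg: "\<not> ?thesis"
  define \<psi> where "\<psi> y = h * (bump p \<rho>1 (fst y) * bump (snd x) \<rho>2 (snd y))" for y :: "'n \<times> 'm"
  have C1: "C1_fun \<psi>" unfolding \<psi>_def by (rule bump_product_C1)
  have g: "grad \<psi> z = (h * bump (snd x) \<rho>2 (snd z)) *\<^sub>R (bump_grad p \<rho>1 (fst z), 0)
        + (h * bump p \<rho>1 (fst z)) *\<^sub>R (0, bump_grad (snd x) \<rho>2 (snd z))" for z
    unfolding \<psi>_def by (rule bump_product_C1)
  have "a' * energy \<psi> z \<le> 1" for z
  proof (cases "norm (fst z - p) < \<rho>1")
    case True
    have "norm (fst (grad \<psi> z)) = h * bump (snd x) \<rho>2 (snd z) * norm (bump_grad p \<rho>1 (fst z))"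
      using h bump_bounds(1) [of "snd x" \<rho>2 "snd z"] by (simp add: g abs_mult)
    also have "\<dots> \<le> h * 1 * (4 / \<rho>1)"
      using h \<rho> by (intro mult_mono bump_bounds bump_grad_norm) auto
    finally have g1: "norm (fst (grad \<psi> z)) \<le> 4 * h / \<rho>1" by (simp add: mult.commute)
    have "norm (snd (grad \<psi> z)) = h * bump p \<rho>1 (fst z) * norm (bump_grad (snd x) \<rho>2 (snd z))"
      using h bump_bounds(1) [of p \<rho>1 "fst z"] by (simp add: g abs_mult)
    also have "\<dots> \<le> h * 1 * (4 / \<rho>2)"
      using h \<rho> by (intro mult_mono bump_bounds bump_grad_norm) auto
    finally have g2: "norm (snd (grad \<psi> z)) \<le> 4 * h / \<rho>2" by (simp add: mult.commute)
    have "w1 (norm (fst z)) * norm (fst (grad \<psi> z)) \<le> W1 * (4 * h / \<rho>1)"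
      using W(1) [OF True] g1 w_nonneg(1) [of "norm (fst z)"] by (intro mult_mono) auto
    then have 1: "(w1 (norm (fst z)) * norm (fst (grad \<psi> z)))\<^sup>2 \<le> (W1 * (4 * h / \<rho>1))\<^sup>2"
      using w_nonneg by (intro power_mono) auto
    have "w2 (norm (fst z)) * norm (snd (grad \<psi> z)) \<le> W2 * (4 * h / \<rho>2)"
      using W(2) [OF True] g2 w_nonneg(2) [of "norm (fst z)"] by (intro mult_mono) auto
    then have 2: "(w2 (norm (fst z)) * norm (snd (grad \<psi> z)))\<^sup>2 \<le> (W2 * (4 * h / \<rho>2))\<^sup>2"
      using w_nonneg by (intro power_mono) auto
    have "a' * energy \<psi> z \<le> a' * ((W1 * (4 * h / \<rho>1))\<^sup>2 + (W2 * (4 * h / \<rho>2))\<^sup>2)"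
      using a 1 2 by (intro mult_left_mono) (auto simp: energy_def power_mult_distrib)
    also have "\<dots> = 16 * a' * h\<^sup>2 * ((W1 / \<rho>1)\<^sup>2 + (W2 / \<rho>2)\<^sup>2)"
      by (simp add: power_mult_distrib power_divide algebra_simps)
    also have "\<dots> \<le> 1" by (rule le)
    finally show ?thesis .
  next
    case False
    then have "grad \<psi> z = 0"
      using bump_outside [OF \<rho>(1), of "fst z" p] by (simp add: g zero_prod_def)
    then show ?thesis by (simp add: energy_def)
  qed
  then have "adm \<psi>" using C1 by (intro admI)
  then have "ereal (\<psi> x - \<psi> y) \<le> dist_c c x y"
    unfolding dist_c_adm by (intro SUP_upper) auto
  also have "\<dots> < ereal (9/16 * h)" using y by (simp add: ball_c_def)
  finally have "\<psi> x - \<psi> y < 9/16 * h" by simp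
  moreover have "\<psi> y = 0"
    using neg bump_outside(1) [OF \<rho>(1), of "fst y" p] bump_outside(1) [OF \<rho>(2), of "snd y" "snd x"]
    by (auto simp: \<psi>_def not_less dist_norm norm_minus_commute)
  moreover have "9/16 * h \<le> \<psi> x"
  proof -
    have "(norm (fst x - p))\<^sup>2 \<le> (\<rho>1 / 2)\<^sup>2" using x by (intro power_mono) auto
    then have "3/4 \<le> 1 - (norm (fst x - p))\<^sup>2 / \<rho>1\<^sup>2"
      using \<rho> by (simp add: power_divide divide_le_eq)
    then have "(3/4)\<^sup>2 \<le> bump p \<rho>1 (fst x)"
      unfolding bump_def by (intro power_mono max.coboundedI2) auto
    moreover have "bump (snd x) \<rho>2 (snd x) = 1" by (simp add: bump_def)
    ultimately show ?thesis using h by (simp add: \<psi>_def power2_eq_square)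
  qed
  ultimately show False by simp
qed

text \<open>The height \<open>16/9 * k1 * r\<close> is normalized so that equality holds when both
  ratios take their largest permitted values.\<close>

lemma k1_bound:
  assumes "0 \<le> p" "p \<le> 64 / r\<^sup>2" "0 \<le> q" "q \<le> (2 powr D2)\<^sup>2 / r\<^sup>2" "0 < r"
  shows "16 * a' * (16/9 * k1 * r)\<^sup>2 * (p + q) \<le> 1"
proof -
  have pos: "0 < 64 + (2 powr D2)\<^sup>2" by (intro add_pos_nonneg) auto
  have "(16/9 * k1 * r)\<^sup>2 = r\<^sup>2 / (16 * a' * (64 + (2 powr D2)\<^sup>2))"
    using a pos by (simp add: k1_def power_mult_distrib power_divide)
  then have "16 * a' * (16/9 * k1 * r)\<^sup>2 * (p + q) = r\<^sup>2 / (64 + (2 powr D2)\<^sup>2) * (p + q)"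
    using a by simp
  also have "\<dots> \<le> r\<^sup>2 / (64 + (2 powr D2)\<^sup>2) * (64 / r\<^sup>2 + (2 powr D2)\<^sup>2 / r\<^sup>2)"
    using assms pos by (intro mult_left_mono) auto
  also have "\<dots> = 1" using assms pos by (simp flip: add_divide_distrib)
  finally show ?thesis .
qed

text \<open>The bump is centred at the degenerate set, not at \<open>fst x\<close>, so that its
  support in the first variable is the ball of radius \<open>R\<close> inside the cube. This is why
  \<open>fst x\<close> has to lie in the inner half.\<close>

lemma near_lower:
  assumes x: "norm (fst x) \<le> R / 2" and R: "0 < R"
  shows "ball_c c x (k1 * \<theta> R) \<subseteq> nbox (snd x) R"
proof
  fix y assume y: "y \<in> ball_c c x (k1 * \<theta> R)"
  have \<theta>: "0 < \<theta> R" using R by (rule \<theta>_pos)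
  have w: "0 < w1 R" "0 < w2 R" using R w_pos by auto
  have "norm (fst y - 0) < R \<and> dist (snd x) (snd y) < \<theta> R * w2 R"
  proof (rule bump_lower [where h = "16/9 * k1 * \<theta> R" and ?W1.0 = "w1 R" and ?W2.0 = "w2 R"])
    show "16 * a' * (16/9 * k1 * \<theta> R)\<^sup>2 * ((w1 R / R)\<^sup>2 + (w2 R / (\<theta> R * w2 R))\<^sup>2) \<le> 1"
    proof (rule k1_bound)
      have "w1 R / R = 1 / \<theta> R" by (simp add: \<theta>_def)
      then show "(w1 R / R)\<^sup>2 \<le> 64 / (\<theta> R)\<^sup>2" using \<theta> by (simp add: power_divide divide_right_mono)
      have "1 \<le> (2 powr D2)\<^sup>2" using D by (intro one_le_power ge_one_powr_ge_zero) auto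
      moreover have "w2 R / (\<theta> R * w2 R) = 1 / \<theta> R" using w by simp
      ultimately show "(w2 R / (\<theta> R * w2 R))\<^sup>2 \<le> (2 powr D2)\<^sup>2 / (\<theta> R)\<^sup>2"
        by (simp add: power_divide divide_right_mono)
    qed (use \<theta> in auto)
    have "9/16 * (16/9 * k1 * \<theta> R) = k1 * \<theta> R" by simp
    then show "y \<in> ball_c c x (9/16 * (16/9 * k1 * \<theta> R))" using y by (simp only:)
    show "norm (fst x - 0) \<le> R / 2" using x by simp
    show "w1 (norm u) \<le> w1 R" "w2 (norm u) \<le> w2 R" if "norm (u - 0) < R" for u :: 'n
      using that w_mono by auto
  qed (use R \<theta> w k_pos in auto)
  moreover have "\<bar>fst y \<bullet> i\<bar> \<le> norm (fst y)" if "i \<in> Basis" for i using that by (rule Basis_le_norm)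
  ultimately show "y \<in> nbox (snd x) R" by (fastforce simp: nbox_def intro: le_less_trans)
qed

lemma far_lower:
  assumes x: "fst x \<noteq> 0" and r: "0 < r" "r * w1 (norm (fst x)) \<le> 2 * norm (fst x)"
  shows "ball_c c x (k1 * r) \<subseteq> fbox x r"
proof
  fix y assume y: "y \<in> ball_c c x (k1 * r)"
  define t where "t = norm (fst x)"
  have t: "0 < t" using x by (simp add: t_def)
  have w: "0 < w1 t" "0 < w2 t" using t w_pos by auto
  have "norm (fst y - fst x) < r * w1 t / 4 \<and> dist (snd x) (snd y) < r * w2 t"
  proof (rule bump_lower [where h = "16/9 * k1 * r" and ?W1.0 = "2 * w1 t" and ?W2.0 = "2 powr D2 * w2 t"])
    show "16 * a' * (16/9 * k1 * r)\<^sup>2 * ((2 * w1 t / (r * w1 t / 4))\<^sup>2 + (2 powr D2 * w2 t / (r * w2 t))\<^sup>2) \<le> 1"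
    proof (rule k1_bound)
      have "2 * w1 t / (r * w1 t / 4) = 8 / r" using w by simp
      then show "(2 * w1 t / (r * w1 t / 4))\<^sup>2 \<le> 64 / r\<^sup>2" by (simp add: power_divide)
      have "2 powr D2 * w2 t / (r * w2 t) = 2 powr D2 / r" using w by simp
      then show "(2 powr D2 * w2 t / (r * w2 t))\<^sup>2 \<le> (2 powr D2)\<^sup>2 / r\<^sup>2" by (simp add: power_divide)
    qed (use r in auto)
    have "9/16 * (16/9 * k1 * r) = k1 * r" by simp
    then show "y \<in> ball_c c x (9/16 * (16/9 * k1 * r))" using y by (simp only:)
    fix u assume "norm (u - fst x) < r * w1 t / 4"
    then have "norm u \<le> 2 * t"
      using norm_triangle_sub [of u "fst x"] r(2) t unfolding t_def by linarith
    then show "w1 (norm u) \<le> 2 * w1 t" "w2 (norm u) \<le> 2 powr D2 * w2 t"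
      using w_mono(1) [of "norm u" "2 * t"] w_mono(2) [of "norm u" "2 * t"] w_half(1) [of "2 * t"] w_half(2) [of "2 * t"] t
      by auto
  qed (use r w k_pos in auto)
  then show "y \<in> fbox x r"
    by (simp add: fbox_def t_def dist_norm norm_minus_commute mem_Times_iff)
qed

text \<open>The box \<open>S\<close> lies between the two balls. Over \<open>V\<close> the mean is
  at least as good as the constant found on \<open>S\<close>, deviations grow from \<open>V\<close>
  to \<open>S\<close>, and the energy over \<open>S\<close> is at most \<open>1 / a\<close> times
  the integral of \<open>Gam\<close> over \<open>U\<close>.\<close>

lemma poincare_from_osc:
  assumes C1: "C1_fun \<phi>" and S: "S \<in> sets borel" "bounded S"
    and V: "V \<in> sets lebesgue" "V \<subseteq> S" and U: "S \<subseteq> U"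
    and osc: "osc_le S \<phi> (ennreal K * (energy_on \<phi> S))"
    and lam: "0 \<le> lam" "lam / r\<^sup>2 * K \<le> a"
  shows "poincare_at c lam r U V \<phi>"
proof -
  have [measurable]: "\<phi> \<in> borel_measurable borel" "energy \<phi> \<in> borel_measurable borel" "S \<in> sets borel"
    using C1_fun_measurable energy_measurable C1 S by auto
  obtain m where m: "(sq_dev S \<phi> m) \<le> ennreal K * (energy_on \<phi> S)"
    using osc by (auto simp: osc_le_def)
  obtain B where B: "\<And>x. x \<in> S \<Longrightarrow> norm (\<phi> x) \<le> B"
    using continuous_bounded_on_bounded [OF C1_fun_continuous [OF C1] S(2)] by metis
  have "emeasure lebesgue V \<le> emeasure lebesgue S"
    using S V by (intro emeasure_mono) auto
  also have "\<dots> < \<infinity>" using emeasure_bounded_finite [OF S(2)] by simp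
  finally have fin: "emeasure lebesgue V < \<infinity>" .
  have "(\<integral>\<^sup>+x\<in>V. ennreal ((\<phi> x - avg V \<phi>)\<^sup>2) \<partial>lebesgue) \<le> (\<integral>\<^sup>+x\<in>V. ennreal ((\<phi> x - m)\<^sup>2) \<partial>lebesgue)"
    using B V by (intro avg_minimizes fin) auto
  also have "\<dots> \<le> (\<integral>\<^sup>+x\<in>S. ennreal ((\<phi> x - m)\<^sup>2) \<partial>lebesgue)"
    using V by (intro nn_integral_mono) (auto simp: indicator_def)
  also have "\<dots> = sq_dev S \<phi> m" by (rule nn_integral_completion)
  also note m
  finally have "ennreal (lam / r\<^sup>2) * (\<integral>\<^sup>+x\<in>V. ennreal ((\<phi> x - avg V \<phi>)\<^sup>2) \<partial>lebesgue)
      \<le> ennreal (lam / r\<^sup>2) * (ennreal K * (energy_on \<phi> S))"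
    by (rule mult_left_mono) simp
  also have "\<dots> = ennreal (lam / r\<^sup>2 * K) * (energy_on \<phi> S)"
    using lam by (intro ennreal_mult_mult) auto
  also have "\<dots> \<le> ennreal a * (energy_on \<phi> S)"
    using lam by (intro mult_right_mono ennreal_leI) auto
  also have "\<dots> = (\<integral>\<^sup>+x\<in>S. ennreal (a * energy \<phi> x) \<partial>lborel)"
    using a by (intro set_nn_integral_cmult_ennreal [symmetric]) auto
  also have "\<dots> = (\<integral>\<^sup>+x\<in>S. ennreal (a * energy \<phi> x) \<partial>lebesgue)" by (rule nn_integral_completion [symmetric])
  also have "\<dots> \<le> (\<integral>\<^sup>+x\<in>U. ennreal (Gam c \<phi> x) \<partial>lebesgue)"
  proof (rule nn_integral_mono_AE)
    show "AE x in lebesgue. ennreal (a * energy \<phi> x) * indicator S x \<le> ennreal (Gam c \<phi> x) * indicator U x"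
      using Gam_bounds by eventually_elim (use U in \<open>auto simp: indicator_def ennreal_leI\<close>)
  qed
  finally show ?thesis unfolding poincare_at_def .
qed

text \<open>The weights on \<open>fbox x r\<close> are bounded below by fixed fractions of those at
  \<open>x\<close>. Intersecting with a convex \<open>H\<close> preserves this and convexity, so
  whole space and half spaces are covered together.\<close>

lemma fbox_osc:
  assumes C1: "C1_fun \<phi>" and x: "fst x \<noteq> 0" and r: "0 < r" "r * w1 (norm (fst x)) \<le> 2 * norm (fst x)"
    and H: "H \<in> sets borel" "convex H"
  shows "osc_le (fbox x r \<inter> H) \<phi> (ennreal (8 * 2 ^ DIM('n \<times> 'm) * (2 * 2 powr D2 * r)\<^sup>2)
    * (energy_on \<phi> (fbox x r \<inter> H)))"
proof (rule osc_le_convex [OF C1])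
  define t where "t = norm (fst x)"
  have t: "0 < t" using x by (simp add: t_def)
  have D2: "1 \<le> 2 powr D2" using D by (intro ge_one_powr_ge_zero) auto
  show "fbox x r \<inter> H \<in> sets borel"
    using H fbox_facts by auto
  show "convex (fbox x r \<inter> H)"
    using H fbox_facts by (intro convex_Int) auto
  show "emeasure lborel (fbox x r \<inter> H) < \<infinity>"
    by (intro emeasure_bounded_finite bounded_Int disjI1 fbox_facts)
  show "0 \<le> 2 * 2 powr D2 * r" using r by simp
  fix y y' z assume yz: "y \<in> fbox x r \<inter> H" "y' \<in> fbox x r \<inter> H" "z \<in> fbox x r \<inter> H"
  have z: "t/2 \<le> norm (fst z)" using fbox_far [of z x r] r yz by (simp add: t_def)
  have wz: "w1 (t/2) \<le> w1 (norm (fst z))" "w2 (t/2) \<le> w2 (norm (fst z))" using z t w_mono by auto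
  have "norm (fst y - fst y') \<le> dist (fst x) (fst y) + dist (fst x) (fst y')"
    using dist_triangle3 [of "fst y" "fst y'" "fst x"] by (simp add: dist_norm)
  also have "\<dots> \<le> r * w1 t / 2" using yz by (simp add: fbox_def t_def mem_Times_iff)
  also have "\<dots> \<le> r * (2 * w1 (t/2)) / 2" using w_half(1) [OF t] r by (intro divide_right_mono mult_left_mono) auto
  also have "\<dots> \<le> r * w1 (norm (fst z))" using wz r by simp
  also have "\<dots> \<le> 2 * 2 powr D2 * r * w1 (norm (fst z))"
    using D2 r w_nonneg(1) [of "norm (fst z)"] mult_right_mono [of 1 "2 * 2 powr D2" "r * w1 (norm (fst z))"] by simp
  finally show "norm (fst y - fst y') \<le> 2 * 2 powr D2 * r * w1 (norm (fst z))" .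
  have "norm (snd y - snd y') \<le> dist (snd x) (snd y) + dist (snd x) (snd y')"
    using dist_triangle3 [of "snd y" "snd y'" "snd x"] by (simp add: dist_norm)
  also have "\<dots> \<le> 2 * r * w2 t" using yz by (simp add: fbox_def t_def mem_Times_iff)
  also have "\<dots> \<le> 2 * r * (2 powr D2 * w2 (t/2))" using w_half(2) [OF t] r by (intro mult_left_mono) auto
  also have "\<dots> \<le> 2 * r * (2 powr D2 * w2 (norm (fst z)))" using wz r by (intro mult_left_mono) auto
  finally show "norm (snd y - snd y') \<le> 2 * 2 powr D2 * r * w2 (norm (fst z))" by (simp add: mult_ac)
qed

text \<open>A family of sets, rather than one set, yields constants common to both half spaces. With
  \<open>s = r / k2\<close> the box of size \<open>s\<close> lies in the ball of radius
  \<open>r\<close>, and \<open>\<kappa> \<le> k1 / k2\<close> puts the shrunk ball into that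
  box.\<close>

lemma poincare_on_balls:
  assumes Hs: "\<And>H. H \<in> \<H> \<Longrightarrow> H \<in> sets borel" "\<And>H. H \<in> \<H> \<Longrightarrow> convex H" and C: "0 \<le> C"
    and near: "\<And>H y R \<phi>. H \<in> \<H> \<Longrightarrow> C1_fun \<phi> \<Longrightarrow> 0 < R \<Longrightarrow>
      osc_le (nbox y R \<inter> H) \<phi> (ennreal (C * (\<theta> R)\<^sup>2) * (energy_on \<phi> (nbox y R \<inter> H)))"
  shows "\<exists>lam>0. \<exists>\<kappa>. 0 < \<kappa> \<and> \<kappa> \<le> 1 \<and> (\<forall>H\<in>\<H>. \<forall>x. \<forall>r>0. \<forall>\<phi>. C1_fun \<phi> \<longrightarrow>
    poincare_at c lam r (ball_c c x r \<inter> H) (ball_c c x (\<kappa> * r) \<inter> H) \<phi>)"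
proof -
  define C' where "C' = C + 8 * 2 ^ DIM('n \<times> 'm) * (2 * 2 powr D2)\<^sup>2"
  have C': "C \<le> C'" "8 * 2 ^ DIM('n \<times> 'm) * (2 * 2 powr D2)\<^sup>2 \<le> C'" "0 < C'"
    using C by (auto simp: C'_def intro!: add_nonneg_pos)
  \<comment> \<open>Makes \<open>lam / r\<^sup>2 * (C' * s\<^sup>2)\<close> equal to
    \<open>a\<close> for \<open>s = r / k2\<close>.\<close>
  define lam where "lam = a * k2\<^sup>2 / C'"
  define \<kappa> where "\<kappa> = min 1 (k1 / k2)"
  have lam: "0 < lam" using a k_pos C' by (simp add: lam_def)
  have \<kappa>: "0 < \<kappa>" "\<kappa> \<le> 1" using k_pos by (auto simp: \<kappa>_def)
  have "poincare_at c lam r (ball_c c x r \<inter> H) (ball_c c x (\<kappa> * r) \<inter> H) \<phi>" if mem: "H \<in> \<H>" and r: "0 < r" and C1: "C1_fun \<phi>" for H x r \<phi>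
  proof -
    note H = Hs [OF mem]
    define s where "s = r / k2"
    have s: "0 < s" "k2 * s = r" using r k_pos by (auto simp: s_def)
    have "\<kappa> * r \<le> k1 / k2 * r" using r by (intro mult_right_mono) (auto simp: \<kappa>_def)
    also have "\<dots> = k1 * s" by (simp add: s_def)
    finally have inner: "ball_c c x (\<kappa> * r) \<subseteq> ball_c c x (k1 * s)" by (rule ball_c_mono)
    have V: "ball_c c x (\<kappa> * r) \<inter> H \<in> sets lebesgue"
      using H ball_c_sets_lebesgue [of c x "\<kappa> * r"] by auto
    have const: "lam / r\<^sup>2 * (K * s\<^sup>2) \<le> a" if "K \<le> C'" for K
    proof -
      have "lam / r\<^sup>2 * (K * s\<^sup>2) \<le> lam / r\<^sup>2 * (C' * s\<^sup>2)"
        using that lam by (intro mult_left_mono mult_right_mono) auto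
      also have "\<dots> = a" using C' k_pos r by (simp add: lam_def s_def power_divide)
      finally show ?thesis .
    qed
    obtain R where R: "0 < R" "\<theta> R = s" using \<theta>_surj [OF s(1)] by blast
    show ?thesis
    proof (cases "norm (fst x) \<le> R / 2")
      case True
      have n1: "R \<le> real DIM('n) * R" using R by (simp add: mult_le_cancel_right1 Suc_le_eq)
      show ?thesis
      proof (rule poincare_from_osc [OF C1 _ _ V _ _ near [OF mem C1 R(1), of "snd x"]])
        show "nbox (snd x) R \<inter> H \<in> sets borel" using H nbox_facts by auto
        show "bounded (nbox (snd x) R \<inter> H)" by (intro bounded_Int disjI1 nbox_facts)
        show "ball_c c x (\<kappa> * r) \<inter> H \<subseteq> nbox (snd x) R \<inter> H"
          using inner near_lower [OF True R(1)] R by auto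
        show "nbox (snd x) R \<inter> H \<subseteq> ball_c c x r \<inter> H"
          using near_upper [of x R] True R s n1 by auto
        show "lam / r\<^sup>2 * (C * (\<theta> R)\<^sup>2) \<le> a" using const C' R by simp
      qed (use lam in auto)
    next
      case False
      \<comment> \<open>Since \<open>\<theta>\<close> grows at most linearly,
        \<open>R < 2 * norm (fst x)\<close> gives
        \<open>s \<le> 2 * \<theta> (norm (fst x))\<close>. Multiplied by \<open>w1\<close> this is
        the condition under which \<open>fbox x s\<close> stays away from the degenerate
        set.\<close>
      then have t: "0 < norm (fst x)" "R < 2 * norm (fst x)" using R by auto
      have "s \<le> \<theta> (2 * norm (fst x))" using \<theta>_mono [of R "2 * norm (fst x)"] R t by simp
      also have "\<dots> \<le> 2 * \<theta> (norm (fst x))" using \<theta>_expand [of "norm (fst x)" 2] t by simp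
      finally have "s * w1 (norm (fst x)) \<le> 2 * \<theta> (norm (fst x)) * w1 (norm (fst x))"
        using w_nonneg by (intro mult_right_mono) auto
      then have sw: "s * w1 (norm (fst x)) \<le> 2 * norm (fst x)" using \<theta>_w1 [OF t(1)] by (simp add: mult.assoc)
      have x: "fst x \<noteq> 0" using t by auto
      show ?thesis
      proof (rule poincare_from_osc [OF C1 _ _ V _ _ fbox_osc [OF C1 x s(1) sw H]])
        show "fbox x s \<inter> H \<in> sets borel"
          using H fbox_facts by auto
        show "bounded (fbox x s \<inter> H)"
          by (intro bounded_Int disjI1 fbox_facts)
        show "ball_c c x (\<kappa> * r) \<inter> H \<subseteq> fbox x s \<inter> H"
          using inner far_lower [OF x s(1) sw] by auto
        show "fbox x s \<inter> H \<subseteq> ball_c c x r \<inter> H"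
          using far_upper [OF x s(1) sw] s by auto
        show "lam / r\<^sup>2 * (8 * 2 ^ DIM('n \<times> 'm) * (2 * 2 powr D2 * s)\<^sup>2) \<le> a"
          using const [OF C'(2)] by (simp add: power_mult_distrib mult_ac)
      qed (use lam in auto)
    qed
  qed
  then show ?thesis using lam \<kappa> by blast
qed

lemma poincare_whole:
  assumes "2 \<le> DIM('n) \<or> DIM('n) = 1 \<and> D1 < 1/2"
  shows "\<exists>lam>0. \<exists>\<kappa>. 0 < \<kappa> \<and> \<kappa> \<le> 1 \<and> (\<forall>x. \<forall>r>0. \<forall>\<phi>. C1_fun \<phi> \<longrightarrow>
    poincare_at c lam r (ball_c c x r) (ball_c c x (\<kappa> * r)) \<phi>)"
proof -
  have "\<exists>C\<ge>0. \<forall>y R \<phi>. C1_fun \<phi> \<longrightarrow> 0 < R \<longrightarrow> osc_le (nbox y R) (\<phi> :: 'n \<times> 'm \<Rightarrow> real)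
      (ennreal (C * (\<theta> R)\<^sup>2) * (energy_on \<phi> (nbox y R)))"
    using assms
  proof
    assume n: "2 \<le> DIM('n)"
    have "0 \<le> chain_const TYPE('n) TYPE('m)"
      unfolding chain_const_def
      by (intro add_nonneg_nonneg mult_nonneg_nonneg near_const_nonneg) auto
    then have "0 \<le> 4 * (real (DIM('n) * 2) * chain_const TYPE('n) TYPE('m)) + 6 * 2 ^ DIM('n \<times> 'm) * (real DIM('n))\<^sup>2"
      by (intro add_nonneg_nonneg mult_nonneg_nonneg) auto
    then show ?thesis using near_osc_space [OF n, where 'm = 'm] by blast
  next
    assume n: "DIM('n) = 1 \<and> D1 < 1/2"
    have "0 \<le> 4 * (3 * near_const TYPE('n) TYPE('m) + 2 * refl_const TYPE('n) TYPE('m)) + 6 * 2 ^ DIM('n \<times> 'm)"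
      by (intro add_nonneg_nonneg mult_nonneg_nonneg near_const_nonneg refl_const_nonneg) auto
    then show ?thesis using near_osc_line [where 'n = 'n and 'm = 'm] n by blast
  qed
  then obtain C where C: "0 \<le> C" "\<And>y R \<phi>. C1_fun \<phi> \<Longrightarrow> 0 < R \<Longrightarrow> osc_le (nbox y R) (\<phi> :: 'n \<times> 'm \<Rightarrow> real)
      (ennreal (C * (\<theta> R)\<^sup>2) * (energy_on \<phi> (nbox y R)))" by blast
  then show ?thesis using poincare_on_balls [of "{UNIV}" C] by simp
qed

lemma poincare_half:
  assumes n: "DIM('n) = 1"
  shows "\<exists>lam>0. \<exists>\<kappa>. 0 < \<kappa> \<and> \<kappa> \<le> 1 \<and> (\<forall>s x. \<forall>r>0. \<forall>\<phi>. C1_fun \<phi> \<longrightarrow>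
    poincare_at c lam r (ball_c c x r \<inter> half s) (ball_c c x (\<kappa> * r) \<inter> half s) \<phi>)"
proof -
  have "0 \<le> 4 * near_const TYPE('n) TYPE('m) + 6 * 2 ^ DIM('n \<times> 'm)"
    by (intro add_nonneg_nonneg mult_nonneg_nonneg near_const_nonneg) auto
  then have "\<exists>lam>0. \<exists>\<kappa>. 0 < \<kappa> \<and> \<kappa> \<le> 1 \<and> (\<forall>H\<in>range half. \<forall>x. \<forall>r>0. \<forall>\<phi>. C1_fun \<phi> \<longrightarrow>
    poincare_at c lam r (ball_c c x r \<inter> H) (ball_c c x (\<kappa> * r) \<inter> H) \<phi>)"
  proof (rule poincare_on_balls [rotated 2])
    fix H :: "('n \<times> 'm) set" and y :: 'm and R :: real and \<phi> :: "'n \<times> 'm \<Rightarrow> real"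
    assume "H \<in> range half" "C1_fun \<phi>" "0 < R"
    then show "osc_le (nbox y R \<inter> H) \<phi>
      (ennreal ((4 * near_const TYPE('n) TYPE('m) + 6 * 2 ^ DIM('n \<times> 'm)) * (\<theta> R)\<^sup>2)
        * (energy_on \<phi> (nbox y R \<inter> H)))"
      using near_osc_half [OF n] by blast
  qed (auto simp: half_facts)
  then show ?thesis by simp
qed

end

subsection \<open>Failure for strong degeneracy in one dimension\<close>

lemma nn_integral_lborel_line:
  fixes b :: "'n::euclidean_space" and f :: "real \<Rightarrow> ennreal"
  assumes b: "Basis = {b}" and [measurable]: "f \<in> borel_measurable borel"
  shows "(\<integral>\<^sup>+x. f (x \<bullet> b) \<partial>lborel) = (\<integral>\<^sup>+s. f s \<partial>lborel)"
proof -
  have "b \<in> Basis" by (simp add: b)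
  then have bb: "b \<bullet> b = 1" by (rule inner_same_Basis)
  have "lborel = distr lborel borel (\<lambda>x :: 'n. x \<bullet> b)"
  proof (rule lborel_eqI)
    fix l u :: real assume lu: "\<And>i. i \<in> Basis \<Longrightarrow> l \<bullet> i \<le> u \<bullet> i"
    have "emeasure (distr lborel borel (\<lambda>x :: 'n. x \<bullet> b)) (box l u) = emeasure lborel ((\<lambda>x :: 'n. x \<bullet> b) -` box l u)"
      by (subst emeasure_distr) auto
    also have "(\<lambda>x :: 'n. x \<bullet> b) -` box l u = box (l *\<^sub>R b) (u *\<^sub>R b)"
      by (auto simp: box_def b bb)
    also have "emeasure lborel (box (l *\<^sub>R b) (u *\<^sub>R b)) = ennreal (u - l)"
      using lu by (subst emeasure_lborel_box) (auto simp: b bb inner_diff_left)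
    finally show "emeasure (distr lborel borel (\<lambda>x :: 'n. x \<bullet> b)) (box l u) = ennreal (\<Prod>i\<in>Basis. (u - l) \<bullet> i)"
      by simp
  qed simp
  then have "(\<integral>\<^sup>+s. f s \<partial>lborel) = (\<integral>\<^sup>+s. f s \<partial>(distr lborel borel (\<lambda>x :: 'n. x \<bullet> b)))" by simp
  also have "\<dots> = (\<integral>\<^sup>+x. f (x \<bullet> b) \<partial>lborel)" by (rule nn_integral_distr) auto
  finally show ?thesis by simp
qed

lemma nn_integral_Times_fst:
  fixes f :: "'n::euclidean_space \<Rightarrow> ennreal" and K :: "'m::euclidean_space set"
  assumes [measurable]: "f \<in> borel_measurable borel" "K \<in> sets borel"
  shows "(\<integral>\<^sup>+x. f (fst x) * indicator K (snd x) \<partial>lborel) = (\<integral>\<^sup>+u. f u \<partial>lborel) * emeasure lborel K"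
proof -
  have "(\<integral>\<^sup>+x. f (fst x) * indicator K (snd x) \<partial>(lborel :: ('n \<times> 'm) measure))
    = (\<integral>\<^sup>+x. f (fst x) * indicator K (snd x) \<partial>(lborel \<Otimes>\<^sub>M lborel))"
    by (simp only: lborel_prod)
  also have "\<dots> = (\<integral>\<^sup>+u. \<integral>\<^sup>+v. f u * indicator K v \<partial>lborel \<partial>lborel)"
    by (subst lborel.nn_integral_fst [symmetric]) auto
  also have "\<dots> = (\<integral>\<^sup>+u. f u \<partial>lborel) * emeasure lborel K"
    by (simp add: nn_integral_cmult nn_integral_multc)
  finally show ?thesis .
qed

section \<open>The arsinh profile and its deviation from constants\<close>

lemma arsinh_bounds:
  fixes y :: real
  assumes "0 < y"
  shows "ln (2 * y) \<le> arsinh y" "arsinh y \<le> ln (2 * y + 1)" "0 < arsinh y"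
proof -
  have "y \<le> sqrt (y\<^sup>2 + 1)" using assms by (intro real_le_rsqrt) simp
  moreover have "sqrt (y\<^sup>2 + 1) \<le> y + 1" using assms by (intro real_le_lsqrt) (auto simp: power2_sum)
  ultimately show "ln (2 * y) \<le> arsinh y" "arsinh y \<le> ln (2 * y + 1)"
    using assms by (auto simp: arsinh_real_def)
  have "arsinh 0 < arsinh y" using assms by (simp only: arsinh_less_iff_real)
  then show "0 < arsinh y" by simp
qed

text \<open>The profile is the antiderivative of \<open>1 / sqrt (s\<^sup>2 + e\<^sup>2)\<close>,
  the function that also dominates its energy density up to a factor. The total energy is thus
  measured by the profile itself.\<close>

lemma arsinh_scaled_derivative:
  fixes s e :: real
  assumes "0 < e"
  shows "((\<lambda>s. arsinh (s / e)) has_real_derivative 1 / sqrt (s\<^sup>2 + e\<^sup>2)) (at s within A)"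
proof -
  have "((\<lambda>s. arsinh (s / e)) has_real_derivative (1 / sqrt ((s / e)\<^sup>2 + 1)) * (1 / e)) (at s within A)"
    using assms by (intro DERIV_chain2 [OF arsinh_real_has_field_derivative]) (auto intro!: derivative_eq_intros)
  also have "(1 / sqrt ((s / e)\<^sup>2 + 1)) * (1 / e) = 1 / sqrt (s\<^sup>2 + e\<^sup>2)"
  proof -
    have "s\<^sup>2 + e\<^sup>2 = e\<^sup>2 * ((s / e)\<^sup>2 + 1)" using assms by (simp add: power_divide field_simps)
    then have "sqrt (s\<^sup>2 + e\<^sup>2) = e * sqrt ((s / e)\<^sup>2 + 1)" using assms by (simp add: real_sqrt_mult)
    then show ?thesis using assms by simp
  qed
  finally show ?thesis .
qed

lemma nn_integral_inverse_sqrt: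
  fixes e R :: real
  assumes "0 < e" "0 < R"
  shows "(\<integral>\<^sup>+s\<in>{-R<..<R}. ennreal (1 / sqrt (s\<^sup>2 + e\<^sup>2)) \<partial>lborel) \<le> ennreal (2 * arsinh (R / e))"
proof -
  have "(\<integral>\<^sup>+s\<in>{-R<..<R}. ennreal (1 / sqrt (s\<^sup>2 + e\<^sup>2)) \<partial>lborel)
    \<le> (\<integral>\<^sup>+s. ennreal (1 / sqrt (s\<^sup>2 + e\<^sup>2)) * indicator {-R..R} s \<partial>lborel)"
    by (intro nn_integral_mono) (auto simp: indicator_def)
  also have "\<dots> = ennreal (arsinh (R / e) - arsinh (- R / e))"
    by (rule nn_integral_FTC_Icc) (use assms arsinh_scaled_derivative in auto)
  also have "arsinh (R / e) - arsinh (- R / e) = 2 * arsinh (R / e)"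
    by (simp add: arsinh_minus_real)
  finally show ?thesis .
qed

text \<open>According to the sign of \<open>m\<close>, the values of \<open>\<phi>\<close> on
  \<open>P\<close> or on \<open>Q\<close> are at distance at least 1/2 from
  \<open>m\<close>.\<close>

lemma square_deviation_two_sided:
  fixes \<phi> :: "'a \<Rightarrow> real"
  assumes sets: "P \<in> sets M" "Q \<in> sets M" and sub: "P \<subseteq> V" "Q \<subseteq> V"
    and P: "\<And>x. x \<in> P \<Longrightarrow> 1/2 \<le> \<phi> x" and Q: "\<And>x. x \<in> Q \<Longrightarrow> \<phi> x \<le> - (1/2)"
    and \<mu>: "\<mu> \<le> emeasure M P" "\<mu> \<le> emeasure M Q"
  shows "ennreal (1/4) * \<mu> \<le> (\<integral>\<^sup>+x\<in>V. ennreal ((\<phi> x - m)\<^sup>2) \<partial>M)"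
proof -
  have *: "ennreal (1/4) * \<mu> \<le> (\<integral>\<^sup>+x\<in>V. ennreal ((\<phi> x - m)\<^sup>2) \<partial>M)"
    if S: "S \<in> sets M" "S \<subseteq> V" "\<mu> \<le> emeasure M S" "\<And>x. x \<in> S \<Longrightarrow> 1/2 \<le> \<bar>\<phi> x - m\<bar>" for S
  proof -
    have "ennreal (1/4) * \<mu> \<le> ennreal (1/4) * emeasure M S" using S by (intro mult_left_mono) auto
    also have "\<dots> = (\<integral>\<^sup>+x. ennreal (1/4) * indicator S x \<partial>M)" using S by (simp add: nn_integral_cmult)
    also have "\<dots> \<le> (\<integral>\<^sup>+x\<in>V. ennreal ((\<phi> x - m)\<^sup>2) \<partial>M)"
    proof (rule nn_integral_mono)
      fix x
      have "ennreal (1/4) \<le> ennreal ((\<phi> x - m)\<^sup>2)" if "x \<in> S"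
      proof (rule ennreal_leI)
        have "(1/2)\<^sup>2 \<le> \<bar>\<phi> x - m\<bar>\<^sup>2" using S(4) [OF that] by (intro power_mono) auto
        then show "1/4 \<le> (\<phi> x - m)\<^sup>2" by (simp add: power2_eq_square)
      qed
      then show "ennreal (1/4) * indicator S x \<le> ennreal ((\<phi> x - m)\<^sup>2) * indicator V x"
        using S(2) by (cases "x \<in> S") auto
    qed
    finally show ?thesis .
  qed
  show ?thesis
  proof (cases "m \<le> 0")
    case True
    then show ?thesis using P sets sub \<mu> by (intro * [of P]) fastforce+
  next
    case False
    then show ?thesis using Q sets sub \<mu> by (intro * [of Q]) fastforce+
  qed
qed

context grushin_form
begin

text \<open>The choice of \<open>R\<close> and \<open>e\<close> bounds the squared weight by a
  multiple of \<open>max s e\<close>, so the energy density is at most a multiple of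
  \<open>1 / (L\<^sup>2 * sqrt (s\<^sup>2 + e\<^sup>2))\<close> and the energy is of order
  \<open>1 / L\<close>. On a fixed fraction of the box the normalized profile is at least 1/2 on one
  side and at most -1/2 on the other, so its deviation from any constant stays bounded below while
  \<open>L\<close> grows.\<close>

lemma poincare_fails:
  assumes n: "DIM('n) = 1" and D1: "1/2 \<le> D1"
    and lam: "0 < lam" and \<kappa>: "0 < \<kappa>"
    and poinc: "\<And>x r \<phi>. 0 < r \<Longrightarrow> C1_fun \<phi> \<Longrightarrow> poincare_at c lam r (ball_c c x r) (ball_c c x (\<kappa> * r)) \<phi>"
  shows False
proof -
  obtain b :: 'n where b: "Basis = {b}" using n by (metis card_1_singletonE)
  have "b \<in> Basis" by (simp add: b)
  then have bb: "b \<bullet> b = 1" "norm b = 1" by (rule inner_same_Basis, rule norm_Basis)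
  have norm_b: "norm u = \<bar>u \<bullet> b\<bar>" for u :: 'n
  proof -
    have "u = (u \<bullet> b) *\<^sub>R b" using euclidean_representation [of u] by (simp add: b)
    then have "norm u = norm ((u \<bullet> b) *\<^sub>R b)" by (rule arg_cong)
    then show ?thesis using bb by simp
  qed
  \<comment> \<open>The fraction for which the box of size \<open>\<eta> * R\<close> fits into the
    ball of radius \<open>\<kappa> * k1 * \<theta> R\<close>: by \<open>\<theta>_shrink\<close> this
    requires \<open>k2 * \<eta> powr (1 - D1) \<le> \<kappa> * k1\<close>.\<close>
  define \<eta> where "\<eta> = min 1 ((\<kappa> * k1 / k2) powr (1 / (1 - D1)))"
  have \<eta>: "0 < \<eta>" "\<eta> \<le> 1" using \<kappa> k_pos by (auto simp: \<eta>_def)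
  have \<eta>k: "k2 * \<eta> powr (1 - D1) \<le> \<kappa> * k1"
  proof -
    have "\<eta> powr (1 - D1) \<le> ((\<kappa> * k1 / k2) powr (1 / (1 - D1))) powr (1 - D1)"
      using \<eta> D by (intro powr_mono2) (auto simp: \<eta>_def)
    also have "\<dots> = \<kappa> * k1 / k2" using D \<kappa> k_pos by (simp add: powr_powr)
    finally show ?thesis using k_pos by (simp add: pos_le_divide_eq mult.commute)
  qed
  \<comment> \<open>Lower bound for the factor by which the radius \<open>\<theta> R * w2 R\<close>
    changes when \<open>R\<close> is replaced by \<open>\<eta> * R\<close>.\<close>
  define \<zeta> where "\<zeta> = \<eta> * \<eta> powr D2"
  have \<zeta>: "0 < \<zeta>" using \<eta> by (simp add: \<zeta>_def)
  \<comment> \<open>The largest value of \<open>L\<close> compatible with the assumed inequality,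
    read off from its final form below.\<close>
  define M where "M = 16 * a' * k1\<^sup>2 / (lam * \<eta> * \<zeta> ^ DIM('m))"
  \<comment> \<open>The exponential forces \<open>L > M\<close>; the term
    \<open>3 / \<eta>\<^sup>2\<close> gives \<open>2 * N + 1 \<le> (\<eta> * N)\<^sup>2\<close>,
    from which \<open>halfL\<close> follows.\<close>
  define N where "N = 3 / \<eta>\<^sup>2 + exp M + 1"
  have "0 < 3 / \<eta>\<^sup>2" "0 < exp M" using \<eta> by auto
  then have N: "1 \<le> N" "3 / \<eta>\<^sup>2 \<le> N" "exp M < N" unfolding N_def by linarith+
  obtain R e where R: "0 < R" "0 < e" "R / e = N"
    and wR: "\<And>s. 0 \<le> s \<Longrightarrow> s \<le> R \<Longrightarrow> (w1 s)\<^sup>2 \<le> (w1 R)\<^sup>2 / R * max s e"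
    using degenerate_scales [OF D1 N(1)] by blast
  define L where "L = arsinh N"
  have L: "M < L" "0 < L"
  proof -
    have "M < ln N" using N by (metis exp_gt_zero less_trans ln_exp ln_less_cancel_iff)
    also have "\<dots> \<le> ln (2 * N)" using N by simp
    also have "\<dots> \<le> L" unfolding L_def using N by (intro arsinh_bounds) auto
    finally show "M < L" .
    show "0 < L" unfolding L_def using N by (intro arsinh_bounds) auto
  qed
  have halfL: "L / 2 \<le> arsinh (\<eta> * N / 2)"
  proof -
    have "3 \<le> N * \<eta>\<^sup>2" using N(2) \<eta> by (simp add: pos_divide_le_eq)
    then have "3 * N \<le> N * \<eta>\<^sup>2 * N" using N by (intro mult_right_mono) auto
    moreover have "(\<eta> * N)\<^sup>2 = N * \<eta>\<^sup>2 * N" by (simp add: power2_eq_square mult_ac)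
    ultimately have "2 * N + 1 \<le> (\<eta> * N)\<^sup>2" using N(1) by linarith
    then have "ln (2 * N + 1) \<le> ln ((\<eta> * N)\<^sup>2)" using N \<eta> by simp
    also have "\<dots> = 2 * ln (2 * (\<eta> * N / 2))" using N \<eta> by (simp add: ln_realpow)
    also have "\<dots> \<le> 2 * arsinh (\<eta> * N / 2)" using N \<eta> by (intro mult_left_mono arsinh_bounds) auto
    finally show ?thesis using arsinh_bounds(2) [of N] N by (simp add: L_def)
  qed
  define \<phi> where "\<phi> x = arsinh ((fst x \<bullet> b) / e) / L" for x :: "'n \<times> 'm"
  define g where "g x = (1 / (L * sqrt ((fst x \<bullet> b)\<^sup>2 + e\<^sup>2))) *\<^sub>R (b, 0 :: 'm)" for x :: "'n \<times> 'm"
  have der: "(\<phi> has_derivative (\<lambda>v. g x \<bullet> v)) (at x)" for x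
  proof -
    have "((\<lambda>x :: 'n \<times> 'm. fst x \<bullet> b) has_derivative (\<lambda>v. fst v \<bullet> b)) (at x)"
      by (auto intro!: derivative_eq_intros)
    from DERIV_compose_FDERIV [OF arsinh_scaled_derivative [OF R(2)] this]
    have "((\<lambda>x. arsinh ((fst x \<bullet> b) / e)) has_derivative (\<lambda>v. (fst v \<bullet> b) * (1 / sqrt ((fst x \<bullet> b)\<^sup>2 + e\<^sup>2)))) (at x)" .
    then have "(\<phi> has_derivative (\<lambda>v. (1 / L) * ((fst v \<bullet> b) * (1 / sqrt ((fst x \<bullet> b)\<^sup>2 + e\<^sup>2))))) (at x)"
      unfolding \<phi>_def using has_derivative_mult_right [of _ _ _ "1 / L"] by fastforce
    then show ?thesis by (simp add: g_def inner_prod_def inner_commute mult.commute)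
  qed
  have pos: "0 < s\<^sup>2 + e\<^sup>2" for s :: real using R by (simp add: add_nonneg_pos)
  have "continuous_on UNIV g" unfolding g_def
    by (intro continuous_intros) (use L pos in \<open>auto simp: less_imp_neq [symmetric]\<close>)
  then have C1: "C1_fun \<phi>" by (rule C1_funI [OF der])
  have grad: "grad \<phi> x = g x" for x by (rule grad_eqI [OF der])
  define K where "K = ball (0 :: 'm) (\<theta> R * w2 R)"
  define f where "f s = (w1 R)\<^sup>2 / R / L\<^sup>2 * (1 / sqrt (s\<^sup>2 + e\<^sup>2))" for s
  have [measurable]: "f \<in> borel_measurable borel" unfolding f_def [abs_def] by measurable
  have [measurable]: "K \<in> sets borel" by (simp add: K_def)
  have en: "energy \<phi> x \<le> f (fst x \<bullet> b)" if x: "x \<in> nbox (0 :: 'm) R" for x :: "'n \<times> 'm"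
  proof -
    define s where "s = \<bar>fst x \<bullet> b\<bar>"
    have s: "0 \<le> s" "s \<le> R" using x by (auto simp: nbox_def b s_def)
    have "max s e \<le> sqrt (s\<^sup>2 + e\<^sup>2)" using s R by (auto intro!: real_le_rsqrt)
    then have m: "max s e / (s\<^sup>2 + e\<^sup>2) \<le> 1 / sqrt (s\<^sup>2 + e\<^sup>2)"
      using pos [of s] by (simp add: divide_le_eq real_div_sqrt less_imp_le)
    have "energy \<phi> x = (w1 s)\<^sup>2 * (1 / (L\<^sup>2 * (s\<^sup>2 + e\<^sup>2)))"
      using pos [of "fst x \<bullet> b"] L bb
      by (simp add: energy_def grad g_def norm_b s_def power_mult_distrib power_divide)
    also have "\<dots> \<le> ((w1 R)\<^sup>2 / R * max s e) * (1 / (L\<^sup>2 * (s\<^sup>2 + e\<^sup>2)))"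
      using wR [OF s] pos [of s] by (intro mult_right_mono) auto
    also have "\<dots> = (w1 R)\<^sup>2 / R / L\<^sup>2 * (max s e / (s\<^sup>2 + e\<^sup>2))" by simp
    also have "\<dots> \<le> f s" unfolding f_def using m R by (intro mult_left_mono) auto
    also have "f s = f (fst x \<bullet> b)" by (simp add: f_def s_def)
    finally show ?thesis .
  qed
  define r where "r = k1 * \<theta> R"
  have r: "0 < r" using k_pos \<theta>_pos R by (simp add: r_def)
  have U: "ball_c c 0 r \<subseteq> nbox 0 R"
    using near_lower [of 0 R] R by (simp add: r_def)
  have upper: "(\<integral>\<^sup>+x\<in>ball_c c 0 r. ennreal (Gam c \<phi> x) \<partial>lebesgue)
      \<le> ennreal (a' * (2 * ((w1 R)\<^sup>2 / R / L))) * emeasure lborel K"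
  proof -
    have "(\<integral>\<^sup>+x\<in>ball_c c 0 r. ennreal (Gam c \<phi> x) \<partial>lebesgue)
      \<le> (\<integral>\<^sup>+x. (ennreal (a' * f (fst x \<bullet> b)) * indicator {-R<..<R} (fst x \<bullet> b)) * indicator K (snd x) \<partial>lebesgue)"
    proof (rule nn_integral_mono_AE)
      show "AE x in lebesgue. ennreal (Gam c \<phi> x) * indicator (ball_c c 0 r) x
        \<le> ennreal (a' * f (fst x \<bullet> b)) * indicator {-R<..<R} (fst x \<bullet> b) * indicator K (snd x)"
        using Gam_bounds
      proof eventually_elim
        case (elim x)
        show ?case
        proof (cases "x \<in> ball_c c 0 r")
          case True
          then have x: "x \<in> nbox 0 R" using U by auto
          have "Gam c \<phi> x \<le> a' * energy \<phi> x" using elim by blast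
          also have "\<dots> \<le> a' * f (fst x \<bullet> b)" using a en [OF x] by (intro mult_left_mono) auto
          finally show ?thesis using x by (auto simp: nbox_def b K_def indicator_def abs_less_iff intro: ennreal_leI)
        qed simp
      qed
    qed
    also have "\<dots> = (\<integral>\<^sup>+x. (ennreal (a' * f (fst x \<bullet> b)) * indicator {-R<..<R} (fst x \<bullet> b)) * indicator K (snd x) \<partial>lborel)"
      by (rule nn_integral_completion)
    also have "\<dots> = (\<integral>\<^sup>+u. ennreal (a' * f (u \<bullet> b)) * indicator {-R<..<R} (u \<bullet> b) \<partial>(lborel :: 'n measure)) * emeasure lborel K"
      by (rule nn_integral_Times_fst [of "\<lambda>u. ennreal (a' * f (u \<bullet> b)) * indicator {-R<..<R} (u \<bullet> b)"]) auto
    also have "(\<integral>\<^sup>+u. ennreal (a' * f (u \<bullet> b)) * indicator {-R<..<R} (u \<bullet> b) \<partial>(lborel :: 'n measure))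
      = (\<integral>\<^sup>+s. ennreal (a' * f s) * indicator {-R<..<R} s \<partial>lborel)"
      by (rule nn_integral_lborel_line [OF b]) auto
    also have "\<dots> = (\<integral>\<^sup>+s\<in>{-R<..<R}. ennreal (a' * ((w1 R)\<^sup>2 / R / L\<^sup>2) * (1 / sqrt (s\<^sup>2 + e\<^sup>2))) \<partial>lborel)"
      by (simp only: f_def mult.assoc)
    also have "\<dots> = ennreal (a' * ((w1 R)\<^sup>2 / R / L\<^sup>2)) * (\<integral>\<^sup>+s\<in>{-R<..<R}. ennreal (1 / sqrt (s\<^sup>2 + e\<^sup>2)) \<partial>lborel)"
      by (rule set_nn_integral_cmult_ennreal) (use a R in auto)
    also have "\<dots> \<le> ennreal (a' * ((w1 R)\<^sup>2 / R / L\<^sup>2)) * ennreal (2 * L)"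
      using nn_integral_inverse_sqrt [OF R(2,1)] by (intro mult_left_mono) (auto simp: R L_def)
    also have "\<dots> = ennreal (a' * (2 * ((w1 R)\<^sup>2 / R / L)))"
      using a R L by (subst ennreal_mult' [symmetric]) (auto simp: power2_eq_square field_simps)
    finally show ?thesis by (simp add: mult_right_mono)
  qed
  define R' where "R' = \<eta> * R"
  have R': "0 < R'" using \<eta> R by (simp add: R'_def)
  define K' where "K' = ball (0 :: 'm) (\<theta> R' * w2 R')"
  have V: "nbox 0 R' \<subseteq> ball_c c 0 (\<kappa> * r)"
  proof -
    have "k2 * \<theta> R' \<le> k2 * (\<eta> powr (1 - D1) * \<theta> R)"
      unfolding R'_def using \<theta>_shrink [OF \<eta> R(1)] k_pos by (intro mult_left_mono) auto
    also have "\<dots> \<le> \<kappa> * k1 * \<theta> R"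
      unfolding mult.assoc [symmetric] using \<eta>k \<theta>_pos [OF R(1)] by (intro mult_right_mono) auto
    finally have "ball_c c 0 (k2 * \<theta> R') \<subseteq> ball_c c 0 (\<kappa> * r)"
      unfolding r_def by (intro ball_c_mono) (simp add: mult.assoc)
    moreover have "nbox 0 R' \<subseteq> ball_c c 0 (k2 * \<theta> R')"
      using near_upper [of 0 R'] R' by auto
    ultimately show ?thesis by blast
  qed
  define P where "P \<sigma> = (corner (\<lambda>_. \<sigma>) R' :: 'n set) \<times> K'" for \<sigma>
  have Pborel: "P \<sigma> \<in> sets borel" for \<sigma>
    unfolding P_def K'_def corner_def by (intro borel_open open_Times open_box open_ball)
  then have Psets: "P \<sigma> \<in> sets lebesgue" for \<sigma> by simp
  have Psub: "P \<sigma> \<subseteq> ball_c c 0 (\<kappa> * r)" for \<sigma>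
  proof -
    have "P \<sigma> \<subseteq> nbox 0 R'"
      using R' by (cases \<sigma>) (auto simp: P_def K'_def nbox_def corner_facts(2) [OF R'] b)
    then show ?thesis using V by blast
  qed
  have large: "1/2 \<le> arsinh (s / e) / L" if "R'/2 \<le> s" for s
  proof -
    have "\<eta> * N / 2 = R' / 2 / e" by (simp add: R'_def R(3) [symmetric])
    also have "\<dots> \<le> s / e" using that R by (intro divide_right_mono) auto
    finally have "arsinh (\<eta> * N / 2) \<le> arsinh (s / e)" using arsinh_less_iff_real [of "s / e" "\<eta> * N / 2"] by linarith
    then show ?thesis using halfL L by (simp add: pos_le_divide_eq)
  qed
  have Pm: "emeasure lebesgue (P \<sigma>) = ennreal (R'/2) * emeasure lborel K'" for \<sigma>
  proof -
    have "emeasure lebesgue (P \<sigma>) = emeasure lborel (P \<sigma>)"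
      using Pborel by simp
    also have "\<dots> = emeasure lborel (corner (\<lambda>_. \<sigma>) R' :: 'n set) * emeasure lborel K'"
      unfolding P_def by (rule emeasure_lborel_Times) (auto simp: corner_def K'_def)
    finally show ?thesis using corner_facts(1) [OF R', of "\<lambda>_ :: 'n. \<sigma>"] n by simp
  qed
  have lower: "ennreal (1/4) * (ennreal (R'/2) * emeasure lborel K')
      \<le> (\<integral>\<^sup>+x\<in>ball_c c 0 (\<kappa> * r). ennreal ((\<phi> x - avg (ball_c c 0 (\<kappa> * r)) \<phi>)\<^sup>2) \<partial>lebesgue)"
  proof (rule square_deviation_two_sided [OF Psets Psets Psub Psub])
    show "1/2 \<le> \<phi> x" if "x \<in> P True" for x
      using that large [of "fst x \<bullet> b"] by (auto simp: P_def corner_facts(2) [OF R'] b \<phi>_def)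
    show "\<phi> x \<le> - (1/2)" if "x \<in> P False" for x
    proof -
      have "fst x \<bullet> b < - (R'/2)" using that by (auto simp: P_def corner_facts(2) [OF R'] b)
      then have "1/2 \<le> arsinh (- (fst x \<bullet> b) / e) / L" by (intro large) simp
      also have "\<dots> = - \<phi> x" by (simp add: \<phi>_def arsinh_minus_real)
      finally show ?thesis by simp
    qed
  qed (auto simp: Pm)
  define v where "v = unit_ball_vol (real DIM('m))"
  have v: "0 < v" by (simp add: v_def)
  have rad: "0 < \<theta> R * w2 R" using \<theta>_pos w_pos R by simp
  have rad': "\<zeta> * (\<theta> R * w2 R) \<le> \<theta> R' * w2 R'"
  proof -
    have "\<eta> * \<theta> R \<le> \<theta> R'"
      unfolding \<theta>_def R'_def using \<eta> R w_pos(1) [of "\<eta> * R"] w_mono(1) [of "\<eta> * R" R]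
      by (simp add: frac_le mult_left_le_one_le)
    moreover have "\<eta> powr D2 * w2 R \<le> w2 R'" unfolding R'_def using w_scale(2) [OF \<eta> R(1)] .
    ultimately have "(\<eta> * \<theta> R) * (\<eta> powr D2 * w2 R) \<le> \<theta> R' * w2 R'"
      using \<theta>_pos [OF R'] w_nonneg by (intro mult_mono) auto
    then show ?thesis by (simp add: \<zeta>_def mult_ac)
  qed
  define q where "q = v * (\<theta> R * w2 R) ^ DIM('m)"
  have q: "0 < q" using v rad by (simp add: q_def)
  have K: "emeasure lborel K = ennreal q"
    unfolding K_def q_def v_def using rad by (intro emeasure_ball) auto
  have K': "ennreal (\<zeta> ^ DIM('m) * q) \<le> emeasure lborel K'"
  proof -
    have "\<zeta> ^ DIM('m) * q = v * (\<zeta> * (\<theta> R * w2 R)) ^ DIM('m)" by (simp add: q_def power_mult_distrib)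
    also have "\<dots> \<le> v * (\<theta> R' * w2 R') ^ DIM('m)"
      using rad rad' \<zeta> v by (intro mult_left_mono power_mono) auto
    finally have "ennreal (\<zeta> ^ DIM('m) * q) \<le> ennreal (v * (\<theta> R' * w2 R') ^ DIM('m))" by (rule ennreal_leI)
    also have "\<dots> = emeasure lborel K'"
      unfolding K'_def v_def using rad rad' \<zeta> by (intro emeasure_ball [symmetric]) (meson less_imp_le mult_pos_pos order_trans)
    finally show ?thesis .
  qed
  have "ennreal (lam / r\<^sup>2 * (1/4 * (R'/2 * (\<zeta> ^ DIM('m) * q))))
     = ennreal (lam / r\<^sup>2) * (ennreal (1/4) * (ennreal (R'/2) * ennreal (\<zeta> ^ DIM('m) * q)))"
    using lam R' by (simp only: ennreal_mult' zero_le_divide_iff zero_le_power2 less_imp_le zero_le_numeral zero_le_one simp_thms)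
  also have "\<dots> \<le> ennreal (lam / r\<^sup>2) * (ennreal (1/4) * (ennreal (R'/2) * emeasure lborel K'))"
    by (intro mult_left_mono K') auto
  also have "\<dots> \<le> ennreal (lam / r\<^sup>2) *
      (\<integral>\<^sup>+x\<in>ball_c c 0 (\<kappa> * r). ennreal ((\<phi> x - avg (ball_c c 0 (\<kappa> * r)) \<phi>)\<^sup>2) \<partial>lebesgue)"
    by (rule mult_left_mono [OF lower]) simp
  also have "\<dots> \<le> (\<integral>\<^sup>+x\<in>ball_c c 0 r. ennreal (Gam c \<phi> x) \<partial>lebesgue)"
    using poinc [OF r C1] by (simp add: poincare_at_def)
  also have "\<dots> \<le> ennreal (a' * (2 * ((w1 R)\<^sup>2 / R / L))) * ennreal q"
    using upper K by simp
  also have "\<dots> = ennreal (a' * (2 * ((w1 R)\<^sup>2 / R / L)) * q)"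
    using a R L by (intro ennreal_mult' [symmetric]) auto
  finally have "lam / r\<^sup>2 * (1/4 * (R'/2 * (\<zeta> ^ DIM('m) * q))) \<le> a' * (2 * ((w1 R)\<^sup>2 / R / L)) * q"
    using a R L q by (subst (asm) ennreal_le_iff) auto
  then have "(lam / r\<^sup>2 * (1/4 * (R'/2 * \<zeta> ^ DIM('m)))) * q \<le> a' * (2 * ((w1 R)\<^sup>2 / R / L)) * q"
    by (simp only: mult.assoc)
  then have "lam / r\<^sup>2 * (1/4 * (R'/2 * \<zeta> ^ DIM('m))) \<le> a' * (2 * ((w1 R)\<^sup>2 / R / L))"
    using q by (simp only: mult_le_cancel_right_pos)
  \<comment> \<open>With \<open>r = k1 * R / w1 R\<close> both sides become multiples of
    \<open>(w1 R)\<^sup>2 / R\<close>. This factor cancels, and a bound on \<open>L\<close> by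
    scale-independent quantities remains.\<close>
  moreover have "lam / r\<^sup>2 * (1/4 * (R'/2 * \<zeta> ^ DIM('m))) = (lam * \<eta> * \<zeta> ^ DIM('m) / (8 * k1\<^sup>2)) * ((w1 R)\<^sup>2 / R)"
    using R w_pos(1) [OF R(1)] k_pos
    by (simp add: r_def R'_def \<theta>_def power_mult_distrib power_divide power2_eq_square; simp add: mult_ac)
  ultimately have "(lam * \<eta> * \<zeta> ^ DIM('m) / (8 * k1\<^sup>2)) * ((w1 R)\<^sup>2 / R) \<le> (2 * a' / L) * ((w1 R)\<^sup>2 / R)"
    by (simp add: mult_ac)
  then have "lam * \<eta> * \<zeta> ^ DIM('m) / (8 * k1\<^sup>2) \<le> 2 * a' / L"
    using R w_pos(1) [OF R(1)] by (subst (asm) mult_le_cancel_right_pos) auto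
  then have "L \<le> M"
    using L k_pos lam \<eta> \<zeta> by (simp add: M_def pos_le_divide_eq divide_le_eq pos_divide_le_eq mult_ac)
  then show False using L by simp
qed

end

theorem theorem1p1:
  fixes c :: "('n::euclidean_space \<times> 'm::euclidean_space) \<Rightarrow> ('n \<times> 'm) \<Rightarrow> ('n \<times> 'm) \<Rightarrow> real"
    and a a' \<delta>1 \<delta>1' \<delta>2 \<delta>2' :: real
  assumes "0 \<le> \<delta>1" "\<delta>1 < 1" "0 \<le> \<delta>1'" "\<delta>1' < 1" "0 \<le> \<delta>2" "0 \<le> \<delta>2'"
    and "0 < a" "0 < a'"
    and "coeff_ok a a' \<delta>1 \<delta>1' \<delta>2 \<delta>2' c"
  shows
   "((DIM('n) \<ge> 2 \<or> (DIM('n) = 1 \<and> max \<delta>1 \<delta>1' < 1/2)) \<longrightarrow>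
      (\<exists>lam>0. \<exists>\<kappa>. 0 < \<kappa> \<and> \<kappa> \<le> 1 \<and>
         (\<forall>x. \<forall>r>0. \<forall>\<phi>. C1_fun \<phi> \<longrightarrow>
            poincare_at c lam r (ball_c c x r) (ball_c c x (\<kappa> * r)) \<phi>)))
    \<and>
    ((DIM('n) = 1 \<and> 1/2 \<le> max \<delta>1 \<delta>1') \<longrightarrow>
      \<not> (\<exists>lam>0. \<exists>\<kappa>. 0 < \<kappa> \<and> \<kappa> \<le> 1 \<and>
         (\<forall>x. \<forall>r>0. \<forall>\<phi>. C1_fun \<phi> \<longrightarrow>
            poincare_at c lam r (ball_c c x r) (ball_c c x (\<kappa> * r)) \<phi>)))
    \<and>
    ((DIM('n) = 1 \<and> 1/2 \<le> \<delta>1) \<longrightarrow>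
      (\<exists>lam>0. \<exists>\<kappa>. 0 < \<kappa> \<and> \<kappa> \<le> 1 \<and>
         (\<forall>s. \<forall>x\<in>half s. \<forall>r>0. \<forall>\<phi>. C1_fun \<phi> \<longrightarrow>
            poincare_at c lam r (ball_c c x r \<inter> half s) (ball_c c x (\<kappa> * r) \<inter> half s) \<phi>)))"
proof -
  interpret grushin_form \<delta>1 \<delta>1' \<delta>2 \<delta>2' a a' c
    using assms by unfold_locales auto
  show ?thesis
  proof (intro conjI impI)
    assume "DIM('n) \<ge> 2 \<or> (DIM('n) = 1 \<and> max \<delta>1 \<delta>1' < 1/2)"
    then show "\<exists>lam>0. \<exists>\<kappa>. 0 < \<kappa> \<and> \<kappa> \<le> 1 \<and> (\<forall>x. \<forall>r>0. \<forall>\<phi>. C1_fun \<phi> \<longrightarrow>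
        poincare_at c lam r (ball_c c x r) (ball_c c x (\<kappa> * r)) \<phi>)"
      by (intro poincare_whole) (auto simp: D1_def)
  next
    assume "DIM('n) = 1 \<and> 1/2 \<le> max \<delta>1 \<delta>1'"
    then have "DIM('n) = 1" "1/2 \<le> D1" by (auto simp: D1_def)
    then show "\<not> (\<exists>lam>0. \<exists>\<kappa>. 0 < \<kappa> \<and> \<kappa> \<le> 1 \<and> (\<forall>x. \<forall>r>0. \<forall>\<phi>. C1_fun \<phi> \<longrightarrow>
        poincare_at c lam r (ball_c c x r) (ball_c c x (\<kappa> * r)) \<phi>))"
      using poincare_fails by metis
  next
    assume "DIM('n) = 1 \<and> 1/2 \<le> \<delta>1"
    then show "\<exists>lam>0. \<exists>\<kappa>. 0 < \<kappa> \<and> \<kappa> \<le> 1 \<and> (\<forall>s. \<forall>x\<in>half s. \<forall>r>0. \<forall>\<phi>. C1_fun \<phi> \<longrightarrow>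
        poincare_at c lam r (ball_c c x r \<inter> half s) (ball_c c x (\<kappa> * r) \<inter> half s) \<phi>)"
      using poincare_half by blast
  qed
qed

end
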